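(* Let $n\ge 0$ be an integer and $t\ge 0$. Let the initial configuration consist of $n$ points chosen independently and uniformly on $[0,1]$ (arranged in increasing order), and let it evolve for time $t$ under the coarsening evolution $\Phi_t$ on $[0,1]$ with stationary extra particles at the endpoints $0$ and $1$. Then the law of the configuration of (non-endpoint) particles at time $t$ is that of $Z$ points chosen uniformly and independently on $[0,1]$, where $Z$ is a binomial random variable with parameters $n$ and $e^{-2t}$.
   Context: For $n\ge 0$ let $\Delta_n=\{\mathbf{x}=(x_0,x_1,\dots,x_n,x_{n+1}) : 0=x_0\le x_1\le\cdots\le x_n\le x_{n+1}=1\}$, with $\Delta_0=\{(0,1)\}$. An element represents $n$ particles in $[0,1]$ together with two stationary extra particles at $0$ and $1$. Let $\Delta_n^o$ be the subset where all inequalities are strict ($\Delta_0^o=\Delta_0$), let $\partial\Delta_n=\Delta_n\setminus\Delta_n^o$, and let $\Delta=\biguplus_{n\ge0}\Delta_n^o$. The map $\pi:\Delta_n\to\bigcup_{k\le n}\Delta_k^o$ omits repeated entries. Let $A_n$ be the $(n+2)\times(n+2)$ matrix with $(A_n\mathbf{x})_0=(A_n\mathbf{x})_{n+1}=0$ and $(A_n\mathbf{x})_i=-x_{i-1}+2x_i-x_{i+1}$ for $1\le i\le n$. For $\mathbf{x}\in\Delta_n^o$ let $\tau(\mathbf{x})=\inf\{t: e^{tA_n}\mathbf{x}\in\partial\Delta_n\}$. The evolution $\Phi_t:\Delta\to\Delta$ is defined recursively in $n$: $\Phi_t$ is the identity on $\Delta_0$, and for $\mathbf{x}\in\Delta_n^o$,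 $\Phi_t(\mathbf{x})=e^{tA_n}\mathbf{x}$ if $t<\tau(\mathbf{x})$, and $\Phi_t(\mathbf{x})=\Phi_{t-\tau(\mathbf{x})}\big(\pi(e^{\tau(\mathbf{x})A_n}\mathbf{x})\big)$ if $t\ge\tau(\mathbf{x})$. Thus particles that collide with each other merge, and particles that collide with an endpoint are absorbed. *)

theory Defs
  imports "HOL-Probability.Probability" "Jordan_Normal_Form.Matrix"
begin

text \<open>A configuration of \<open>n\<close> particles is a list \<open>[x\<^sub>0, \<dots>, x\<^sub>n\<^sub>+\<^sub>1]\<close> of length \<open>n + 2\<close> which includes the
  two stationary particles \<open>x\<^sub>0 = 0\<close> and \<open>x\<^sub>n\<^sub>+\<^sub>1 = 1\<close>.\<close>

definition Delta :: "nat \<Rightarrow> real list set" where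
  "Delta n = {x. length x = n + 2 \<and> x ! 0 = 0 \<and> x ! (n + 1) = 1 \<and> sorted x}"

definition Delta_open :: "nat \<Rightarrow> real list set" where
  "Delta_open n = {x \<in> Delta n. sorted_wrt (<) x}"

definition Delta_boundary :: "nat \<Rightarrow> real list set" where
  "Delta_boundary n = Delta n - Delta_open n"

definition A_mat :: "nat \<Rightarrow> real mat" where
  "A_mat n = mat (n + 2) (n + 2) (\<lambda>(i, j).
     if i = 0 \<or> i = n + 1 then 0
     else if j = i then 2
     else if j + 1 = i \<or> j = i + 1 then - 1
     else 0)"

definition mat_exp :: "real mat \<Rightarrow> real mat" where
  "mat_exp B = mat (dim_row B) (dim_row B) (\<lambda>(i, j). \<Sum>k. (B ^\<^sub>m k) $$ (i, j) / fact k)"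

definition linear_flow :: "real \<Rightarrow> real list \<Rightarrow> real list" where
  "linear_flow t x =
     list_of_vec (mat_exp (t \<cdot>\<^sub>m A_mat (length x - 2)) *\<^sub>v vec_of_list x)"

text \<open>The first collision time is \<open>\<infinity>\<close> if no collision ever occurs, e.g. for equally spaced particles.\<close>

definition collision_time :: "real list \<Rightarrow> ereal" where
  "collision_time x =
     (INF s \<in> {s. 0 \<le> s \<and> linear_flow s x \<in> Delta_boundary (length x - 2)}. ereal s)"

text \<open>The map \<open>\<pi>\<close>, which omits repeated entries, is \<^const>\<open>remdups_adj\<close>, as configurations are sorted.
  The recursion terminates on configurations: the boundary is closed, so a finite collision time is
  attained, and \<open>\<pi>\<close> strictly decreases the length of the boundary configuration reached then. On a boundary
  configuration the collision time is \<open>0\<close>, so the same equation extends \<open>\<Phi>\<^sub>t\<close> by \<open>\<Phi>\<^sub>t \<circ> \<pi>\<close>; for random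
  initial points this concerns only a null set.\<close>

partial_function (tailrec) Phi :: "real \<Rightarrow> real list \<Rightarrow> real list" where
  "Phi t x =
     (if length x = 2 then x
      else if ereal t < collision_time x then linear_flow t x
      else Phi (t - real_of_ereal (collision_time x))
             (remdups_adj (linear_flow (real_of_ereal (collision_time x)) x)))"

definition add_endpoints :: "real list \<Rightarrow> real list" where
  "add_endpoints ys = 0 # ys @ [1]"

definition particles :: "real list \<Rightarrow> real list" where
  "particles x = butlast (tl x)"

text \<open>The Borel sigma-algebra of the disjoint union of the spaces \<open>\<real>\<^sup>n\<close> for \<open>n \<ge> 0\<close>, with
  elements of \<open>\<real>\<^sup>n\<close> represented as lists of length \<open>n\<close>.\<close>

definition particle_space :: "real list measure" where
  "particle_space = sigma UNIV
     {{ys. length ys = n \<and> (\<forall>i<n. ys ! i \<in> B i)} | n B. \<forall>i<n. B i \<in> sets borel}"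

text \<open>Lebesgue measure on \<open>[0,1]\<close> is the uniform distribution, and the product is the joint law of
  \<open>n\<close> independent uniform points.\<close>

definition uniform_points :: "nat \<Rightarrow> (nat \<Rightarrow> real) measure" where
  "uniform_points n = (\<Pi>\<^sub>M i\<in>{..<n}. restrict_space lborel {0..1})"

definition in_order :: "nat \<Rightarrow> (nat \<Rightarrow> real) \<Rightarrow> real list" where
  "in_order n u = sort (map u [0..<n])"

text \<open>The law, as an ordered configuration without the endpoints, of \<open>n\<close> independent uniform points.\<close>

definition uniform_config :: "nat \<Rightarrow> real list measure" where
  "uniform_config n = distr (uniform_points n) particle_space (in_order n)"

end

theory Submission
  imports Defs
begin

text \<open>The law of \<open>n\<close> ordered uniform points is normalised Lebesgue measure on the simplex \<^term>\<open>Delta n\<close>, and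
the theorem says that the coarsening evolution thins it like a pure death process in which each
particle dies at rate \<open>2\<close>. The reason becomes visible when time runs backwards. The backward flow
\<open>e\<^bsup>-rA\<^esup>\<close> is a discrete heat flow: the gaps between consecutive particles evolve by averaging,
so they stay nonnegative and a gap that is closed opens at once
(\<open>backward_flow_Delta\<close>, \<open>backward_flow_opens_gaps\<close>). Up to a null set, the simplex is therefore the
disjoint union of the points \<open>e\<^bsup>-tA\<^esup>y\<close> with \<open>y\<close> in the open simplex, which do not collide before
time \<open>t\<close>, and the points \<open>e\<^bsup>-rA\<^esup>y\<close> with \<open>0 < r \<le> t\<close> and \<open>y\<close> on a face, which collide first at time
\<open>r\<close> and then continue from \<open>y\<close> with its repeated entry omitted.

The vector field \<open>x \<mapsto> Ax\<close> has constant divergence \<open>2n\<close>, so that \<open>e\<^bsup>-rA\<^esup>\<close> shrinks volume by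
\<open>e\<^bsup>-2nr\<^esup>\<close>. A face is a copy of the simplex with one particle fewer, and the flux through all
faces over a point \<open>z\<close> of that simplex counts each gap of \<open>z\<close> twice: the particle that disappeared may
have merged with the left or with the right end of the gap that contained it. As the gaps of \<open>z\<close> add
up to \<open>1\<close>, the total flux is the constant \<open>2\<close>. In other words, collisions happen at a constant rate and
leave behind Lebesgue measure on the smaller simplex, and a recursion for the evolved integrals results
(\<open>evolved_Suc\<close>). Its solution has binomial weights (\<open>evolved_binomial\<close>).

The change of variables behind this decomposition is \<open>transport_formula\<close>. For a smooth
function \<open>h\<close> one differentiates \<open>e\<^bsup>-2nr\<^esup> \<integral> h (e\<^bsup>-rA\<^esup>y) dy\<close>, the integral being over the
simplex, in \<open>r\<close>. The divergence theorem, applied in one coordinate at a time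
(\<open>divergence_coordinate\<close>), turns the derivative into the flux term
(\<open>soft_box_transport_identity\<close>). Both sides of the resulting identity are integrals of \<open>h\<close> with
respect to finite measures, and smooth approximations of the indicators of boxes determine such a
measure (\<open>measure_eqI_soft_box\<close>), so the identity holds for all nonnegative measurable functions.

All integrals are taken over unordered configurations of independent uniform points, restricted to
those that happen to be ordered. A point can then be inserted at any position by the same product
measure (\<open>iid_config_Suc\<close>). This gives Fubini's theorem in each coordinate, and also the factor \<open>n!\<close>
between ordered and sorted configurations (\<open>nn_integral_sort_iid_config\<close>).\<close>

section \<open>The linear flow\<close>

text \<open>Sums over the \<open>n + 2\<close> coordinates are manipulated as a whole, so the simplifier must not split off
their last terms.\<close>

declare sum.lessThan_Suc [simp del] add_2_eq_Suc' [simp del] add_2_eq_Suc [simp del]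

definition flow_coeff :: "nat \<Rightarrow> real \<Rightarrow> nat \<Rightarrow> nat \<Rightarrow> real" where
  "flow_coeff n t i j = mat_exp (t \<cdot>\<^sub>m A_mat n) $$ (i, j)"

lemma A_mat_carrier [simp]: "A_mat n \<in> carrier_mat (n + 2) (n + 2)"
  by (simp add: A_mat_def)

lemma A_mat_pow_carrier [simp]: "A_mat n ^\<^sub>m k \<in> carrier_mat (n + 2) (n + 2)"
  by (simp add: pow_carrier_mat)

lemma index_mult_mat_sum:
  assumes "C \<in> carrier_mat m m" "D \<in> carrier_mat m m" "i < m" "j < m"
  shows "(C * D) $$ (i, j) = (\<Sum>l<m. C $$ (i, l) * D $$ (l, j))"
  using assms by (simp add: scalar_prod_def lessThan_atLeast0)

lemma A_mat_pow_Suc: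
  assumes "i < n + 2" "j < n + 2"
  shows "(A_mat n ^\<^sub>m Suc k) $$ (i, j) = (\<Sum>l<n + 2. (A_mat n ^\<^sub>m k) $$ (i, l) * A_mat n $$ (l, j))"
  using index_mult_mat_sum[OF A_mat_pow_carrier A_mat_carrier assms] by simp

lemma A_mat_pow_Suc':
  assumes "i < n + 2" "j < n + 2"
  shows "(A_mat n ^\<^sub>m Suc k) $$ (i, j) = (\<Sum>l<n + 2. A_mat n $$ (i, l) * (A_mat n ^\<^sub>m k) $$ (l, j))"
proof -
  have "A_mat n ^\<^sub>m Suc k = A_mat n * A_mat n ^\<^sub>m k"
  proof (induction k)
    case 0
    show ?case
      by (metis A_mat_carrier carrier_matD(1) left_mult_one_mat pow_mat.simps(1,2) right_mult_one_mat)
  next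
    case (Suc k)
    have "A_mat n ^\<^sub>m Suc (Suc k) = (A_mat n * A_mat n ^\<^sub>m k) * A_mat n"
      using Suc by simp
    also have "\<dots> = A_mat n * (A_mat n ^\<^sub>m k * A_mat n)"
      by (rule assoc_mult_mat) (rule A_mat_carrier A_mat_pow_carrier)+
    finally show ?case by simp
  qed
  then show ?thesis
    using index_mult_mat_sum[OF A_mat_carrier A_mat_pow_carrier assms] by metis
qed

lemma A_mat_pow_bound:
  assumes "i < n + 2" "j < n + 2"
  shows "\<bar>(A_mat n ^\<^sub>m k) $$ (i, j)\<bar> \<le> (2 * real (n + 2)) ^ k"
  using assms
proof (induction k arbitrary: i j)
  case 0
  then have "(A_mat n ^\<^sub>m 0) $$ (i, j) = (if i = j then 1 else 0)"
    by (simp add: A_mat_def)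
  then show ?case by simp
next
  case (Suc k)
  have entry: "\<bar>A_mat n $$ (l, j)\<bar> \<le> 2" if "l < n + 2" for l
    using that Suc.prems by (simp add: A_mat_def)
  have "\<bar>(A_mat n ^\<^sub>m Suc k) $$ (i, j)\<bar>
      \<le> (\<Sum>l<n + 2. \<bar>(A_mat n ^\<^sub>m k) $$ (i, l) * A_mat n $$ (l, j)\<bar>)"
    unfolding A_mat_pow_Suc[OF Suc.prems] by (rule sum_abs)
  also have "\<dots> \<le> (\<Sum>l<n + 2. (2 * real (n + 2)) ^ k * 2)"
    unfolding abs_mult
    by (intro sum_mono mult_mono) (use Suc entry in auto)
  also have "\<dots> = (2 * real (n + 2)) ^ Suc k" by simp
  finally show ?case .
qed

lemma smult_pow_mat_index:
  assumes "i < n + 2" "j < n + 2"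
  shows "((t \<cdot>\<^sub>m A_mat n) ^\<^sub>m k) $$ (i, j) = t ^ k * (A_mat n ^\<^sub>m k) $$ (i, j)"
  using assms
proof (induction k arbitrary: i j)
  case 0
  then show ?case by (simp add: A_mat_def)
next
  case (Suc k)
  have c: "t \<cdot>\<^sub>m A_mat n \<in> carrier_mat (n + 2) (n + 2)" by simp
  have "((t \<cdot>\<^sub>m A_mat n) ^\<^sub>m Suc k) $$ (i, j)
      = (\<Sum>l<n + 2. ((t \<cdot>\<^sub>m A_mat n) ^\<^sub>m k) $$ (i, l) * (t \<cdot>\<^sub>m A_mat n) $$ (l, j))"
    using index_mult_mat_sum[OF pow_carrier_mat[OF c] c Suc.prems] by simp
  also have "\<dots> = (\<Sum>l<n + 2. t ^ Suc k * ((A_mat n ^\<^sub>m k) $$ (i, l) * A_mat n $$ (l, j)))"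
  proof (rule sum.cong[OF refl])
    fix l assume "l \<in> {..<n + 2}"
    then have "l < n + 2" by simp
    moreover have "dim_row (A_mat n) = n + 2" "dim_col (A_mat n) = n + 2" by (simp_all add: A_mat_def)
    ultimately show "((t \<cdot>\<^sub>m A_mat n) ^\<^sub>m k) $$ (i, l) * (t \<cdot>\<^sub>m A_mat n) $$ (l, j)
        = t ^ Suc k * ((A_mat n ^\<^sub>m k) $$ (i, l) * A_mat n $$ (l, j))"
      using Suc by simp
  qed
  also have "\<dots> = t ^ Suc k * (A_mat n ^\<^sub>m Suc k) $$ (i, j)"
    unfolding A_mat_pow_Suc[OF Suc.prems] sum_distrib_left ..
  finally show ?case .
qed

lemma flow_coeff_series:
  assumes "i < n + 2" "j < n + 2"
  shows "flow_coeff n t i j = (\<Sum>k. (A_mat n ^\<^sub>m k) $$ (i, j) / fact k * t ^ k)"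
proof -
  have "dim_row (A_mat n) = n + 2" by (simp add: A_mat_def)
  then show ?thesis
    using assms by (simp add: flow_coeff_def mat_exp_def smult_pow_mat_index mult.commute)
qed

lemma flow_coeff_summable:
  assumes "i < n + 2" "j < n + 2"
  shows "summable (\<lambda>k. (A_mat n ^\<^sub>m k) $$ (i, j) / fact k * t ^ k)"
proof (rule summable_comparison_test)
  show "summable (\<lambda>k. inverse (fact k) * (2 * real (n + 2) * \<bar>t\<bar>) ^ k)"
    by (rule summable_exp)
  have "norm ((A_mat n ^\<^sub>m k) $$ (i, j) / fact k * t ^ k) \<le> inverse (fact k) * (2 * real (n + 2) * \<bar>t\<bar>) ^ k" for k
  proof -
    have "\<bar>(A_mat n ^\<^sub>m k) $$ (i, j)\<bar> * \<bar>t\<bar> ^ k / fact k \<le> (2 * real (n + 2)) ^ k * \<bar>t\<bar> ^ k / fact k"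
      by (intro divide_right_mono mult_right_mono A_mat_pow_bound assms) auto
    then show ?thesis
      by (simp add: abs_mult power_abs power_mult_distrib divide_simps)
  qed
  then show "\<exists>N. \<forall>k\<ge>N. norm ((A_mat n ^\<^sub>m k) $$ (i, j) / fact k * t ^ k)
      \<le> inverse (fact k) * (2 * real (n + 2) * \<bar>t\<bar>) ^ k" by blast
qed

lemma flow_coeff_0:
  assumes "i < n + 2" "j < n + 2"
  shows "flow_coeff n 0 i j = (if i = j then 1 else 0)"
proof -
  have d: "dim_row (A_mat n) = n + 2" by (simp add: A_mat_def)
  have "flow_coeff n 0 i j = (A_mat n ^\<^sub>m 0) $$ (i, j) / fact 0"
    unfolding flow_coeff_series[OF assms] by (rule powser_zero)
  then show ?thesis using assms d by simp
qed

lemma flow_coeff_DERIV_series: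
  assumes "i < n + 2" "j < n + 2"
  shows "((\<lambda>t. flow_coeff n t i j) has_field_derivative
            (\<Sum>k. (A_mat n ^\<^sub>m Suc k) $$ (i, j) / fact k * t ^ k)) (at t)"
proof -
  have "diffs (\<lambda>k. (A_mat n ^\<^sub>m k) $$ (i, j) / fact k) = (\<lambda>k. (A_mat n ^\<^sub>m Suc k) $$ (i, j) / fact k)"
    by (rule ext) (simp add: diffs_def divide_simps del: pow_mat.simps)
  then show ?thesis
    unfolding flow_coeff_series[OF assms]
    using termdiffs_strong_converges_everywhere[OF flow_coeff_summable[OF assms], of t] by simp
qed

lemma flow_coeff_DERIV_left:
  assumes "i < n + 2" "j < n + 2"
  shows "((\<lambda>t. flow_coeff n t i j) has_field_derivative
            (\<Sum>l<n + 2. A_mat n $$ (i, l) * flow_coeff n t l j)) (at t)"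
proof -
  have "(\<Sum>k. (A_mat n ^\<^sub>m Suc k) $$ (i, j) / fact k * t ^ k)
      = (\<Sum>k. \<Sum>l<n + 2. A_mat n $$ (i, l) * ((A_mat n ^\<^sub>m k) $$ (l, j) / fact k * t ^ k))"
    unfolding A_mat_pow_Suc'[OF assms] by (simp add: sum_distrib_right sum_divide_distrib mult.assoc)
  also have "\<dots> = (\<Sum>l<n + 2. \<Sum>k. A_mat n $$ (i, l) * ((A_mat n ^\<^sub>m k) $$ (l, j) / fact k * t ^ k))"
    by (intro suminf_sum summable_mult flow_coeff_summable) (use assms in auto)
  also have "\<dots> = (\<Sum>l<n + 2. A_mat n $$ (i, l) * flow_coeff n t l j)"
  proof (rule sum.cong[OF refl])
    fix l assume "l \<in> {..<n + 2}"
    then have l: "l < n + 2" by simp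
    show "(\<Sum>k. A_mat n $$ (i, l) * ((A_mat n ^\<^sub>m k) $$ (l, j) / fact k * t ^ k)) = A_mat n $$ (i, l) * flow_coeff n t l j"
      unfolding flow_coeff_series[OF l assms(2)] by (rule suminf_mult) (rule flow_coeff_summable[OF l assms(2)])
  qed
  finally show ?thesis using flow_coeff_DERIV_series[OF assms, of t] by simp
qed

lemma flow_coeff_DERIV_right:
  assumes "i < n + 2" "j < n + 2"
  shows "((\<lambda>t. flow_coeff n t i j) has_field_derivative
            (\<Sum>l<n + 2. flow_coeff n t i l * A_mat n $$ (l, j))) (at t)"
proof -
  have "(\<Sum>k. (A_mat n ^\<^sub>m Suc k) $$ (i, j) / fact k * t ^ k)
      = (\<Sum>k. \<Sum>l<n + 2. ((A_mat n ^\<^sub>m k) $$ (i, l) / fact k * t ^ k) * A_mat n $$ (l, j))"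
    unfolding A_mat_pow_Suc[OF assms]
    by (simp add: sum_distrib_right sum_distrib_left sum_divide_distrib mult.assoc mult.commute mult.left_commute)
  also have "\<dots> = (\<Sum>l<n + 2. \<Sum>k. ((A_mat n ^\<^sub>m k) $$ (i, l) / fact k * t ^ k) * A_mat n $$ (l, j))"
    by (intro suminf_sum summable_mult2 flow_coeff_summable) (use assms in auto)
  also have "\<dots> = (\<Sum>l<n + 2. flow_coeff n t i l * A_mat n $$ (l, j))"
  proof (rule sum.cong[OF refl])
    fix l assume "l \<in> {..<n + 2}"
    then have l: "l < n + 2" by simp
    show "(\<Sum>k. (A_mat n ^\<^sub>m k) $$ (i, l) / fact k * t ^ k * A_mat n $$ (l, j)) = flow_coeff n t i l * A_mat n $$ (l, j)"
      unfolding flow_coeff_series[OF assms(1) l]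
      by (rule suminf_mult2[symmetric]) (rule flow_coeff_summable[OF assms(1) l])
  qed
  finally show ?thesis using flow_coeff_DERIV_series[OF assms, of t] by simp
qed

text \<open>The group law follows from uniqueness for the differential equation: along \<open>r \<mapsto> e\<^bsup>rA\<^esup> e\<^bsup>(s+t-r)A\<^esup>\<close>
the derivatives of the two factors cancel, so the product is constant.\<close>

lemma flow_coeff_add:
  assumes "i < n + 2" "j < n + 2"
  shows "(\<Sum>l<n + 2. flow_coeff n s i l * flow_coeff n t l j) = flow_coeff n (s + t) i j"
proof -
  \<comment> \<open>Constant in \<open>r\<close>, with the two sides of the claim as its values at \<open>s\<close> and \<open>0\<close>.\<close>
  define g where "g r = (\<Sum>l<n + 2. flow_coeff n r i l * flow_coeff n (s + t - r) l j)" for r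
  have "(g has_field_derivative 0) (at r)" for r
  proof -
    have right: "((\<lambda>r. flow_coeff n (s + t - r) l j) has_field_derivative
        - (\<Sum>m<n + 2. A_mat n $$ (l, m) * flow_coeff n (s + t - r) m j)) (at r)" if "l < n + 2" for l
    proof -
      have "((\<lambda>r. s + t - r) has_field_derivative -1) (at r)"
        by (auto intro!: derivative_eq_intros)
      from DERIV_chain2[OF flow_coeff_DERIV_left[OF that assms(2)] this] show ?thesis by simp
    qed
    have "(g has_field_derivative
        (\<Sum>l<n + 2. flow_coeff n r i l * - (\<Sum>m<n + 2. A_mat n $$ (l, m) * flow_coeff n (s + t - r) m j)
          + (\<Sum>m<n + 2. flow_coeff n r i m * A_mat n $$ (m, l)) * flow_coeff n (s + t - r) l j)) (at r)"
      unfolding g_def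
      by (intro DERIV_sum DERIV_mult' flow_coeff_DERIV_right right) (use assms in auto)
    moreover have "(\<Sum>l<n + 2. (\<Sum>m<n + 2. flow_coeff n r i m * A_mat n $$ (m, l)) * flow_coeff n (s + t - r) l j)
        = (\<Sum>l<n + 2. flow_coeff n r i l * (\<Sum>m<n + 2. A_mat n $$ (l, m) * flow_coeff n (s + t - r) m j))"
      unfolding sum_distrib_left sum_distrib_right mult.assoc by (rule sum.swap)
    ultimately show ?thesis by (simp add: sum_subtractf)
  qed
  then have "g s = g 0" by (intro DERIV_isconst_all allI)
  moreover have "g 0 = flow_coeff n (s + t) i j"
  proof -
    have "g 0 = (\<Sum>l<n + 2. if l = i then flow_coeff n (s + t) l j else 0)"
      unfolding g_def by (rule sum.cong[OF refl]) (use assms in \<open>auto simp: flow_coeff_0\<close>)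
    then show ?thesis using assms by simp
  qed
  ultimately show ?thesis by (simp add: g_def)
qed

text \<open>The vector field \<open>x \<mapsto> Ax\<close> of the flow, in coordinates.\<close>

definition vel :: "real list \<Rightarrow> nat \<Rightarrow> real" where
  "vel x i = (if i = 0 \<or> Suc i = length x then 0 else 2 * x ! i - x ! (i - 1) - x ! (i + 1))"

lemma length_linear_flow_general: "length (linear_flow t x) = length x - 2 + 2"
  by (simp add: linear_flow_def mat_exp_def A_mat_def)

lemma length_linear_flow [simp]: "length x = n + 2 \<Longrightarrow> length (linear_flow t x) = n + 2"
  by (simp add: length_linear_flow_general)

lemma linear_flow_nth_general:
  assumes "i < length x - 2 + 2"
  shows "linear_flow t x ! i = (\<Sum>j<length x. flow_coeff (length x - 2) t i j * x ! j)"
proof -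
  have "dim_row (mat_exp (t \<cdot>\<^sub>m A_mat n)) = n + 2" "dim_col (mat_exp (t \<cdot>\<^sub>m A_mat n)) = n + 2" for n
    by (simp_all add: mat_exp_def A_mat_def)
  then show ?thesis
    using assms
    by (auto simp: linear_flow_def list_of_vec_index flow_coeff_def scalar_prod_def
        lessThan_atLeast0 vec_of_list_index intro!: sum.cong)
qed

lemma linear_flow_nth:
  assumes "length x = n + 2" "i < n + 2"
  shows "linear_flow t x ! i = (\<Sum>j<n + 2. flow_coeff n t i j * x ! j)"
  using linear_flow_nth_general[of i x t] assms by simp

lemma A_mat_apply:
  assumes "length x = n + 2" "i < n + 2"
  shows "(\<Sum>l<n + 2. A_mat n $$ (i, l) * x ! l) = vel x i"
proof (cases "i = 0 \<or> i = n + 1")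
  case True
  then show ?thesis using assms by (auto simp: A_mat_def vel_def intro!: sum.neutral)
next
  case False
  then obtain m where m: "i = Suc m" "m < n" using assms by (cases i) auto
  have "(\<Sum>l<n + 2. A_mat n $$ (i, l) * x ! l) = (\<Sum>l\<in>{m, m + 1, m + 2}. A_mat n $$ (i, l) * x ! l)"
    by (rule sum.mono_neutral_right) (use m in \<open>auto simp: A_mat_def\<close>)
  also have "\<dots> = vel x i" using m assms by (simp add: A_mat_def vel_def numeral_2_eq_2)
  finally show ?thesis .
qed

lemma linear_flow_0 [simp]: "length x = n + 2 \<Longrightarrow> linear_flow 0 x = x"
proof (rule nth_equalityI)
  assume l: "length x = n + 2"
  then show "length (linear_flow 0 x) = length x" by simp
  fix i assume "i < length (linear_flow 0 x)"
  then have i: "i < n + 2" using l by simp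
  have "linear_flow 0 x ! i = (\<Sum>j<n + 2. if j = i then x ! j else 0)"
    unfolding linear_flow_nth[OF l i] by (rule sum.cong[OF refl]) (use i in \<open>auto simp: flow_coeff_0\<close>)
  then show "linear_flow 0 x ! i = x ! i" using i by simp
qed

lemma linear_flow_add:
  assumes l: "length x = n + 2"
  shows "linear_flow s (linear_flow t x) = linear_flow (s + t) x"
proof (rule nth_equalityI)
  show "length (linear_flow s (linear_flow t x)) = length (linear_flow (s + t) x)"
    using l by simp
  fix i assume "i < length (linear_flow s (linear_flow t x))"
  then have i: "i < n + 2" using l by simp
  have "linear_flow s (linear_flow t x) ! i
      = (\<Sum>j<n + 2. flow_coeff n s i j * (\<Sum>k<n + 2. flow_coeff n t j k * x ! k))"
    using l i by (simp add: linear_flow_nth[of _ n] del: sum.lessThan_Suc)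
  also have "\<dots> = (\<Sum>k<n + 2. (\<Sum>j<n + 2. flow_coeff n s i j * flow_coeff n t j k) * x ! k)"
    unfolding sum_distrib_left sum_distrib_right mult.assoc by (rule sum.swap)
  also have "\<dots> = linear_flow (s + t) x ! i"
    using l i by (simp add: linear_flow_nth[of _ n] flow_coeff_add[of i n, simplified] del: sum.lessThan_Suc)
  finally show "linear_flow s (linear_flow t x) ! i = linear_flow (s + t) x ! i" .
qed

lemma linear_flow_DERIV:
  assumes "length x = n + 2" "i < n + 2"
  shows "((\<lambda>t. linear_flow t x ! i) has_field_derivative vel (linear_flow t x) i) (at t)"
proof -
  have "((\<lambda>t. \<Sum>j<n + 2. flow_coeff n t i j * x ! j) has_field_derivative
      (\<Sum>j<n + 2. (\<Sum>l<n + 2. A_mat n $$ (i, l) * flow_coeff n t l j) * x ! j)) (at t)"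
    by (intro DERIV_sum DERIV_cmult_right flow_coeff_DERIV_left) (use assms in auto)
  moreover have "(\<Sum>j<n + 2. (\<Sum>l<n + 2. A_mat n $$ (i, l) * flow_coeff n t l j) * x ! j)
     = (\<Sum>l<n + 2. A_mat n $$ (i, l) * linear_flow t x ! l)"
  proof -
    have "(\<Sum>l<n + 2. A_mat n $$ (i, l) * linear_flow t x ! l)
       = (\<Sum>l<n + 2. \<Sum>j<n + 2. A_mat n $$ (i, l) * flow_coeff n t l j * x ! j)"
      by (rule sum.cong[OF refl]) (use assms in \<open>simp add: linear_flow_nth[of _ n] sum_distrib_left mult.assoc del: sum.lessThan_Suc\<close>)
    then show ?thesis
      unfolding sum_distrib_right by (subst sum.swap) simp
  qed
  ultimately show ?thesis
    using A_mat_apply[of "linear_flow t x" n i] assms by (simp add: linear_flow_nth[of _ n] del: sum.lessThan_Suc)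
qed

text \<open>The same derivative with \<open>A\<close> on the other side of the exponential. This form expresses the time derivative
of a function of \<open>e\<^bsup>tA\<^esup>x\<close> through its partial derivatives with respect to the coordinates of \<open>x\<close>.\<close>

lemma linear_flow_DERIV_coeff:
  assumes "length x = n + 2" "i < n + 2"
  shows "((\<lambda>t. linear_flow t x ! i) has_field_derivative (\<Sum>l<n + 2. flow_coeff n t i l * vel x l)) (at t)"
proof -
  have "((\<lambda>t. \<Sum>j<n + 2. flow_coeff n t i j * x ! j) has_field_derivative
      (\<Sum>j<n + 2. (\<Sum>l<n + 2. flow_coeff n t i l * A_mat n $$ (l, j)) * x ! j)) (at t)"
    by (intro DERIV_sum DERIV_cmult_right flow_coeff_DERIV_right) (use assms in auto)
  moreover have "(\<Sum>j<n + 2. (\<Sum>l<n + 2. flow_coeff n t i l * A_mat n $$ (l, j)) * x ! j)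
     = (\<Sum>l<n + 2. flow_coeff n t i l * (\<Sum>j<n + 2. A_mat n $$ (l, j) * x ! j))"
    unfolding sum_distrib_left sum_distrib_right mult.assoc by (rule sum.swap)
  moreover have "\<dots> = (\<Sum>l<n + 2. flow_coeff n t i l * vel x l)"
    using A_mat_apply[OF assms(1)] by simp
  ultimately show ?thesis
    using assms by (simp add: linear_flow_nth[of _ n] del: sum.lessThan_Suc)
qed

lemma linear_flow_ends:
  assumes "length x = n + 2"
  shows "linear_flow t x ! 0 = x ! 0" "linear_flow t x ! (n + 1) = x ! (n + 1)"
proof -
  have "linear_flow t x ! i = x ! i" if "i = 0 \<or> i = n + 1" for i
  proof -
    have "((\<lambda>t. linear_flow t x ! i) has_field_derivative 0) (at s)" for s
      using linear_flow_DERIV[OF assms, of i s] that assms by (auto simp: vel_def)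
    then have "linear_flow t x ! i = linear_flow 0 x ! i"
      by (intro DERIV_isconst_all allI)
    then show ?thesis using assms by simp
  qed
  then show "linear_flow t x ! 0 = x ! 0" "linear_flow t x ! (n + 1) = x ! (n + 1)" by auto
qed

lemma linear_flow_continuous:
  assumes "length x = n + 2" "i < n + 2"
  shows "isCont (\<lambda>t. linear_flow t x ! i) t"
  using linear_flow_DERIV[OF assms] by (rule DERIV_isCont)

lemma flow_coeff_continuous:
  assumes "i < n + 2" "j < n + 2"
  shows "isCont (\<lambda>t. flow_coeff n t i j) t"
  using flow_coeff_DERIV_left[OF assms] by (rule DERIV_isCont)

section \<open>The backward flow separates particles\<close>

lemma Delta_iff:
  "x \<in> Delta n \<longleftrightarrow> length x = n + 2 \<and> x ! 0 = 0 \<and> x ! (n + 1) = 1 \<and> (\<forall>i\<le>n. x ! i \<le> x ! (i + 1))"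
  by (auto simp: Delta_def sorted_iff_nth_Suc numeral_2_eq_2)

lemma Delta_open_iff:
  "x \<in> Delta_open n \<longleftrightarrow> length x = n + 2 \<and> x ! 0 = 0 \<and> x ! (n + 1) = 1 \<and> (\<forall>i\<le>n. x ! i < x ! (i + 1))"
proof -
  have "sorted_wrt (<) x \<longleftrightarrow> (\<forall>i. Suc i < length x \<longrightarrow> x ! i < x ! Suc i)"
    by (rule sorted_wrt_iff_nth_Suc_transp) (rule transp_on_less)
  then show ?thesis
    by (auto simp: Delta_open_def Delta_iff numeral_2_eq_2 less_imp_le)
qed

lemma Delta_length: "x \<in> Delta n \<Longrightarrow> length x = n + 2"
  by (simp add: Delta_def)

lemma Delta_open_subset: "Delta_open n \<subseteq> Delta n"
  by (auto simp: Delta_open_def)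

text \<open>On a time interval of length at most \<open>1/4\<close>, the minimum \<open>m\<close> over all components and times satisfies
\<open>m \<ge> m/2\<close> if it is negative: by the mean value theorem the minimal component has dropped from a
nonnegative value with slope at least \<open>2m\<close>. Truncated subtraction and \<open>min\<close> encode reflection at the two
ends of the index range.\<close>

lemma cooperative_nonneg_step:
  fixes v :: "nat \<Rightarrow> real \<Rightarrow> real"
  assumes deriv: "\<And>i r. i \<le> n \<Longrightarrow> (v i has_field_derivative v (i - 1) r + v (min (i + 1) n) r) (at r)"
    and init: "\<And>i. i \<le> n \<Longrightarrow> 0 \<le> v i s"
    and "i \<le> n" "s \<le> r" "r \<le> s + 1 / 4"
  shows "0 \<le> v i r"
proof -
  have "\<exists>r0\<in>{s..s + 1 / 4}. \<forall>r\<in>{s..s + 1 / 4}. v i r0 \<le> v i r" if "i \<le> n" for i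
    by (rule continuous_attains_inf)
      (auto intro!: continuous_at_imp_continuous_on DERIV_isCont[OF deriv] that)
  then obtain r0 where r0: "\<And>i. i \<le> n \<Longrightarrow> r0 i \<in> {s..s + 1 / 4}"
    "\<And>i r. i \<le> n \<Longrightarrow> r \<in> {s..s + 1 / 4} \<Longrightarrow> v i (r0 i) \<le> v i r"
    by metis
  define m where "m = Min ((\<lambda>i. v i (r0 i)) ` {..n})"
  have m_le: "m \<le> v i r" if "i \<le> n" "r \<in> {s..s + 1 / 4}" for i r
  proof -
    have "m \<le> v i (r0 i)" unfolding m_def using that by (intro Min_le) auto
    then show ?thesis using r0(2)[OF that] by linarith
  qed
  have "m \<in> (\<lambda>i. v i (r0 i)) ` {..n}" unfolding m_def by (rule Min_in) auto
  then obtain k where k: "k \<le> n" "m = v k (r0 k)" by auto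
  have "0 \<le> m"
  proof (rule ccontr)
    assume "\<not> 0 \<le> m"
    then have neg: "m < 0" by simp
    have "r0 k \<noteq> s" using init[OF k(1)] k(2) neg by auto
    then have lt: "s < r0 k" using r0(1)[OF k(1)] by auto
    obtain z where z: "z > s" "z < r0 k"
      "v k (r0 k) - v k s = (r0 k - s) * (v (k - 1) z + v (min (k + 1) n) z)"
      using MVT2[OF lt, of "v k" "\<lambda>z. v (k - 1) z + v (min (k + 1) n) z"] deriv[OF k(1)] by auto
    have zin: "z \<in> {s..s + 1 / 4}" using z r0(1)[OF k(1)] by auto
    have "2 * m \<le> v (k - 1) z + v (min (k + 1) n) z"
      using m_le[OF _ zin, of "k - 1"] m_le[OF _ zin, of "min (k + 1) n"] k(1) by linarith
    then have "(r0 k - s) * (2 * m) \<le> v k (r0 k) - v k s"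
      unfolding z(3) using lt by (intro mult_left_mono) auto
    moreover have "(1 / 4) * (2 * m) \<le> (r0 k - s) * (2 * m)"
      using r0(1)[OF k(1)] neg by (intro mult_right_mono_neg) auto
    ultimately have "m / 2 \<le> m" using init[OF k(1)] k(2) by simp
    then show False using neg by simp
  qed
  then show ?thesis using m_le[of i r] assms by auto
qed

lemma cooperative_nonneg:
  fixes v :: "nat \<Rightarrow> real \<Rightarrow> real"
  assumes deriv: "\<And>i r. i \<le> n \<Longrightarrow> (v i has_field_derivative v (i - 1) r + v (min (i + 1) n) r) (at r)"
    and init: "\<And>i. i \<le> n \<Longrightarrow> 0 \<le> v i 0"
    and "i \<le> n" "0 \<le> r"
  shows "0 \<le> v i r"
proof -
  have "\<forall>i\<le>n. 0 \<le> v i r" if "0 \<le> r" "r \<le> real k / 4" for k r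
    using that
  proof (induction k arbitrary: r)
    case 0
    then show ?case using init by auto
  next
    case (Suc k)
    show ?case
    proof (cases "r \<le> real k / 4")
      case True
      then show ?thesis using Suc by auto
    next
      case False
      have "\<forall>i\<le>n. 0 \<le> v i (real k / 4)" by (rule Suc.IH) auto
      then show ?thesis
        using cooperative_nonneg_step[OF deriv, of "real k / 4" _ r] False Suc.prems
        by (auto simp: add_divide_distrib)
    qed
  qed
  moreover obtain k :: nat where "r \<le> real k / 4"
    using real_arch_simple[of "4 * r"] by (auto simp: field_simps)
  ultimately show ?thesis using assms by blast
qed

lemma cooperative_mono:
  fixes v :: "nat \<Rightarrow> real \<Rightarrow> real"
  assumes deriv: "\<And>i r. i \<le> n \<Longrightarrow> (v i has_field_derivative v (i - 1) r + v (min (i + 1) n) r) (at r)"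
    and init: "\<And>i. i \<le> n \<Longrightarrow> 0 \<le> v i 0"
    and "i \<le> n" "0 \<le> r"
  shows "v i 0 \<le> v i r"
proof (rule DERIV_nonneg_imp_nondecreasing[OF \<open>0 \<le> r\<close>])
  fix s :: real assume "0 \<le> s"
  then have "0 \<le> v (i - 1) s + v (min (i + 1) n) s"
    using cooperative_nonneg[OF deriv init] \<open>i \<le> n\<close> by (intro add_nonneg_nonneg) auto
  then show "\<exists>y. (v i has_real_derivative y) (at s) \<and> 0 \<le> y" using deriv[OF \<open>i \<le> n\<close>] by blast
qed

text \<open>The growth rate of a component is at least the value of each neighbour, so one positive neighbour makes it
positive immediately.\<close>

lemma cooperative_pos:
  fixes v :: "nat \<Rightarrow> real \<Rightarrow> real"
  assumes deriv: "\<And>i r. i \<le> n \<Longrightarrow> (v i has_field_derivative v (i - 1) r + v (min (i + 1) n) r) (at r)"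
    and init: "\<And>i. i \<le> n \<Longrightarrow> 0 \<le> v i 0"
    and "i \<le> n" "0 < r" "j = i - 1 \<or> j = min (i + 1) n" "0 < v j 0"
  shows "0 < v i r"
proof -
  have nn: "0 \<le> v k s" if "k \<le> n" "0 \<le> s" for k s
    using cooperative_nonneg[OF deriv init] that by blast
  have "v i 0 < v i r"
  proof (rule DERIV_pos_imp_increasing[OF \<open>0 < r\<close>])
    fix s :: real assume s: "0 \<le> s"
    have "j \<le> n" using assms by auto
    then have "0 < v j s" using cooperative_mono[OF deriv init _ s, of j] \<open>0 < v j 0\<close> by fastforce
    then have "0 < v (i - 1) s + v (min (i + 1) n) s"
      using nn[OF _ s, of "i - 1"] nn[OF _ s, of "min (i + 1) n"] assms(3,5)
      by (auto intro: add_pos_nonneg add_nonneg_pos)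
    then show "\<exists>y. (v i has_real_derivative y) (at s) \<and> 0 < y" using deriv[OF \<open>i \<le> n\<close>] by blast
  qed
  then show ?thesis using init[OF \<open>i \<le> n\<close>] by linarith
qed

text \<open>The gaps \<open>g\<^sub>i\<close> satisfy \<open>g\<^sub>i' = g\<^bsub>i-1\<^esub> - 2 g\<^sub>i + g\<^bsub>i+1\<^esub>\<close> under the backward flow, with
reflection at both ends since the extra particles do not move. The factor \<open>e\<^bsup>2r\<^esup>\<close> removes the
negative diagonal term.\<close>

definition scaled_gap :: "real list \<Rightarrow> nat \<Rightarrow> real \<Rightarrow> real" where
  "scaled_gap x i r = exp (2 * r) * (linear_flow (- r) x ! (i + 1) - linear_flow (- r) x ! i)"

lemma scaled_gap_DERIV:
  assumes "length x = n + 2" "i \<le> n"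
  shows "(scaled_gap x i has_field_derivative scaled_gap x (i - 1) r + scaled_gap x (min (i + 1) n) r) (at r)"
proof -
  let ?y = "linear_flow (- r) x"
  have l: "length ?y = n + 2" using assms by simp
  have d: "((\<lambda>r. linear_flow (- r) x ! k) has_field_derivative - vel ?y k) (at r)" if "k < n + 2" for k
  proof -
    have "(uminus has_field_derivative -1) (at r)" by (auto intro!: derivative_eq_intros)
    from DERIV_chain2[OF linear_flow_DERIV[OF assms(1) that] this] show ?thesis by simp
  qed
  have "(scaled_gap x i has_field_derivative
      exp (2 * r) * (- vel ?y (i + 1) - - vel ?y i) + exp (2 * r) * 2 * (?y ! (i + 1) - ?y ! i)) (at r)"
    unfolding scaled_gap_def
    by (intro DERIV_mult' DERIV_diff d derivative_eq_intros) (use assms in auto)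
  moreover have "exp (2 * r) * (- vel ?y (i + 1) - - vel ?y i) + exp (2 * r) * 2 * (?y ! (i + 1) - ?y ! i)
      = exp (2 * r) * ((?y ! (i - 1 + 1) - ?y ! (i - 1)) + (?y ! (min (i + 1) n + 1) - ?y ! min (i + 1) n))"
  proof -
    have "(- vel ?y (i + 1) - - vel ?y i) + 2 * (?y ! (i + 1) - ?y ! i)
      = (?y ! (i - 1 + 1) - ?y ! (i - 1)) + (?y ! (min (i + 1) n + 1) - ?y ! min (i + 1) n)"
      using assms(2) l unfolding vel_def
      by (cases "i = 0"; cases "i = n") (auto simp: min_def numeral_2_eq_2)
    then show ?thesis by (simp only: distrib_left[symmetric] mult.assoc)
  qed
  ultimately show ?thesis by (simp add: scaled_gap_def distrib_left)
qed

lemma scaled_gap_0: "length x = n + 2 \<Longrightarrow> scaled_gap x i 0 = x ! (i + 1) - x ! i"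
  by (simp add: scaled_gap_def)

lemma backward_flow_Delta:
  assumes "x \<in> Delta n" "0 \<le> r"
  shows "linear_flow (- r) x \<in> Delta n"
proof -
  have l: "length x = n + 2" using assms by (simp add: Delta_length)
  have "0 \<le> scaled_gap x i r" if "i \<le> n" for i
    by (rule cooperative_nonneg[OF scaled_gap_DERIV[OF l]])
      (use assms that in \<open>auto simp: scaled_gap_0[OF l] Delta_iff\<close>)
  then show ?thesis
    using assms(1) linear_flow_ends[OF l, of "- r"] l
    by (auto simp: Delta_iff scaled_gap_def zero_le_mult_iff)
qed

lemma backward_flow_Delta_open:
  assumes "x \<in> Delta_open n" "0 \<le> r"
  shows "linear_flow (- r) x \<in> Delta_open n"
proof -
  have l: "length x = n + 2" using assms by (simp add: Delta_open_iff)
  have pos: "0 < scaled_gap x i 0" if "i \<le> n" for i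
    using assms that by (simp add: scaled_gap_0[OF l] Delta_open_iff)
  have "scaled_gap x i 0 \<le> scaled_gap x i r" if "i \<le> n" for i
    by (rule cooperative_mono[OF scaled_gap_DERIV[OF l]]) (use pos assms that in \<open>auto simp: less_imp_le\<close>)
  then have "0 < scaled_gap x i r" if "i \<le> n" for i using pos[OF that] that by (meson less_le_trans)
  then show ?thesis
    using assms(1) linear_flow_ends[OF l, of "- r"] l
    by (auto simp: Delta_open_iff scaled_gap_def zero_less_mult_iff)
qed

text \<open>A closed gap opens immediately if one of its neighbours is open. The condition holds on every face with
exactly one closed gap; the smaller faces are null sets.\<close>

lemma backward_flow_opens_gaps:
  assumes x: "x \<in> Delta n" and "0 < r"
    and near: "\<And>i. i \<le> n \<Longrightarrow> x ! i = x ! (i + 1) \<Longrightarrow>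
      (0 < i \<and> x ! (i - 1) < x ! i) \<or> (i < n \<and> x ! (i + 1) < x ! (i + 2))"
  shows "linear_flow (- r) x \<in> Delta_open n"
proof -
  have l: "length x = n + 2" using assms by (simp add: Delta_length)
  have nn: "0 \<le> scaled_gap x i 0" if "i \<le> n" for i
    using x that by (simp add: scaled_gap_0[OF l] Delta_iff)
  have "0 < scaled_gap x i r" if i: "i \<le> n" for i
  proof (cases "x ! i = x ! (i + 1)")
    case True
    from near[OF i True] obtain j where "j = i - 1 \<or> j = min (i + 1) n" "0 < scaled_gap x j 0"
    proof
      assume "0 < i \<and> x ! (i - 1) < x ! i"
      then show thesis by (intro that[of "i - 1"]) (auto simp: scaled_gap_0[OF l])
    next
      assume "i < n \<and> x ! (i + 1) < x ! (i + 2)"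
      then show thesis by (intro that[of "i + 1"]) (auto simp: scaled_gap_0[OF l] numeral_2_eq_2)
    qed
    then show ?thesis using cooperative_pos[OF scaled_gap_DERIV[OF l] nn i \<open>0 < r\<close>] by blast
  next
    case False
    then have "x ! i < x ! (i + 1)" using x i by (auto simp: Delta_iff order_less_le)
    then have "0 < scaled_gap x i 0" by (simp add: scaled_gap_0[OF l])
    also have "\<dots> \<le> scaled_gap x i r"
      by (rule cooperative_mono[OF scaled_gap_DERIV[OF l] nn i]) (use \<open>0 < r\<close> in auto)
    finally show ?thesis .
  qed
  then show ?thesis
    using x linear_flow_ends[OF l, of "- r"] l
    by (auto simp: Delta_open_iff Delta_iff scaled_gap_def zero_less_mult_iff)
qed

section \<open>Collision times and the evolution\<close>

lemma flow_Delta_open_backwards: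
  assumes "length x = n + 2" "linear_flow s x \<in> Delta_open n" "r \<le> s"
  shows "linear_flow r x \<in> Delta_open n"
  using backward_flow_Delta_open[OF assms(2), of "s - r"] assms linear_flow_add[OF assms(1), of "r - s" s]
  by simp

lemma flow_Delta_open_eventually:
  assumes "x \<in> Delta n" "linear_flow s x \<in> Delta_open n"
  shows "\<forall>\<^sub>F r in nhds s. linear_flow r x \<in> Delta_open n"
proof -
  have l: "length x = n + 2" using assms by (simp add: Delta_length)
  have "\<forall>\<^sub>F r in nhds s. \<forall>i\<in>{..n}. 0 < linear_flow r x ! (i + 1) - linear_flow r x ! i"
  proof (intro eventually_ball_finite ballI)
    fix i assume "i \<in> {..n}"
    then have i: "i \<le> n" by simp
    have "isCont (\<lambda>r. linear_flow r x ! (i + 1) - linear_flow r x ! i) s"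
      by (intro continuous_intros linear_flow_continuous[OF l]) (use i in auto)
    then have "((\<lambda>r. linear_flow r x ! (i + 1) - linear_flow r x ! i) \<longlongrightarrow>
        linear_flow s x ! (i + 1) - linear_flow s x ! i) (nhds s)"
      unfolding isCont_def
      using tendsto_at_iff_tendsto_nhds[of "\<lambda>r. linear_flow r x ! (i + 1) - linear_flow r x ! i" s] by simp
    then show "\<forall>\<^sub>F r in nhds s. 0 < linear_flow r x ! (i + 1) - linear_flow r x ! i"
      by (rule order_tendstoD) (use assms i in \<open>auto simp: Delta_open_iff\<close>)
  qed auto
  then show ?thesis
    by eventually_elim (use assms(1) l linear_flow_ends[OF l] in \<open>auto simp: Delta_open_iff Delta_iff\<close>)
qed

text \<open>The last time in \<open>[0, s]\<close> at which the configuration is ordered is a collision: were the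
configuration in the open simplex then, it would stay there a little longer, unless that time is \<open>s\<close>,
which is excluded by assumption.\<close>

lemma collision_before:
  assumes x: "x \<in> Delta n" and "0 \<le> s" and "linear_flow s x \<notin> Delta_open n"
  obtains r where "0 \<le> r" "r \<le> s" "linear_flow r x \<in> Delta_boundary n"
proof -
  have l: "length x = n + 2" using assms by (simp add: Delta_length)
  \<comment> \<open>The times at which the configuration is still ordered; compact, so it has a largest element.\<close>
  define K where "K = {0..s} \<inter> (\<Inter>i\<in>{..n}. {r. linear_flow r x ! i \<le> linear_flow r x ! (i + 1)})"
  have K: "r \<in> K \<longleftrightarrow> 0 \<le> r \<and> r \<le> s \<and> linear_flow r x \<in> Delta n" for r
    using x l linear_flow_ends[OF l] by (auto simp: K_def Delta_iff)
  have "compact K"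
    unfolding K_def
    by (intro compact_Int_closed compact_Icc closed_INT ballI closed_Collect_le
        continuous_at_imp_continuous_on linear_flow_continuous[OF l] ballI) auto
  moreover have "0 \<in> K" using K assms l by simp
  ultimately obtain r where r: "r \<in> K" "\<And>q. q \<in> K \<Longrightarrow> q \<le> r"
    using compact_attains_sup[of K] by blast
  have "linear_flow r x \<notin> Delta_open n"
  proof
    assume o: "linear_flow r x \<in> Delta_open n"
    then have "r < s" using assms(3) r(1) K by (metis order_less_le)
    from flow_Delta_open_eventually[OF x o] obtain d where d: "d > 0"
      "\<And>q. dist q r < d \<Longrightarrow> linear_flow q x \<in> Delta_open n"
      unfolding eventually_nhds_metric by blast
    define q where "q = min s (r + d / 2)"
    have "r < q" "q \<le> s" "dist q r < d" using \<open>r < s\<close> d(1) by (auto simp: q_def dist_real_def)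
    then have "q \<in> K" using d(2)[of q] Delta_open_subset r(1) K by force
    then show False using r(2) \<open>r < q\<close> by force
  qed
  then show thesis using that[of r] r(1) K by (auto simp: Delta_boundary_def)
qed

text \<open>Although collision is defined through the whole past, one time suffices to exclude it: from an interior
configuration, the backward flow never leaves the interior. This also makes the collision time
measurable.\<close>

lemma less_collision_time_iff:
  assumes x: "x \<in> Delta n" and "0 \<le> s"
  shows "ereal s < collision_time x \<longleftrightarrow> linear_flow s x \<in> Delta_open n"
proof
  have l: "length x = n + 2" using assms by (simp add: Delta_length)
  then have l2: "length x - 2 = n" by simp
  {
    assume a: "ereal s < collision_time x"
    show "linear_flow s x \<in> Delta_open n"
    proof (rule ccontr)
      assume "linear_flow s x \<notin> Delta_open n"
      from collision_before[OF x \<open>0 \<le> s\<close> this] obtain r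
        where r: "0 \<le> r" "r \<le> s" "linear_flow r x \<in> Delta_boundary n" .
      then have "collision_time x \<le> ereal r"
        unfolding collision_time_def l2 by (intro INF_lower) auto
      also have "\<dots> \<le> ereal s" using r by simp
      finally show False using a by simp
    qed
  }
  assume o: "linear_flow s x \<in> Delta_open n"
  from flow_Delta_open_eventually[OF x o] obtain d where d: "d > 0"
    "\<And>q. dist q s < d \<Longrightarrow> linear_flow q x \<in> Delta_open n"
    unfolding eventually_nhds_metric by blast
  have "linear_flow (s + d / 2) x \<in> Delta_open n" using d by (simp add: dist_real_def)
  then have ok: "linear_flow r x \<in> Delta_open n" if "r \<le> s + d / 2" for r
    using flow_Delta_open_backwards[OF l] that by blast
  have "ereal s < ereal (s + d / 2)" using d by simp
  also have "\<dots> \<le> collision_time x"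
    unfolding collision_time_def l2
  proof (rule INF_greatest)
    fix r assume "r \<in> {s. 0 \<le> s \<and> linear_flow s x \<in> Delta_boundary n}"
    then have "linear_flow r x \<notin> Delta_open n" by (auto simp: Delta_boundary_def)
    then show "ereal (s + d / 2) \<le> ereal r" using ok[of r] by (cases "r \<le> s + d / 2") auto
  qed
  finally show "ereal s < collision_time x" .
qed

lemma collision_time_nonneg: "0 \<le> collision_time x"
  unfolding collision_time_def by (rule INF_greatest) auto

lemma flow_at_collision_time:
  assumes x: "x \<in> Delta n" and c: "collision_time x = ereal c"
  shows "linear_flow c x \<in> Delta_boundary n"
proof -
  have l: "length x = n + 2" using assms by (simp add: Delta_length)
  have c0: "0 \<le> c" using collision_time_nonneg[of x] c by simp
  have "linear_flow c x \<notin> Delta_open n" using less_collision_time_iff[OF x c0] c by simp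
  moreover have "linear_flow c x \<in> Delta n"
  proof (cases "c = 0")
    case True
    then show ?thesis using x l by simp
  next
    case False
    have "0 \<le> linear_flow c x ! (i + 1) - linear_flow c x ! i" if i: "i \<le> n" for i
    proof (rule tendsto_lowerbound)
      have "isCont (\<lambda>r. linear_flow r x ! (i + 1) - linear_flow r x ! i) c"
        by (intro continuous_intros linear_flow_continuous[OF l]) (use i in auto)
      then show "((\<lambda>r. linear_flow r x ! (i + 1) - linear_flow r x ! i) \<longlongrightarrow>
          linear_flow c x ! (i + 1) - linear_flow c x ! i) (at_left c)"
        unfolding isCont_def by (rule filterlim_mono) (auto simp: at_le)
      show "\<forall>\<^sub>F r in at_left c. 0 \<le> linear_flow r x ! (i + 1) - linear_flow r x ! i"
      proof (rule eventually_at_leftI)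
        show "0 < c" using c0 False by simp
        fix r assume "r \<in> {0<..<c}"
        then have "linear_flow r x \<in> Delta_open n"
          using less_collision_time_iff[OF x, of r] c by simp
        then show "0 \<le> linear_flow r x ! (i + 1) - linear_flow r x ! i"
          using i by (simp add: Delta_open_iff less_imp_le)
      qed
    qed simp
    then show ?thesis using x l linear_flow_ends[OF l] by (simp add: Delta_iff)
  qed
  ultimately show ?thesis by (simp add: Delta_boundary_def)
qed

text \<open>Boundary points whose backward trajectory lies in the interior are reached by it for the first time exactly
when they should be.\<close>

lemma collision_time_backward_flow:
  assumes y: "y \<in> Delta_boundary n" and "0 \<le> r"
    and opens: "\<And>q. 0 < q \<Longrightarrow> linear_flow (- q) y \<in> Delta_open n"
  shows "collision_time (linear_flow (- r) y) = ereal r"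
proof (rule antisym)
  let ?x = "linear_flow (- r) y"
  have yD: "y \<in> Delta n" "y \<notin> Delta_open n" using y by (auto simp: Delta_boundary_def)
  have l: "length y = n + 2" using yD by (simp add: Delta_length)
  have x: "?x \<in> Delta n" using backward_flow_Delta[OF yD(1) \<open>0 \<le> r\<close>] .
  have flow: "linear_flow q ?x = linear_flow (- (r - q)) y" for q
    using linear_flow_add[OF l, of q "- r"] by simp
  have "\<not> ereal r < collision_time ?x"
    using less_collision_time_iff[OF x \<open>0 \<le> r\<close>] flow[of r] yD l by simp
  then show "collision_time ?x \<le> ereal r" by simp
  show "ereal r \<le> collision_time ?x"
  proof (rule ccontr)
    assume "\<not> ereal r \<le> collision_time ?x"
    then obtain q where q: "collision_time ?x = ereal q" "q < r"
      using collision_time_nonneg[of ?x] by (cases "collision_time ?x") auto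
    then have "0 \<le> q" using collision_time_nonneg[of ?x] by simp
    then have "ereal q < collision_time ?x"
      using less_collision_time_iff[OF x \<open>0 \<le> q\<close>] flow[of q] opens[of "r - q"] q(2) by simp
    then show False using q(1) by simp
  qed
qed

lemma remdups_adj_strict:
  fixes x :: "real list"
  assumes "sorted x"
  shows "sorted_wrt (<) (remdups_adj x)"
  using assms
proof (induction x rule: remdups_adj.induct)
  case (3 x y xs)
  then show ?case by fastforce
qed auto

text \<open>The recursion for \<^const>\<open>Phi\<close> descends to fewer particles.\<close>

lemma remdups_adj_Delta_boundary:
  assumes "x \<in> Delta_boundary n"
  obtains k where "k < n" "remdups_adj x \<in> Delta_open k"
proof -
  let ?y = "remdups_adj x"
  have x: "length x = n + 2" "x ! 0 = 0" "x ! (n + 1) = 1" "sorted x" "\<not> sorted_wrt (<) x"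
    using assms by (auto simp: Delta_boundary_def Delta_open_def Delta_def)
  have ne: "x \<noteq> []" "?y \<noteq> []" using x(1) by auto
  have h: "hd ?y = 0" "last ?y = 1" using x ne by (auto simp: hd_conv_nth last_conv_nth)
  then have "2 \<le> length ?y" using ne by (cases ?y; cases "tl ?y") (auto simp: last_ConsL)
  then obtain k where k: "length ?y = k + 2" by (metis add.commute le_Suc_ex)
  have "length ?y \<noteq> length x"
  proof
    assume "length ?y = length x"
    then have "distinct_adj x" by (simp add: distinct_adj_conv_length_remdups_adj)
    then have "?y = x" by (simp add: distinct_adj_altdef)
    then show False using remdups_adj_strict[OF x(4)] x(5) by simp
  qed
  then have "k < n" using remdups_adj_length[of x] k x(1) by simp
  moreover have "?y ! 0 = 0" "?y ! (k + 1) = 1"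
    using h hd_conv_nth[OF ne(2)] last_conv_nth[OF ne(2)] k by auto
  ultimately show thesis by (intro that[of k]) (auto simp: Delta_open_def Delta_def k remdups_adj_strict x)
qed

lemma Phi_before_collision:
  assumes "x \<in> Delta_open n" "0 \<le> t"
  shows "Phi t (linear_flow (- t) x) = x"
proof -
  have l: "length x = n + 2" using assms by (simp add: Delta_open_iff)
  have D: "linear_flow (- t) x \<in> Delta n"
    using backward_flow_Delta_open[OF assms] Delta_open_subset by blast
  have flow: "linear_flow t (linear_flow (- t) x) = x" using l by (simp add: linear_flow_add[OF l])
  have "ereal t < collision_time (linear_flow (- t) x)"
    using less_collision_time_iff[OF D \<open>0 \<le> t\<close>] flow assms by simp
  moreover have "linear_flow (- t) x = x" if "length (linear_flow (- t) x) = 2"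
  proof -
    have "n = 0" using that l by simp
    then show ?thesis using l linear_flow_ends[OF l, of "- t"]
      by (intro nth_equalityI) (auto simp: less_Suc_eq numeral_2_eq_2)
  qed
  ultimately show ?thesis using flow by (subst Phi.simps) auto
qed

lemma Phi_after_collision:
  assumes y: "y \<in> Delta_boundary n" and "0 \<le> r" "r \<le> t"
    and opens: "\<And>q. 0 < q \<Longrightarrow> linear_flow (- q) y \<in> Delta_open n"
  shows "Phi t (linear_flow (- r) y) = Phi (t - r) (remdups_adj y)"
proof -
  have l: "length y = n + 2" using y by (simp add: Delta_boundary_def Delta_length)
  have n: "n \<noteq> 0"
  proof
    assume "n = 0"
    then show False using y by (auto simp: Delta_boundary_def Delta_iff Delta_open_iff)
  qed
  have "linear_flow r (linear_flow (- r) y) = y" using l by (simp add: linear_flow_add[OF l])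
  then show ?thesis
    using collision_time_backward_flow[OF y \<open>0 \<le> r\<close> opens] n l \<open>r \<le> t\<close>
    by (subst Phi.simps) auto
qed

section \<open>Measurability on the space of lists\<close>

lemma space_particle_space [simp]: "space particle_space = UNIV"
  by (simp add: particle_space_def)

lemma particle_space_box:
  assumes "\<And>i. i < n \<Longrightarrow> B i \<in> sets borel"
  shows "{ys. length ys = n \<and> (\<forall>i<n. ys ! i \<in> B i)} \<in> sets particle_space"
  unfolding particle_space_def by (rule in_measure_of) (use assms in auto)

lemma measurable_length [measurable]: "length \<in> measurable particle_space (count_space UNIV)"
proof (rule measurable_count_space_eq2_countable[THEN iffD2])
  have "length -` {n} = {ys::real list. length ys = n \<and> (\<forall>i<n. ys ! i \<in> UNIV)}" for n by auto
  then show "length \<in> space particle_space \<rightarrow> UNIV \<and> (\<forall>a\<in>UNIV. length -` {a} \<inter> space particle_space \<in> sets particle_space)"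
    using particle_space_box[of _ "\<lambda>_. UNIV"] by auto
qed

text \<open>Beyond the end of a list the value of \<open>nth\<close> depends on the length only, so every index is measurable.\<close>

lemma measurable_nth [measurable]: "(\<lambda>x. x ! i) \<in> borel_measurable particle_space"
proof (rule measurableI)
  fix B :: "real set" assume B: "B \<in> sets borel"
  have beyond: "x ! i = [] ! (i - length x)" if "length x \<le> i" for x :: "real list"
    using nth_append[of x "[]" i] that by simp
  have "(\<lambda>x. x ! i) -` B \<inter> space particle_space
      = (\<Union>n. {x. length x = n \<and> (\<forall>j<n. x ! j \<in> (if j = i then B else UNIV)) \<and> (n \<le> i \<longrightarrow> [] ! (i - n) \<in> B)})"
  proof (rule Set.set_eqI)
    fix x :: "real list"
    show "x \<in> (\<lambda>x. x ! i) -` B \<inter> space particle_space \<longleftrightarrow> x \<in>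
      (\<Union>n. {x. length x = n \<and> (\<forall>j<n. x ! j \<in> (if j = i then B else UNIV)) \<and> (n \<le> i \<longrightarrow> [] ! (i - n) \<in> B)})"
      using beyond[of x] by (cases "length x \<le> i") (auto split: if_splits)
  qed
  also have "\<dots> \<in> sets particle_space"
  proof (rule sets.countable_UN, safe)
    fix n
    have "{x. length x = n \<and> (\<forall>j<n. x ! j \<in> (if j = i then B else UNIV))} \<in> sets particle_space"
      by (rule particle_space_box) (use B in auto)
    then show "{x. length x = n \<and> (\<forall>j<n. x ! j \<in> (if j = i then B else UNIV)) \<and> (n \<le> i \<longrightarrow> [] ! (i - n) \<in> B)} \<in> sets particle_space"
      by (cases "n \<le> i \<longrightarrow> [] ! (i - n) \<in> B") auto
  qed
  finally show "(\<lambda>x. x ! i) -` B \<inter> space particle_space \<in> sets particle_space" .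
qed auto

text \<open>A list-valued function need only agree with a measurable function in each coordinate on each level set
of the length.\<close>

lemma measurable_particle_spaceI:
  assumes len [measurable]: "(\<lambda>x. length (g x)) \<in> measurable M (count_space UNIV)"
    and nth: "\<And>n i. i < n \<Longrightarrow>
      \<exists>h \<in> borel_measurable M. \<forall>x\<in>space M. length (g x) = n \<longrightarrow> g x ! i = h x"
  shows "g \<in> measurable M particle_space"
  unfolding particle_space_def
proof (rule measurable_measure_of)
  fix S :: "real list set"
  assume "S \<in> {{ys. length ys = n \<and> (\<forall>i<n. ys ! i \<in> B i)} | n B. \<forall>i<n. B i \<in> sets borel}"
  then obtain n B where S: "S = {ys. length ys = n \<and> (\<forall>i<n. ys ! i \<in> B i)}"
    and B: "\<And>i. i < n \<Longrightarrow> B i \<in> sets borel" by blast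
  have "\<forall>i\<in>{..<n}. \<exists>h. h \<in> borel_measurable M \<and> (\<forall>x\<in>space M. length (g x) = n \<longrightarrow> g x ! i = h x)"
    using nth[of _ n] by blast
  from bchoice[OF this] obtain h where h: "\<And>i. i < n \<Longrightarrow> h i \<in> borel_measurable M"
    "\<And>i x. i < n \<Longrightarrow> x \<in> space M \<Longrightarrow> length (g x) = n \<Longrightarrow> g x ! i = h i x"
    by auto
  have "g -` S \<inter> space M = {x\<in>space M. length (g x) = n \<and> (\<forall>i\<in>{..<n}. h i x \<in> B i)}"
    using h by (auto simp: S)
  also have "\<dots> \<in> sets M"
  proof (intro sets.sets_Collect_conj sets.sets_Collect_finite_All)
    show "{x\<in>space M. length (g x) = n} \<in> sets M" by measurable
    fix i assume "i \<in> {..<n}"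
    then show "{x\<in>space M. h i x \<in> B i} \<in> sets M"
      using measurable_sets[OF h(1) B] by (simp add: vimage_def Int_def conj_commute)
  qed auto
  finally show "g -` S \<inter> space M \<in> sets M" .
qed auto

lemma measurable_particle_space_fixed_length:
  assumes "\<And>x. x \<in> space M \<Longrightarrow> length (g x) = n"
    and "\<And>i. i < n \<Longrightarrow> (\<lambda>x. g x ! i) \<in> borel_measurable M"
  shows "g \<in> measurable M particle_space"
proof (rule measurable_particle_spaceI)
  show "(\<lambda>x. length (g x)) \<in> measurable M (count_space UNIV)"
    by (subst measurable_cong[of M _ "\<lambda>_. n"]) (use assms in auto)
  fix m i :: nat assume "i < m"
  show "\<exists>h\<in>borel_measurable M. \<forall>x\<in>space M. length (g x) = m \<longrightarrow> g x ! i = h x"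
  proof (cases "m = n")
    case True
    then show ?thesis using assms \<open>i < m\<close> by (intro bexI[of _ "\<lambda>x. g x ! i"]) auto
  next
    case False
    then show ?thesis using assms by (intro bexI[of _ "\<lambda>x. 0"]) auto
  qed
qed

lemma measurable_by_length:
  assumes "\<And>n. (\<lambda>x. g n x) \<in> measurable M N" and [measurable]: "h \<in> measurable M particle_space"
  shows "(\<lambda>x. g (length (h x)) x) \<in> measurable M N"
  by (rule measurable_compose_countable[OF assms(1)]) measurable

lemma measurable_Cons [measurable]:
  assumes [measurable]: "f \<in> borel_measurable M" "g \<in> measurable M particle_space"
  shows "(\<lambda>x. f x # g x) \<in> measurable M particle_space"
proof (rule measurable_particle_spaceI)
  show "(\<lambda>x. length (f x # g x)) \<in> measurable M (count_space UNIV)" by simp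
  fix n i :: nat
  show "\<exists>h\<in>borel_measurable M. \<forall>x\<in>space M. length (f x # g x) = n \<longrightarrow> (f x # g x) ! i = h x"
  proof (cases i)
    case 0 then show ?thesis by (intro bexI[of _ f]) auto
  next
    case (Suc j) then show ?thesis by (intro bexI[of _ "\<lambda>x. g x ! j"]) auto
  qed
qed

lemma measurable_tl [measurable]: "tl \<in> measurable particle_space particle_space"
proof (rule measurable_particle_spaceI)
  show "(\<lambda>x. length (tl x)) \<in> measurable particle_space (count_space UNIV)" by simp
  fix n i :: nat assume "i < n"
  then show "\<exists>h\<in>borel_measurable particle_space. \<forall>x\<in>space particle_space. length (tl x) = n \<longrightarrow> tl x ! i = h x"
    by (intro bexI[of _ "\<lambda>x. x ! Suc i"]) (auto simp: nth_tl)
qed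

lemma measurable_butlast [measurable]: "butlast \<in> measurable particle_space particle_space"
proof (rule measurable_particle_spaceI)
  show "(\<lambda>x. length (butlast x)) \<in> measurable particle_space (count_space UNIV)" by simp
  fix n i :: nat assume "i < n"
  then show "\<exists>h\<in>borel_measurable particle_space. \<forall>x\<in>space particle_space. length (butlast x) = n \<longrightarrow> butlast x ! i = h x"
    by (intro bexI[of _ "\<lambda>x. x ! i"]) (auto simp: nth_butlast)
qed

lemma measurable_particles [measurable]: "particles \<in> measurable particle_space particle_space"
  unfolding particles_def by measurable

lemma measurable_add_endpoints [measurable]: "add_endpoints \<in> measurable particle_space particle_space"
proof (rule measurable_particle_spaceI)
  show "(\<lambda>x. length (add_endpoints x)) \<in> measurable particle_space (count_space UNIV)"
    by (simp add: add_endpoints_def)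
  fix n i :: nat assume "i < n"
  then show "\<exists>h\<in>borel_measurable particle_space. \<forall>x\<in>space particle_space. length (add_endpoints x) = n \<longrightarrow> add_endpoints x ! i = h x"
    by (intro bexI[of _ "\<lambda>x. if i = 0 then 0 else if i < n - 1 then x ! (i - 1) else 1"])
      (auto simp: add_endpoints_def nth_Cons nth_append split: nat.splits)
qed

lemma measurable_remdups_adj [measurable]: "remdups_adj \<in> measurable particle_space particle_space"
proof -
  have "(\<lambda>x. if length x = m then remdups_adj x else []) \<in> measurable particle_space particle_space" for m
  proof (induction m)
    case 0
    have "(\<lambda>x. if length x = 0 then remdups_adj x else []) = (\<lambda>x::real list. [])" by auto
    then show ?case by simp
  next
    case (Suc m)
    define g where "g x = (if length x = m then remdups_adj x else [])" for x :: "real list"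
    have [measurable]: "g \<in> measurable particle_space particle_space" using Suc unfolding g_def .
    have "(\<lambda>x. if length x = Suc m then remdups_adj x else [])
       = (\<lambda>x. if length x = Suc m then
           (if m = 0 then x else if x ! 0 = x ! 1 then g (tl x) else x ! 0 # g (tl x)) else [])"
    proof (rule ext)
      fix x :: "real list"
      show "(if length x = Suc m then remdups_adj x else []) = (if length x = Suc m then
           (if m = 0 then x else if x ! 0 = x ! 1 then g (tl x) else x ! 0 # g (tl x)) else [])"
        by (cases x rule: remdups_adj.cases) (auto simp: g_def)
    qed
    moreover have "\<dots> \<in> measurable particle_space particle_space" by measurable
    ultimately show ?case by simp
  qed
  from measurable_by_length[of "\<lambda>m x. if length x = m then remdups_adj x else []", OF this, of "\<lambda>x. x"]
  show ?thesis by simp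
qed

lemma measurable_insort [measurable]:
  assumes [measurable]: "f \<in> borel_measurable M" "g \<in> measurable M particle_space"
  shows "(\<lambda>x. insort (f x) (g x)) \<in> measurable M particle_space"
proof -
  have "(\<lambda>x. if length (h x) = m then insort (f x) (h x) else []) \<in> measurable M particle_space"
    if "h \<in> measurable M particle_space" for m h
    using that
  proof (induction m arbitrary: h)
    case 0
    have "(\<lambda>x. if length (h x) = 0 then insort (f x) (h x) else []) = (\<lambda>x. if length (h x) = 0 then [f x] else [])"
      by auto
    moreover note [measurable] = 0
    have "(\<lambda>x. if length (h x) = 0 then [f x] else []) \<in> measurable M particle_space" by measurable
    ultimately show ?case by simp
  next
    case (Suc m)
    note [measurable] = Suc.prems
    have [measurable]: "(\<lambda>x. if length (tl (h x)) = m then insort (f x) (tl (h x)) else []) \<in> measurable M particle_space"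
      by (rule Suc.IH) measurable
    have "(\<lambda>x. if length (h x) = Suc m then insort (f x) (h x) else [])
      = (\<lambda>x. if length (h x) = Suc m then
          (if f x \<le> h x ! 0 then f x # h x else h x ! 0 # (if length (tl (h x)) = m then insort (f x) (tl (h x)) else []))
          else [])"
      by (rule ext) (case_tac "h x", auto)
    moreover have "\<dots> \<in> measurable M particle_space" by measurable
    ultimately show ?case by simp
  qed
  from measurable_by_length[of "\<lambda>m x. if length (g x) = m then insort (f x) (g x) else []", OF this[OF assms(2)] assms(2)]
  show ?thesis by simp
qed

lemma measurable_sort_map [measurable]:
  assumes "\<And>i. i < n \<Longrightarrow> (\<lambda>x. u x i) \<in> borel_measurable M"
  shows "(\<lambda>x. sort (map (u x) [0..<n])) \<in> measurable M particle_space"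
proof -
  have "(\<lambda>x. sort (map (u x) js)) \<in> measurable M particle_space" if "set js \<subseteq> {..<n}" for js
    using that
  proof (induction js)
    case (Cons i js)
    note [measurable] = assms[of i]
    from Cons show ?case by simp
  qed simp
  from this[of "[0..<n]"] show ?thesis by (simp add: lessThan_atLeast0)
qed

lemma measurable_sort [measurable]: "sort \<in> measurable particle_space particle_space"
proof -
  have "(\<lambda>x. sort (map (\<lambda>i. x ! i) [0..<m])) \<in> measurable particle_space particle_space" for m
    by (rule measurable_sort_map) measurable
  from measurable_by_length[of "\<lambda>m x. sort (map (\<lambda>i. x ! i) [0..<m])", OF this, of "\<lambda>x. x"]
  show ?thesis by (simp add: map_nth)
qed

section \<open>Measurability of the evolution\<close>

lemma measurable_flow_coeff [measurable (raw)]: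
  assumes [measurable]: "f \<in> borel_measurable M" and "i < n + 2" "j < n + 2"
  shows "(\<lambda>x. flow_coeff n (f x) i j) \<in> borel_measurable M"
proof -
  have "(\<lambda>t. flow_coeff n t i j) \<in> borel_measurable borel"
    using flow_coeff_continuous[OF assms(2,3)]
    by (intro borel_measurable_continuous_onI continuous_at_imp_continuous_on) auto
  from measurable_compose[OF assms(1) this] show ?thesis .
qed

lemma measurable_linear_flow [measurable (raw)]:
  assumes [measurable]: "f \<in> borel_measurable M" "g \<in> measurable M particle_space"
  shows "(\<lambda>x. linear_flow (f x) (g x)) \<in> measurable M particle_space"
proof (rule measurable_particle_spaceI)
  show "(\<lambda>x. length (linear_flow (f x) (g x))) \<in> measurable M (count_space UNIV)"
    by (simp add: length_linear_flow_general)
  fix n i :: nat assume "i < n"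
  define h where "h m x = (if i < m - 2 + 2 then \<Sum>j<m. flow_coeff (m - 2) (f x) i j * g x ! j else 0)" for m x
  have m: "(\<lambda>x. h m x) \<in> borel_measurable M" for m
  proof (cases "i < m - 2 + 2")
    case True
    have [measurable]: "(\<lambda>x. flow_coeff (m - 2) (f x) i j) \<in> borel_measurable M" if "j < m" for j
      by (rule measurable_flow_coeff) (use True that in auto)
    show ?thesis using True unfolding h_def by simp
  qed (simp add: h_def)
  have "(\<lambda>x. h (length (g x)) x) \<in> borel_measurable M"
    by (rule measurable_by_length[OF m]) measurable
  moreover have "linear_flow (f x) (g x) ! i = h (length (g x)) x" if "length (linear_flow (f x) (g x)) = n" for x
    using that \<open>i < n\<close> by (simp add: linear_flow_nth_general h_def length_linear_flow_general)
  ultimately show "\<exists>h\<in>borel_measurable M. \<forall>x\<in>space M. length (linear_flow (f x) (g x)) = n \<longrightarrow> linear_flow (f x) (g x) ! i = h x"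
    by (intro bexI[of _ "\<lambda>x. h (length (g x)) x"]) auto
qed

lemma pred_Delta [measurable]: "Measurable.pred particle_space (\<lambda>x. x \<in> Delta n)"
  unfolding Delta_iff by measurable

lemma pred_Delta_open [measurable]: "Measurable.pred particle_space (\<lambda>x. x \<in> Delta_open n)"
  unfolding Delta_open_iff by measurable

text \<open>By \<open>less_collision_time_iff\<close>, the superlevel sets are preimages of the open simplex under the flow at a
fixed time.\<close>

lemma measurable_collision_time:
  "(\<lambda>x. if x \<in> Delta n then collision_time x else \<infinity>) \<in> borel_measurable particle_space"
proof (rule borel_measurableI_greater)
  fix y :: ereal
  have "{x \<in> space particle_space. y < (if x \<in> Delta n then collision_time x else \<infinity>)}
    = (if y < 0 then UNIV else if y = \<infinity> then {}
       else {x. x \<in> Delta n \<longrightarrow> linear_flow (real_of_ereal y) x \<in> Delta_open n})"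
  proof (cases y)
    case (real r)
    show ?thesis
    proof (cases "y < 0")
      case True
      then show ?thesis using less_le_trans[OF True collision_time_nonneg] real by auto
    next
      case False
      then have "0 \<le> r" using real by simp
      then show ?thesis using less_collision_time_iff[OF _ \<open>0 \<le> r\<close>] False real by auto
    qed
  next
    case MInf
    have "- \<infinity> < collision_time x" for x using collision_time_nonneg[of x] by (cases "collision_time x") auto
    then show ?thesis using MInf by auto
  qed auto
  moreover have "{x. x \<in> Delta n \<longrightarrow> linear_flow (real_of_ereal y) x \<in> Delta_open n} \<in> sets particle_space"
  proof -
    have "{x\<in>space particle_space. x \<in> Delta n \<longrightarrow> linear_flow (real_of_ereal y) x \<in> Delta_open n} \<in> sets particle_space"
      by measurable
    then show ?thesis by simp
  qed
  moreover have "(UNIV :: real list set) \<in> sets particle_space" using sets.top[of particle_space] by simp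
  ultimately show "{x \<in> space particle_space. y < (if x \<in> Delta n then collision_time x else \<infinity>)} \<in> sets particle_space"
    by auto
qed

text \<open>Joint measurability in time and configuration is required, because the recursion evaluates the evolution with
fewer particles at the random remaining time. The value \<open>[]\<close> is a default outside the simplices.\<close>

lemma measurable_Phi_below:
  "(\<lambda>(t, x). if (\<exists>k<n. x \<in> Delta k) \<and> 0 \<le> t then Phi t x else [])
    \<in> measurable (borel \<Otimes>\<^sub>M particle_space) particle_space"
proof (induction n)
  case 0
  then show ?case by simp
next
  case (Suc n)
  define g where "g = (\<lambda>(t, x). if (\<exists>k<n. x \<in> Delta k) \<and> 0 \<le> t then Phi t x else [])"
  define \<tau> where "\<tau> x = (if x \<in> Delta n then collision_time x else \<infinity>)" for x
  have g [measurable]: "g \<in> measurable (borel \<Otimes>\<^sub>M particle_space) particle_space"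
    using Suc unfolding g_def .
  have [measurable]: "\<tau> \<in> borel_measurable particle_space"
    using measurable_collision_time unfolding \<tau>_def .
  have "(\<lambda>(t, x). if (\<exists>k<Suc n. x \<in> Delta k) \<and> 0 \<le> t then Phi t x else [])
    = (\<lambda>(t, x). if x \<in> Delta n \<and> 0 \<le> t
        then if n = 0 then x else if ereal t < \<tau> x then linear_flow t x
          else g (t - real_of_ereal (\<tau> x), remdups_adj (linear_flow (real_of_ereal (\<tau> x)) x))
        else g (t, x))"
  proof (safe intro!: ext)
    fix t :: real and x :: "real list"
    show "(if (\<exists>k<Suc n. x \<in> Delta k) \<and> 0 \<le> t then Phi t x else [])
      = (if x \<in> Delta n \<and> 0 \<le> t
        then if n = 0 then x else if ereal t < \<tau> x then linear_flow t x
          else g (t - real_of_ereal (\<tau> x), remdups_adj (linear_flow (real_of_ereal (\<tau> x)) x))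
        else g (t, x))"
    proof (cases "x \<in> Delta n \<and> 0 \<le> t")
      case False
      then show ?thesis by (auto simp: g_def less_Suc_eq)
    next
      case True
      then have l: "length x = n + 2" by (simp add: Delta_length)
      have \<tau>: "\<tau> x = collision_time x" using True by (simp add: \<tau>_def)
      have eq: "Phi t x = (if n = 0 then x else if ereal t < \<tau> x then linear_flow t x
          else Phi (t - real_of_ereal (\<tau> x)) (remdups_adj (linear_flow (real_of_ereal (\<tau> x)) x)))"
        by (subst Phi.simps) (simp add: l \<tau>)
      have "Phi (t - real_of_ereal (\<tau> x)) (remdups_adj (linear_flow (real_of_ereal (\<tau> x)) x))
        = g (t - real_of_ereal (\<tau> x), remdups_adj (linear_flow (real_of_ereal (\<tau> x)) x))"
        if le: "\<not> ereal t < \<tau> x"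
      proof -
        obtain c where c: "collision_time x = ereal c" "c \<le> t"
          using le \<tau> collision_time_nonneg[of x] by (cases "collision_time x") auto
        have "linear_flow c x \<in> Delta_boundary n"
          using flow_at_collision_time[OF _ c(1)] True by blast
        then obtain k where "k < n" "remdups_adj (linear_flow c x) \<in> Delta_open k"
          by (rule remdups_adj_Delta_boundary)
        then show ?thesis using c \<tau> Delta_open_subset by (fastforce simp: g_def)
      qed
      then show ?thesis using True eq by auto
    qed
  qed
  moreover have "\<dots> \<in> measurable (borel \<Otimes>\<^sub>M particle_space) particle_space" by measurable
  ultimately show ?case by simp
qed

lemma measurable_Phi:
  assumes [measurable]: "f \<in> borel_measurable M" "g \<in> measurable M particle_space"
    and "\<And>x. x \<in> space M \<Longrightarrow> g x \<in> Delta n" "\<And>x. x \<in> space M \<Longrightarrow> 0 \<le> f x"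
  shows "(\<lambda>x. Phi (f x) (g x)) \<in> measurable M particle_space"
proof -
  note [measurable] = measurable_Phi_below[of "Suc n"]
  have "(\<lambda>x. (\<lambda>(t, x). if (\<exists>k<Suc n. x \<in> Delta k) \<and> 0 \<le> t then Phi t x else []) (f x, g x)) \<in> measurable M particle_space"
    by measurable
  moreover have "Phi (f x) (g x) = (\<lambda>(t, x). if (\<exists>k<Suc n. x \<in> Delta k) \<and> 0 \<le> t then Phi t x else []) (f x, g x)"
    if "x \<in> space M" for x
    using assms(3,4)[OF that] by auto
  ultimately show ?thesis by (rule measurable_cong[THEN iffD2, rotated])
qed

section \<open>Independent uniform points\<close>

definition unit_lborel :: "real measure" where
  "unit_lborel = restrict_space lborel {0..1}"

lemma space_unit_lborel [simp]: "space unit_lborel = {0..1}"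
  by (simp add: unit_lborel_def space_restrict_space)

lemma prob_space_unit_lborel: "prob_space unit_lborel"
  by (rule prob_spaceI) (simp add: unit_lborel_def emeasure_restrict_space space_restrict_space)

interpretation unit: prob_space unit_lborel by (rule prob_space_unit_lborel)

lemma measurable_unit_lborel [measurable]: "(\<lambda>x. x) \<in> measurable unit_lborel borel"
  unfolding unit_lborel_def by (rule measurable_restrict_space1) simp

lemma uniform_points_eq: "uniform_points n = (\<Pi>\<^sub>M i\<in>{..<n}. unit_lborel)"
  by (simp add: uniform_points_def unit_lborel_def)

interpretation unit_product: product_prob_space "\<lambda>_::nat. unit_lborel" "UNIV"
  by unfold_locales

lemma prob_space_uniform_points: "prob_space (uniform_points n)"
  unfolding uniform_points_eq by (intro prob_space_PiM prob_space_unit_lborel)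

text \<open>The points are deliberately left unsorted: their law is a product measure, in which any coordinate can be
integrated first.\<close>

definition config :: "nat \<Rightarrow> (nat \<Rightarrow> real) \<Rightarrow> real list" where
  "config n u = add_endpoints (map u [0..<n])"

definition iid_config :: "nat \<Rightarrow> real list measure" where
  "iid_config n = distr (uniform_points n) particle_space (config n)"

text \<open>Insertion after index \<open>i\<close>. The first entry, which is the extra particle at \<open>0\<close>, thus stays in front.\<close>

definition ins :: "nat \<Rightarrow> real \<Rightarrow> real list \<Rightarrow> real list" where
  "ins i v z = take (Suc i) z @ v # drop (Suc i) z"

lemma length_ins [simp]: "length (ins i v z) = Suc (length z)"
  by (simp add: ins_def)

lemma ins_nth:
  assumes "Suc i \<le> length z" "j \<le> length z"
  shows "ins i v z ! j = (if j \<le> i then z ! j else if j = Suc i then v else z ! (j - 1))"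
proof (cases "Suc i < j")
  case True
  then obtain k where "j = Suc (Suc i + k)" using less_imp_Suc_add[of "Suc i" j] by auto
  then show ?thesis using assms by (simp add: ins_def nth_append)
next
  case False
  then show ?thesis using assms by (auto simp: ins_def nth_append)
qed

lemma config_nth:
  "j < n + 2 \<Longrightarrow> config n u ! j = (if j = 0 then 0 else if j \<le> n then u (j - 1) else 1)"
  by (auto simp: config_def add_endpoints_def nth_Cons nth_append split: nat.splits)

lemma length_config [simp]: "length (config n u) = n + 2"
  by (simp add: config_def add_endpoints_def)

lemma measurable_config [measurable]: "config n \<in> measurable (uniform_points n) particle_space"
proof (rule measurable_particle_space_fixed_length)
  fix i assume i: "i < n + 2"
  have [measurable]: "(\<lambda>u. u j) \<in> borel_measurable (uniform_points n)" if "j < n" for j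
  proof -
    have "(\<lambda>u. u j) \<in> measurable (uniform_points n) unit_lborel"
      unfolding uniform_points_eq by (rule measurable_component_singleton) (use that in simp)
    from measurable_compose[OF this measurable_unit_lborel] show ?thesis .
  qed
  show "(\<lambda>u. config n u ! i) \<in> borel_measurable (uniform_points n)"
    using i by (cases "i = 0 \<or> i = n + 1") (auto simp: config_nth)
qed simp

lemma measurable_ins [measurable (raw)]:
  assumes [measurable]: "f \<in> borel_measurable M" "g \<in> measurable M particle_space"
  shows "(\<lambda>x. ins i (f x) (g x)) \<in> measurable M particle_space"
proof (rule measurable_particle_spaceI)
  show "(\<lambda>x. length (ins i (f x) (g x))) \<in> measurable M (count_space UNIV)" by simp
  fix n j :: nat assume j: "j < n"
  define p where "p = min (Suc i) (n - 1)"
  have "ins i (f x) (g x) ! j = (if j < p then g x ! j else if j = p then f x else g x ! (j - 1))"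
    if "length (ins i (f x) (g x)) = n" for x
  proof -
    show ?thesis
    proof (cases "Suc i \<le> length (g x)")
      case True
      then show ?thesis using that j by (auto simp: ins_nth p_def)
    next
      case False
      then show ?thesis using that j by (auto simp: ins_def nth_append p_def)
    qed
  qed
  then show "\<exists>h\<in>borel_measurable M. \<forall>x\<in>space M. length (ins i (f x) (g x)) = n \<longrightarrow> ins i (f x) (g x) ! j = h x"
    by (intro bexI[of _ "\<lambda>x. if j < p then g x ! j else if j = p then f x else g x ! (j - 1)"]) auto
qed

lemma sets_iid_config [measurable_cong, simp]: "sets (iid_config n) = sets particle_space"
  by (simp add: iid_config_def)

lemma space_iid_config [simp]: "space (iid_config n) = UNIV"
  by (simp add: iid_config_def)

lemma prob_space_iid_config: "prob_space (iid_config n)"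
  unfolding iid_config_def by (intro prob_space.prob_space_distr prob_space_uniform_points) measurable

interpretation iid: prob_space "iid_config n" for n by (rule prob_space_iid_config)

definition insert_coord :: "nat \<Rightarrow> nat \<Rightarrow> (nat \<Rightarrow> real) \<times> real \<Rightarrow> nat \<Rightarrow> real" where
  "insert_coord n i = (\<lambda>(u, v). \<lambda>j\<in>{..<Suc n}. if j < i then u j else if j = i then v else u (j - 1))"

lemma distr_insert_coord:
  assumes "i \<le> n"
  shows "insert_coord n i \<in> measurable (uniform_points n \<Otimes>\<^sub>M unit_lborel) (uniform_points (Suc n))"
    and "distr (uniform_points n \<Otimes>\<^sub>M unit_lborel) (uniform_points (Suc n)) (insert_coord n i) = uniform_points (Suc n)"
proof -
  let ?N = "uniform_points n \<Otimes>\<^sub>M unit_lborel"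
  show m: "insert_coord n i \<in> measurable ?N (uniform_points (Suc n))"
    unfolding uniform_points_eq insert_coord_def case_prod_beta'
  proof (rule measurable_restrict)
    fix j assume "j \<in> {..<Suc n}"
    then show "(\<lambda>p. if j < i then fst p j else if j = i then snd p else fst p (j - 1))
        \<in> measurable ((\<Pi>\<^sub>M i\<in>{..<n}. unit_lborel) \<Otimes>\<^sub>M unit_lborel) unit_lborel"
      using assms
      by (cases "j < i"; cases "j = i")
        (auto intro!: measurable_compose[OF measurable_fst measurable_component_singleton])
  qed
  have "distr ?N (uniform_points (Suc n)) (insert_coord n i) = (\<Pi>\<^sub>M i\<in>{..<Suc n}. unit_lborel)"
  proof (rule unit_product.PiM_eqI)
    show "sets (distr ?N (uniform_points (Suc n)) (insert_coord n i)) = sets (\<Pi>\<^sub>M i\<in>{..<Suc n}. unit_lborel)"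
      by (simp add: uniform_points_eq)
    fix A :: "nat \<Rightarrow> real set" assume A: "\<And>j. j \<in> {..<Suc n} \<Longrightarrow> A j \<in> sets unit_lborel"
    \<comment> \<open>The positions of the old coordinates after the insertion.\<close>
    define s where "s j = (if j < i then j else Suc j)" for j
    have s: "s j < Suc n" if "j < n" for j using that by (auto simp: s_def)
    have Asub: "A j \<subseteq> {0..1}" if "j < Suc n" for j using sets.sets_into_space[OF A] that by auto
    have split: "{..<Suc n} = insert i (s ` {..<n})"
    proof (intro equalityI subsetI)
      fix j assume "j \<in> {..<Suc n}"
      then show "j \<in> insert i (s ` {..<n})"
        using assms by (cases "j < i"; cases "j = i")
          (auto simp: s_def image_iff intro: bexI[of _ j] bexI[of _ "j - 1"])
    qed (use assms s in auto)
    have pre: "insert_coord n i -` Pi\<^sub>E {..<Suc n} A \<inter> space ?N = Pi\<^sub>E {..<n} (\<lambda>j. A (s j)) \<times> A i"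
    proof -
      have mem: "insert_coord n i (u, v) \<in> Pi\<^sub>E {..<Suc n} A \<longleftrightarrow> (\<forall>j<n. u j \<in> A (s j)) \<and> v \<in> A i" for u v
      proof -
        have "insert_coord n i (u, v) \<in> Pi\<^sub>E {..<Suc n} A \<longleftrightarrow> (\<forall>j\<in>insert i (s ` {..<n}). insert_coord n i (u, v) j \<in> A j)"
          unfolding split[symmetric] by (auto simp: insert_coord_def PiE_iff)
        moreover have "insert_coord n i (u, v) i = v" using assms by (simp add: insert_coord_def)
        moreover have "insert_coord n i (u, v) (s j) = u j" if "j < n" for j
          using s[OF that] by (auto simp: insert_coord_def s_def)
        ultimately show ?thesis by auto
      qed
      have space1: "(u, v) \<in> space ?N" if "u \<in> extensional {..<n}" "\<forall>j<n. u j \<in> A (s j)" "v \<in> A i" for u v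
      proof -
        have "u j \<in> {0..1}" if "j < n" for j
          using Asub[OF s[OF that]] \<open>\<forall>j<n. u j \<in> A (s j)\<close> that by blast
        moreover have "v \<in> {0..1}" using Asub[of i] \<open>v \<in> A i\<close> assms by auto
        ultimately show ?thesis
          using that(1) by (simp add: space_pair_measure uniform_points_eq space_PiM PiE_iff)
      qed
      have space2: "(u, v) \<in> space ?N \<Longrightarrow> u \<in> extensional {..<n}" for u v
        by (auto simp: space_pair_measure uniform_points_eq space_PiM PiE_iff)
      show ?thesis
      proof (rule Set.set_eqI)
        fix p :: "(nat \<Rightarrow> real) \<times> real"
        obtain u v where p: "p = (u, v)" by (cases p)
        have "p \<in> Pi\<^sub>E {..<n} (\<lambda>j. A (s j)) \<times> A i \<longleftrightarrow> u \<in> extensional {..<n} \<and> (\<forall>j<n. u j \<in> A (s j)) \<and> v \<in> A i"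
          unfolding p by (auto simp: PiE_iff)
        then show "p \<in> insert_coord n i -` Pi\<^sub>E {..<Suc n} A \<inter> space ?N \<longleftrightarrow> p \<in> Pi\<^sub>E {..<n} (\<lambda>j. A (s j)) \<times> A i"
          using mem[of u v] space1[of u v] space2[of u v] unfolding p vimage_eq Int_iff by argo
      qed
    qed
    have box: "Pi\<^sub>E {..<n} (\<lambda>j. A (s j)) \<in> sets (uniform_points n)"
      unfolding uniform_points_eq by (intro sets_PiM_I_finite) (use A s in auto)
    have "emeasure (distr ?N (uniform_points (Suc n)) (insert_coord n i)) (Pi\<^sub>E {..<Suc n} A)
      = emeasure ?N (Pi\<^sub>E {..<n} (\<lambda>j. A (s j)) \<times> A i)"
      unfolding pre[symmetric]
      by (rule emeasure_distr[OF m]) (auto simp: uniform_points_eq intro!: sets_PiM_I_finite A)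
    also have "\<dots> = emeasure (uniform_points n) (Pi\<^sub>E {..<n} (\<lambda>j. A (s j))) * emeasure unit_lborel (A i)"
      by (rule unit.emeasure_pair_measure_Times) (use box A assms in auto)
    also have "\<dots> = (\<Prod>j<n. emeasure unit_lborel (A (s j))) * emeasure unit_lborel (A i)"
      unfolding uniform_points_eq by (subst unit_product.emeasure_PiM) (use A s in auto)
    also have "\<dots> = (\<Prod>j<Suc n. emeasure unit_lborel (A j))"
    proof -
      have "i \<notin> s ` {..<n}" "inj_on s {..<n}" by (auto simp: s_def inj_on_def split: if_splits)
      then show ?thesis unfolding split by (simp add: prod.reindex mult.commute)
    qed
    finally show "emeasure (distr ?N (uniform_points (Suc n)) (insert_coord n i)) (Pi\<^sub>E {..<Suc n} A)
      = (\<Prod>j<Suc n. emeasure unit_lborel (A j))" .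
  qed auto
  then show "distr ?N (uniform_points (Suc n)) (insert_coord n i) = uniform_points (Suc n)"
    by (simp add: uniform_points_eq)
qed

lemma config_insert_coord:
  assumes "i \<le> n"
  shows "config (Suc n) (insert_coord n i (u, v)) = ins i v (config n u)"
proof (rule nth_equalityI)
  show "length (config (Suc n) (insert_coord n i (u, v))) = length (ins i v (config n u))" by simp
  fix j assume "j < length (config (Suc n) (insert_coord n i (u, v)))"
  then have j: "j \<le> n + 2" by simp
  then show "config (Suc n) (insert_coord n i (u, v)) ! j = ins i v (config n u) ! j"
    using assms by (auto simp: config_nth ins_nth insert_coord_def)
qed

text \<open>Independent points are exchangeable, so the new point may be put at any fixed position. Every use of
Fubini's theorem in a single coordinate goes through this identity.\<close>

lemma iid_config_Suc:
  assumes "i \<le> n"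
  shows "iid_config (Suc n) = distr (iid_config n \<Otimes>\<^sub>M unit_lborel) particle_space (\<lambda>(z, v). ins i v z)"
proof -
  let ?N = "uniform_points n \<Otimes>\<^sub>M unit_lborel"
  have id: "distr unit_lborel unit_lborel (\<lambda>v. v) = unit_lborel" by simp
  have "iid_config (Suc n) = distr (distr ?N (uniform_points (Suc n)) (insert_coord n i)) particle_space (config (Suc n))"
    unfolding distr_insert_coord(2)[OF assms] iid_config_def ..
  also have "\<dots> = distr ?N particle_space (config (Suc n) \<circ> insert_coord n i)"
    by (rule distr_distr[OF measurable_config distr_insert_coord(1)[OF assms]])
  also have "config (Suc n) \<circ> insert_coord n i = (\<lambda>(z, v). ins i v z) \<circ> (\<lambda>(u, v). (config n u, v))"
    using config_insert_coord[OF assms] by (auto simp: fun_eq_iff)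
  also have "distr ?N particle_space \<dots> = distr (distr ?N (particle_space \<Otimes>\<^sub>M unit_lborel) (\<lambda>(u, v). (config n u, v))) particle_space (\<lambda>(z, v). ins i v z)"
    by (rule distr_distr[symmetric]) measurable
  also have "distr ?N (particle_space \<Otimes>\<^sub>M unit_lborel) (\<lambda>(u, v). (config n u, v)) = iid_config n \<Otimes>\<^sub>M distr unit_lborel unit_lborel (\<lambda>v. v)"
    unfolding iid_config_def
    by (rule pair_measure_distr[symmetric]) (use unit.sigma_finite_measure_axioms id in auto)
  finally show ?thesis unfolding id .
qed

lemma nn_integral_iid_config_Suc:
  assumes "i \<le> n" and [measurable]: "f \<in> borel_measurable particle_space"
  shows "(\<integral>\<^sup>+y. f y \<partial>iid_config (Suc n)) = (\<integral>\<^sup>+z. \<integral>\<^sup>+v. f (ins i v z) \<partial>unit_lborel \<partial>iid_config n)"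
proof -
  have "(\<integral>\<^sup>+y. f y \<partial>iid_config (Suc n)) = (\<integral>\<^sup>+p. f ((\<lambda>(z, v). ins i v z) p) \<partial>(iid_config n \<Otimes>\<^sub>M unit_lborel))"
    unfolding iid_config_Suc[OF assms(1)] by (rule nn_integral_distr) measurable
  also have "\<dots> = (\<integral>\<^sup>+z. \<integral>\<^sup>+v. f ((\<lambda>(z, v). ins i v z) (z, v)) \<partial>unit_lborel \<partial>iid_config n)"
    by (rule unit.nn_integral_fst[symmetric]) measurable
  finally show ?thesis by simp
qed

lemma integral_iid_config_Suc:
  fixes f :: "real list \<Rightarrow> real"
  assumes "i \<le> n" and [measurable]: "f \<in> borel_measurable particle_space"
    and int: "integrable (iid_config (Suc n)) f"
  shows "(\<integral>y. f y \<partial>iid_config (Suc n)) = (\<integral>z. \<integral>v. f (ins i v z) \<partial>unit_lborel \<partial>iid_config n)"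
proof -
  interpret pair_sigma_finite "iid_config n" unit_lborel by unfold_locales
  have "(\<integral>y. f y \<partial>iid_config (Suc n)) = (\<integral>p. f ((\<lambda>(z, v). ins i v z) p) \<partial>(iid_config n \<Otimes>\<^sub>M unit_lborel))"
    unfolding iid_config_Suc[OF assms(1)] by (rule integral_distr) measurable
  also have "\<dots> = (\<integral>z. \<integral>v. f ((\<lambda>(z, v). ins i v z) (z, v)) \<partial>unit_lborel \<partial>iid_config n)"
  proof (rule integral_fst'[symmetric])
    show "integrable (iid_config n \<Otimes>\<^sub>M unit_lborel) (\<lambda>p. f ((\<lambda>(z, v). ins i v z) p))"
      using int unfolding iid_config_Suc[OF assms(1)] by (subst (asm) integrable_distr_eq) measurable
  qed
  finally show ?thesis by simp
qed

lemma AE_iid_config_Suc: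
  assumes "i \<le> n" and [measurable]: "Measurable.pred particle_space Q"
    and "AE z in iid_config n. AE v in unit_lborel. Q (ins i v z)"
  shows "AE y in iid_config (Suc n). Q y"
proof -
  interpret pair_sigma_finite "iid_config n" unit_lborel by unfold_locales
  have "AE p in iid_config n \<Otimes>\<^sub>M unit_lborel. Q ((\<lambda>(z, v). ins i v z) p)"
  proof (rule AE_pair_measure)
    show "{p \<in> space (iid_config n \<Otimes>\<^sub>M unit_lborel). Q ((\<lambda>(z, v). ins i v z) p)} \<in> sets (iid_config n \<Otimes>\<^sub>M unit_lborel)"
      by measurable
  qed (use assms(3) in simp)
  then show ?thesis
    unfolding iid_config_Suc[OF assms(1)] 
    using assms(2) by (subst AE_distr_iff) (auto simp: pred_def split_beta')
qed

section \<open>The divergence theorem in one coordinate\<close>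

lemma ins_in_Delta_iff:
  assumes "i \<le> n"
  shows "ins i v z \<in> Delta (Suc n) \<longleftrightarrow> z \<in> Delta n \<and> z ! i \<le> v \<and> v \<le> z ! (i + 1)"
proof (cases "length z = n + 2")
  case True
  have nth: "ins i v z ! j = (if j \<le> i then z ! j else if j = Suc i then v else z ! (j - 1))" if "j \<le> n + 2" for j
    using ins_nth[of i z j v] True assms that by simp
  have "(\<forall>j\<le>Suc n. ins i v z ! j \<le> ins i v z ! (j + 1))
      \<longleftrightarrow> (\<forall>j\<le>n. z ! j \<le> z ! (j + 1)) \<and> z ! i \<le> v \<and> v \<le> z ! (i + 1)" (is "?L = ?R")
  proof
    assume L: ?L
    have 1: "z ! i \<le> v" "v \<le> z ! (i + 1)" using L[rule_format, of i] L[rule_format, of "Suc i"] assms by (auto simp: nth)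
    have "z ! j \<le> z ! (j + 1)" if "j \<le> n" for j
    proof -
      consider "j < i" | "j = i" | "i < j" by linarith
      then show ?thesis
      proof cases
        assume "j < i" then show ?thesis using L[rule_format, of j] that by (simp add: nth)
      next
        assume "j = i" then show ?thesis using 1 by simp
      next
        assume "i < j" then show ?thesis using L[rule_format, of "Suc j"] that by (simp add: nth)
      qed
    qed
    then show ?R using 1 by blast
  next
    assume R: ?R
    show ?L
    proof (intro allI impI)
      fix j assume j: "j \<le> Suc n"
      consider "j < i" | "j = i" | "j = Suc i" | "Suc i < j" by linarith
      then show "ins i v z ! j \<le> ins i v z ! (j + 1)"
      proof cases
        assume "j < i" then show ?thesis using R assms j by (simp add: nth)
      next
        assume "j = i" then show ?thesis using R assms j by (simp add: nth)
      next
        assume "j = Suc i" then show ?thesis using R assms j by (simp add: nth)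
      next
        assume "Suc i < j"
        then obtain k where k: "j = Suc k" by (cases j) auto
        then have "z ! k \<le> z ! (k + 1)" using R j by auto
        then show ?thesis using \<open>Suc i < j\<close> assms j k by (simp add: nth)
      qed
    qed
  qed
  then show ?thesis using True assms by (auto simp: Delta_iff nth)
qed (auto simp: Delta_iff)

lemma Delta_mono:
  assumes "z \<in> Delta n" "i \<le> j" "j \<le> n + 1"
  shows "z ! i \<le> z ! j"
  using assms by (intro sorted_nth_mono) (auto simp: Delta_def)

lemma Delta_bounds:
  assumes "z \<in> Delta n" "i \<le> n + 1"
  shows "0 \<le> z ! i" "z ! i \<le> 1"
  using Delta_mono[OF assms(1), of 0 i] Delta_mono[OF assms(1), of i "n + 1"] assms by (auto simp: Delta_iff)

lemma integrable_iid_config_bounded: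
  fixes f :: "real list \<Rightarrow> real"
  assumes [measurable]: "f \<in> borel_measurable particle_space"
    and "\<And>y. \<bar>f y\<bar> \<le> C"
  shows "integrable (iid_config n) f"
  by (rule iid.integrable_const_bound[of _ C]) (use assms in auto)

lemma integral_unit_lborel:
  fixes g :: "real \<Rightarrow> real"
  shows "(\<integral>v. g v \<partial>unit_lborel) = (\<integral>v. indicator {0..1} v * g v \<partial>lborel)"
  unfolding unit_lborel_def by (subst integral_restrict_space) auto

text \<open>For fixed other particles \<open>z\<close>, the inserted particle \<open>v\<close> ranges between its neighbours \<open>a\<close> and \<open>b\<close>, and its
velocity \<open>2v - a - b\<close> has derivative \<open>2\<close>. The integrand is thus the derivative of \<open>(2v - a - b) F\<close>, which
has the boundary value \<open>(b - a) F\<close> at \<open>b\<close> and \<open>-(b - a) F\<close> at \<open>a\<close>: the flux is the width of the gap on both faces.\<close>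

lemma divergence_coordinate:
  fixes F D :: "real list \<Rightarrow> real"
  assumes i: "i \<le> n"
    and [measurable]: "F \<in> borel_measurable particle_space" "D \<in> borel_measurable particle_space"
    and bound: "\<And>y. y \<in> Delta (Suc n) \<Longrightarrow> \<bar>F y\<bar> \<le> C" "\<And>y. y \<in> Delta (Suc n) \<Longrightarrow> \<bar>D y\<bar> \<le> C"
    and deriv: "\<And>z v. z \<in> Delta n \<Longrightarrow> ((\<lambda>v. F (ins i v z)) has_field_derivative D (ins i v z)) (at v)"
    and cont: "\<And>z v. z \<in> Delta n \<Longrightarrow> isCont (\<lambda>v. D (ins i v z)) v"
  shows "(\<integral>y. indicator (Delta (Suc n)) y * (2 * F y + vel y (Suc i) * D y) \<partial>iid_config (Suc n))
    = (\<integral>z. indicator (Delta n) z *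
        ((z ! (i + 1) - z ! i) * (F (ins i (z ! i) z) + F (ins i (z ! (i + 1)) z))) \<partial>iid_config n)"
proof -
  let ?g = "\<lambda>y. indicator (Delta (Suc n)) y * (2 * F y + (2 * y ! Suc i - y ! i - y ! (i + 2)) * D y)"
  have vel: "vel y (Suc i) = 2 * y ! Suc i - y ! i - y ! (i + 2)" if "y \<in> Delta (Suc n)" for y
    using that i by (auto simp: vel_def Delta_iff numeral_2_eq_2)
  have [measurable]: "?g \<in> borel_measurable particle_space" by measurable
  have C: "0 \<le> C" if "y \<in> Delta (Suc n)" for y using bound(1)[OF that] by linarith
  have gb: "\<bar>?g y\<bar> \<le> 2 * \<bar>C\<bar> + 4 * \<bar>C\<bar>" for y
  proof (cases "y \<in> Delta (Suc n)")
    case True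
    have "\<bar>2 * y ! Suc i - y ! i - y ! (i + 2)\<bar> \<le> 4"
      using Delta_bounds[OF True, of "Suc i"] Delta_bounds[OF True, of i] Delta_bounds[OF True, of "i + 2"] i
      by (simp add: abs_le_iff)
    then have "\<bar>(2 * y ! Suc i - y ! i - y ! (i + 2)) * D y\<bar> \<le> 4 * \<bar>C\<bar>"
      unfolding abs_mult using bound(2)[OF True] by (intro mult_mono) auto
    then show ?thesis using bound(1)[OF True] True C[OF True] by (simp add: abs_le_iff)
  qed simp
  have "(\<integral>y. indicator (Delta (Suc n)) y * (2 * F y + vel y (Suc i) * D y) \<partial>iid_config (Suc n))
    = (\<integral>y. ?g y \<partial>iid_config (Suc n))"
    by (rule Bochner_Integration.integral_cong) (auto simp: indicator_def vel)
  also have "\<dots> = (\<integral>z. \<integral>v. ?g (ins i v z) \<partial>unit_lborel \<partial>iid_config n)"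
    by (rule integral_iid_config_Suc[OF i _ integrable_iid_config_bounded]) (measurable, rule gb)
  also have "\<dots> = (\<integral>z. indicator (Delta n) z *
        ((z ! (i + 1) - z ! i) * (F (ins i (z ! i) z) + F (ins i (z ! (i + 1)) z))) \<partial>iid_config n)"
  proof (rule Bochner_Integration.integral_cong[OF refl])
    fix z :: "real list"
    show "(\<integral>v. ?g (ins i v z) \<partial>unit_lborel) = indicator (Delta n) z *
        ((z ! (i + 1) - z ! i) * (F (ins i (z ! i) z) + F (ins i (z ! (i + 1)) z)))"
    proof (cases "z \<in> Delta n")
      case False
      then show ?thesis using ins_in_Delta_iff[OF i] by (simp add: indicator_def)
    next
      case True
      define a b where "a = z ! i" and "b = z ! (i + 1)"
      have l: "length z = n + 2" using True by (rule Delta_length)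
      have ab: "0 \<le> a" "a \<le> b" "b \<le> 1"
        using Delta_bounds[OF True, of i] Delta_bounds[OF True, of "i + 1"] Delta_mono[OF True, of i "i + 1"] i
        by (auto simp: a_def b_def)
      let ?f = "\<lambda>v. 2 * F (ins i v z) + (2 * v - a - b) * D (ins i v z)"
      have "(\<integral>v. ?g (ins i v z) \<partial>unit_lborel) = (\<integral>v. indicator {a..b} v *\<^sub>R ?f v \<partial>lborel)"
        unfolding integral_unit_lborel
      proof (rule Bochner_Integration.integral_cong[OF refl])
        fix v :: real
        show "indicator {0..1} v * ?g (ins i v z) = indicator {a..b} v *\<^sub>R ?f v"
          using ins_in_Delta_iff[OF i, of v z] True ab l i
          by (auto simp: indicator_def a_def b_def ins_nth numeral_2_eq_2)
      qed
      also have "\<dots> = (2 * b - a - b) * F (ins i b z) - (2 * a - a - b) * F (ins i a z)"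
      proof (rule integral_FTC_Icc[OF ab(2)])
        fix v
        show "((\<lambda>v. (2 * v - a - b) * F (ins i v z)) has_vector_derivative ?f v) (at v within {a..b})"
        proof -
          have "((\<lambda>v. (2 * v - a - b) * F (ins i v z)) has_field_derivative
              (2 * v - a - b) * D (ins i v z) + 2 * F (ins i v z)) (at v)"
            by (intro DERIV_mult' deriv[OF True]) (auto intro!: derivative_eq_intros)
          then show ?thesis
            by (simp add: has_real_derivative_iff_has_vector_derivative add.commute has_vector_derivative_at_within)
        qed
      next
        have "isCont (\<lambda>v. F (ins i v z)) v" for v using deriv[OF True] by (rule DERIV_isCont)
        then show "continuous_on {a..b} ?f"
          by (intro continuous_at_imp_continuous_on ballI continuous_intros cont[OF True])
      qed
      also have "\<dots> = (b - a) * (F (ins i a z) + F (ins i b z))" by (simp add: algebra_simps)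
      finally show ?thesis using True by (simp add: a_def b_def)
    qed
  qed
  finally show ?thesis .
qed

section \<open>Smoothed boxes along the backward flow\<close>

text \<open>As \<open>K\<close> tends to infinity, this smooth function tends to the indicator of \<open>x\<^sub>k \<le> a\<^sub>k\<close> for all \<open>k\<close>. The shift
by \<open>-K\<close> in the exponent, which is small against \<open>K\<^sup>2\<close>, makes the limit \<open>1\<close> also where \<open>x\<^sub>k = a\<^sub>k\<close>.\<close>

definition soft_box :: "nat \<Rightarrow> nat \<Rightarrow> (nat \<Rightarrow> real) \<Rightarrow> real list \<Rightarrow> real" where
  "soft_box m K a x = exp (- (\<Sum>k<m. exp (real K ^ 2 * (x ! k - a k) - real K)))"

text \<open>The partial derivative with respect to \<open>y\<^sub>l\<close> of the smoothed box at \<open>e\<^bsup>-rA\<^esup>y\<close>.\<close>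

definition soft_box_grad :: "nat \<Rightarrow> nat \<Rightarrow> (nat \<Rightarrow> real) \<Rightarrow> real \<Rightarrow> nat \<Rightarrow> real list \<Rightarrow> real" where
  "soft_box_grad N K a r l y = - soft_box (N + 2) K a (linear_flow (- r) y) *
     (\<Sum>k<N + 2. exp (real K ^ 2 * (linear_flow (- r) y ! k - a k) - real K) * (real K ^ 2 * flow_coeff N (- r) k l))"

lemma measurable_soft_box [measurable]: "soft_box m K a \<in> borel_measurable particle_space"
  unfolding soft_box_def by measurable

lemma soft_box_bounds: "0 < soft_box m K a x" "soft_box m K a x \<le> 1"
  by (auto simp: soft_box_def intro!: sum_nonneg)

lemma DERIV_soft_box:
  assumes "\<And>k. k < m \<Longrightarrow> ((\<lambda>s. x s ! k) has_field_derivative d k) (at s)"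
  shows "((\<lambda>s. soft_box m K a (x s)) has_field_derivative
    - soft_box m K a (x s) * (\<Sum>k<m. exp (real K ^ 2 * (x s ! k - a k) - real K) * (real K ^ 2 * d k))) (at s)"
proof -
  have "((\<lambda>s. - (\<Sum>k<m. exp (real K ^ 2 * (x s ! k - a k) - real K))) has_field_derivative
      - (\<Sum>k<m. exp (real K ^ 2 * (x s ! k - a k) - real K) * (real K ^ 2 * d k))) (at s)"
  proof (intro DERIV_minus DERIV_sum)
    fix k assume "k \<in> {..<m}"
    then have "((\<lambda>s. real K ^ 2 * (x s ! k - a k) - real K) has_field_derivative real K ^ 2 * d k) (at s)"
      by (auto intro!: derivative_eq_intros assms)
    from DERIV_fun_exp[OF this] show "((\<lambda>s. exp (real K ^ 2 * (x s ! k - a k) - real K)) has_field_derivative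
      exp (real K ^ 2 * (x s ! k - a k) - real K) * (real K ^ 2 * d k)) (at s)" .
  qed
  from DERIV_fun_exp[OF this] show ?thesis unfolding soft_box_def by simp
qed

text \<open>The exponentials in the gradient are unbounded, but each is multiplied by a factor at most \<open>e\<^bsup>-s\<^esup>\<close>
where \<open>s\<close> is its own value, and \<open>s e\<^bsup>-s\<^esup> \<le> 1\<close>.\<close>

lemma soft_box_grad_bound:
  assumes "\<And>k. k < N + 2 \<Longrightarrow> \<bar>flow_coeff N (- r) k l\<bar> \<le> C"
  shows "\<bar>soft_box_grad N K a r l y\<bar> \<le> real (N + 2) * (real K ^ 2 * C)"
proof -
  let ?e = "\<lambda>k. exp (real K ^ 2 * (linear_flow (- r) y ! k - a k) - real K)"
  let ?F = "soft_box (N + 2) K a (linear_flow (- r) y)"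
  have Fe: "?F * ?e k \<le> 1" if "k < N + 2" for k
  proof -
    have "?e k \<le> (\<Sum>k<N + 2. ?e k)" by (rule member_le_sum) (use that in auto)
    then have "?F \<le> exp (- ?e k)" by (simp add: soft_box_def)
    then have "?F * ?e k \<le> exp (- ?e k) * ?e k" by (rule mult_right_mono) simp
    also have "\<dots> \<le> exp (- ?e k) * exp (?e k)"
    proof (rule mult_left_mono)
      show "?e k \<le> exp (?e k)" using exp_ge_add_one_self[of "?e k"] by linarith
    qed simp
    finally show ?thesis by (simp add: exp_minus)
  qed
  have "\<bar>soft_box_grad N K a r l y\<bar> = \<bar>\<Sum>k<N + 2. (?F * ?e k) * (real K ^ 2 * flow_coeff N (- r) k l)\<bar>"
    by (simp add: soft_box_grad_def sum_distrib_left mult.assoc sum_negf)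
  also have "\<dots> \<le> (\<Sum>k<N + 2. \<bar>(?F * ?e k) * (real K ^ 2 * flow_coeff N (- r) k l)\<bar>)" by (rule sum_abs)
  also have "\<dots> \<le> (\<Sum>k<N + 2. 1 * (real K ^ 2 * C))"
  proof (rule sum_mono)
    fix k assume "k \<in> {..<N + 2}"
    then have k: "k < N + 2" by simp
    show "\<bar>(?F * ?e k) * (real K ^ 2 * flow_coeff N (- r) k l)\<bar> \<le> 1 * (real K ^ 2 * C)"
      unfolding abs_mult[of "?F * ?e k"]
    proof (rule mult_mono)
      show "\<bar>?F * ?e k\<bar> \<le> 1" using Fe[OF k] soft_box_bounds(1) by (simp add: abs_mult less_imp_le)
      show "\<bar>real K ^ 2 * flow_coeff N (- r) k l\<bar> \<le> real K ^ 2 * C"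
        unfolding abs_mult by (intro mult_mono) (use assms[OF k] in auto)
    qed auto
  qed
  finally show ?thesis by simp
qed

lemma DERIV_soft_box_ins:
  assumes l: "length z = n + 2" and i: "i \<le> n"
  shows "((\<lambda>v. soft_box (Suc n + 2) K a (linear_flow (- r) (ins i v z))) has_field_derivative
    soft_box_grad (Suc n) K a r (Suc i) (ins i v z)) (at v)"
  unfolding soft_box_grad_def
proof (rule DERIV_soft_box)
  fix k assume k: "k < Suc n + 2"
  have ins: "((\<lambda>v. ins i v z ! j) has_field_derivative (if j = Suc i then 1 else 0)) (at v)"
    if "j < Suc n + 2" for j
    using that l i by (cases "j \<le> i"; cases "j = Suc i") (auto simp: ins_nth)
  have "((\<lambda>v. \<Sum>j<Suc n + 2. flow_coeff (Suc n) (- r) k j * ins i v z ! j) has_field_derivative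
      (\<Sum>j<Suc n + 2. flow_coeff (Suc n) (- r) k j * (if j = Suc i then 1 else 0))) (at v)"
    by (intro DERIV_sum DERIV_cmult ins) auto
  moreover have "(\<Sum>j<Suc n + 2. flow_coeff (Suc n) (- r) k j * (if j = Suc i then 1 else 0)) = flow_coeff (Suc n) (- r) k (Suc i)"
    using i by (simp add: if_distrib[of "\<lambda>x. _ * x"] cong: if_cong)
  ultimately show "((\<lambda>v. linear_flow (- r) (ins i v z) ! k) has_field_derivative flow_coeff (Suc n) (- r) k (Suc i)) (at v)"
    using l k by (simp add: linear_flow_nth[of _ "Suc n"])
qed

lemma isCont_soft_box_grad_ins:
  assumes l: "length z = n + 2" and i: "i \<le> n"
  shows "isCont (\<lambda>v. soft_box_grad (Suc n) K a r (Suc i) (ins i v z)) v"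
proof -
  have "isCont (\<lambda>v. ins i v z ! j) v" if "j < Suc n + 2" for j
    using that l i by (cases "j \<le> i"; cases "j = Suc i") (auto simp: ins_nth)
  then have "isCont (\<lambda>v. linear_flow (- r) (ins i v z) ! k) v" if "k < Suc n + 2" for k
    using that l by (simp add: linear_flow_nth[of _ "Suc n"] continuous_intros)
  moreover have "isCont (\<lambda>v. soft_box (Suc n + 2) K a (linear_flow (- r) (ins i v z))) v"
    using DERIV_soft_box_ins[OF assms] by (rule DERIV_isCont)
  ultimately show ?thesis
    unfolding soft_box_grad_def by (intro continuous_intros) auto
qed

text \<open>The transport equation: moving \<open>r\<close> forward is the same as moving \<open>y\<close> against the velocity field.\<close>

lemma DERIV_soft_box_time:
  assumes y: "length y = N + 2"
  shows "((\<lambda>r. soft_box (N + 2) K a (linear_flow (- r) y)) has_field_derivative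
    - (\<Sum>l<N + 2. vel y l * soft_box_grad N K a r l y)) (at r)"
proof -
  let ?e = "\<lambda>k. exp (real K ^ 2 * (linear_flow (- r) y ! k - a k) - real K)"
  let ?F = "soft_box (N + 2) K a (linear_flow (- r) y)"
  have "((\<lambda>r. soft_box (N + 2) K a (linear_flow (- r) y)) has_field_derivative
    - ?F * (\<Sum>k<N + 2. ?e k * (real K ^ 2 * - (\<Sum>l<N + 2. flow_coeff N (- r) k l * vel y l)))) (at r)"
  proof (rule DERIV_soft_box)
    fix k assume k: "k < N + 2"
    have "(uminus has_field_derivative -1) (at r)" by (auto intro!: derivative_eq_intros)
    from DERIV_chain2[OF linear_flow_DERIV_coeff[OF y k] this]
    show "((\<lambda>r. linear_flow (- r) y ! k) has_field_derivative - (\<Sum>l<N + 2. flow_coeff N (- r) k l * vel y l)) (at r)" by simp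
  qed
  also have "- ?F * (\<Sum>k<N + 2. ?e k * (real K ^ 2 * - (\<Sum>l<N + 2. flow_coeff N (- r) k l * vel y l)))
    = (\<Sum>k<N + 2. \<Sum>l<N + 2. ?F * ?e k * real K ^ 2 * flow_coeff N (- r) k l * vel y l)"
    unfolding sum_distrib_left[of "- ?F"]
  proof (rule sum.cong[OF refl])
    fix k
    show "- ?F * (?e k * (real K ^ 2 * - (\<Sum>l<N + 2. flow_coeff N (- r) k l * vel y l)))
      = (\<Sum>l<N + 2. ?F * ?e k * real K ^ 2 * flow_coeff N (- r) k l * vel y l)"
      by (simp add: sum_distrib_left mult.assoc sum_negf)
  qed
  also have "\<dots> = (\<Sum>l<N + 2. \<Sum>k<N + 2. ?F * ?e k * real K ^ 2 * flow_coeff N (- r) k l * vel y l)"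
    by (rule sum.swap)
  also have "\<dots> = - (\<Sum>l<N + 2. vel y l * soft_box_grad N K a r l y)"
    unfolding sum_negf[symmetric]
  proof (rule sum.cong[OF refl])
    fix l
    show "(\<Sum>k<N + 2. ?F * ?e k * real K ^ 2 * flow_coeff N (- r) k l * vel y l) = - (vel y l * soft_box_grad N K a r l y)"
      by (simp add: soft_box_grad_def sum_distrib_left mult.assoc mult.left_commute[of "vel y l"] mult.commute[of "vel y l"] sum_negf)
  qed
  finally show ?thesis .
qed

section \<open>Smoothed boxes determine a measure\<close>

text \<open>The uniqueness theorem for measures is applied below to a finite sum of image measures with different
sources.\<close>

definition sum_measure :: "'i set \<Rightarrow> 'a measure \<Rightarrow> ('i \<Rightarrow> 'a measure) \<Rightarrow> 'a measure" where
  "sum_measure J N M = measure_of (space N) (sets N) (\<lambda>A. \<Sum>j\<in>J. emeasure (M j) A)"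

lemma sets_sum_measure [simp, measurable_cong]: "sets (sum_measure J N M) = sets N"
  by (simp add: sum_measure_def)

lemma space_sum_measure [simp]: "space (sum_measure J N M) = space N"
  by (simp add: sum_measure_def)

lemma emeasure_sum_measure:
  assumes "finite J" "\<And>j. j \<in> J \<Longrightarrow> sets (M j) = sets N" "A \<in> sets N"
  shows "emeasure (sum_measure J N M) A = (\<Sum>j\<in>J. emeasure (M j) A)"
proof (rule emeasure_measure_of[OF sum_measure_def])
  show "countably_additive (sets (sum_measure J N M)) (\<lambda>A. \<Sum>j\<in>J. emeasure (M j) A)"
  proof (rule countably_additiveI)
    fix F :: "nat \<Rightarrow> _" assume F: "range F \<subseteq> sets (sum_measure J N M)" "disjoint_family F"
    have "(\<Sum>i. \<Sum>j\<in>J. emeasure (M j) (F i)) = (\<Sum>j\<in>J. \<Sum>i. emeasure (M j) (F i))"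
      by (rule suminf_sum) simp
    also have "\<dots> = (\<Sum>j\<in>J. emeasure (M j) (\<Union>i. F i))"
      by (intro sum.cong refl suminf_emeasure) (use F assms in auto)
    finally show "(\<Sum>i. \<Sum>j\<in>J. emeasure (M j) (F i)) = (\<Sum>j\<in>J. emeasure (M j) (\<Union>i. F i))" .
  qed
qed (use assms sets.space_closed[of N] in \<open>auto simp: positive_def\<close>)

lemma nn_integral_sum_measure:
  assumes J: "finite J" and sets: "\<And>j. j \<in> J \<Longrightarrow> sets (M j) = sets N" and f: "f \<in> borel_measurable N"
  shows "(\<integral>\<^sup>+x. f x \<partial>sum_measure J N M) = (\<Sum>j\<in>J. \<integral>\<^sup>+x. f x \<partial>M j)"
  using f
proof (induction f rule: borel_measurable_induct)
  case (cong f g)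
  have "(\<integral>\<^sup>+x. f x \<partial>M j) = (\<integral>\<^sup>+x. g x \<partial>M j)" if "j \<in> J" for j
    by (rule nn_integral_cong) (use cong sets_eq_imp_space_eq[OF sets[OF that]] in auto)
  moreover have "(\<integral>\<^sup>+x. f x \<partial>sum_measure J N M) = (\<integral>\<^sup>+x. g x \<partial>sum_measure J N M)"
    by (rule nn_integral_cong) (use cong in auto)
  ultimately show ?case using cong by simp
next
  case (set A)
  then show ?case using emeasure_sum_measure[OF J sets] sets by simp
next
  case (mult u c)
  have "(\<integral>\<^sup>+x. c * u x \<partial>M j) = c * (\<integral>\<^sup>+x. u x \<partial>M j)" if "j \<in> J" for j
    by (rule nn_integral_cmult) (use mult measurable_cong_sets[OF sets[OF that] refl] in auto)
  moreover have "(\<integral>\<^sup>+x. c * u x \<partial>sum_measure J N M) = c * (\<integral>\<^sup>+x. u x \<partial>sum_measure J N M)"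
    by (rule nn_integral_cmult) (use mult in measurable)
  ultimately show ?case using mult by (simp add: sum_distrib_left)
next
  case (add u v)
  have "(\<integral>\<^sup>+x. v x + u x \<partial>M j) = (\<integral>\<^sup>+x. v x \<partial>M j) + (\<integral>\<^sup>+x. u x \<partial>M j)" if "j \<in> J" for j
    by (rule nn_integral_add) (simp_all add: measurable_cong_sets[OF sets[OF that] refl] add)
  moreover have "(\<integral>\<^sup>+x. v x + u x \<partial>sum_measure J N M) = (\<integral>\<^sup>+x. v x \<partial>sum_measure J N M) + (\<integral>\<^sup>+x. u x \<partial>sum_measure J N M)"
    by (rule nn_integral_add) (use add in measurable)
  ultimately show ?case using add by (simp add: sum.distrib)
next
  case (seq U)
  have mono: "incseq (\<lambda>i. \<integral>\<^sup>+x. U i x \<partial>M j)" for j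
    using seq(3) by (auto simp: incseq_def le_fun_def intro!: nn_integral_mono)
  have "(\<integral>\<^sup>+x. (\<Squnion> (range U)) x \<partial>M j) = (SUP i. \<integral>\<^sup>+x. U i x \<partial>M j)" if "j \<in> J" for j
    unfolding SUP_apply
    by (rule nn_integral_monotone_convergence_SUP) (simp_all add: measurable_cong_sets[OF sets[OF that] refl] seq)
  moreover have "(\<integral>\<^sup>+x. (\<Squnion> (range U)) x \<partial>sum_measure J N M) = (SUP i. \<integral>\<^sup>+x. U i x \<partial>sum_measure J N M)"
    unfolding SUP_apply
    by (rule nn_integral_monotone_convergence_SUP) (use seq in \<open>auto cong: measurable_cong_sets\<close>)
  moreover have "(SUP i. \<Sum>j\<in>J. \<integral>\<^sup>+x. U i x \<partial>M j) = (\<Sum>j\<in>J. SUP i. \<integral>\<^sup>+x. U i x \<partial>M j)"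
    by (rule ennreal_SUP_sum) (use mono in auto)
  ultimately show ?case using seq by simp
qed

definition lower_box :: "nat \<Rightarrow> (nat \<Rightarrow> real) \<Rightarrow> real list set" where
  "lower_box m a = {y. length y = m \<and> (\<forall>k<m. y ! k \<le> a k)}"

lemma lower_box_sets [measurable]: "lower_box m a \<in> sets particle_space"
  using particle_space_box[of m "\<lambda>k. {..a k}"] by (simp add: lower_box_def)

lemma soft_box_limit:
  assumes "length y = m"
  shows "(\<lambda>K. soft_box m K a y) \<longlonglongrightarrow> indicator (lower_box m a) y"
proof (cases "y \<in> lower_box m a")
  case True
  have "(\<lambda>K. exp (real K ^ 2 * (y ! k - a k) - real K)) \<longlonglongrightarrow> 0" if k: "k < m" for k
  proof (rule tendsto_sandwich[of "\<lambda>_. 0"])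
    have "y ! k \<le> a k" using True k by (auto simp: lower_box_def)
    then show "\<forall>\<^sub>F K in sequentially. exp (real K ^ 2 * (y ! k - a k) - real K) \<le> exp (- real K)"
      by (intro always_eventually) (auto intro: mult_nonneg_nonpos)
    show "(\<lambda>K. exp (- real K)) \<longlonglongrightarrow> 0" by real_asymp
  qed (auto intro: always_eventually)
  then have "(\<lambda>K. soft_box m K a y) \<longlonglongrightarrow> exp (- (\<Sum>k<m. 0))"
    unfolding soft_box_def by (intro tendsto_intros) auto
  then show ?thesis using True by simp
next
  case False
  then obtain k where k: "k < m" "a k < y ! k" using assms by (auto simp: lower_box_def not_le)
  define d where "d = y ! k - a k"
  have d: "0 < d" using k by (simp add: d_def)
  have "(\<lambda>K. soft_box m K a y) \<longlonglongrightarrow> 0"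
  proof (rule tendsto_sandwich[of "\<lambda>_. 0"])
    have "soft_box m K a y \<le> exp (- exp (real K ^ 2 * d - real K))" for K
    proof -
      have "exp (real K ^ 2 * d - real K) \<le> (\<Sum>k<m. exp (real K ^ 2 * (y ! k - a k) - real K))"
        unfolding d_def by (rule member_le_sum[of k _ "\<lambda>k. exp (real K ^ 2 * (y ! k - a k) - real K)"]) (use k in auto)
      then show ?thesis by (simp add: soft_box_def)
    qed
    then show "\<forall>\<^sub>F K in sequentially. soft_box m K a y \<le> exp (- exp (real K ^ 2 * d - real K))"
      by (intro always_eventually) auto
    show "(\<lambda>K. exp (- exp (real K ^ 2 * d - real K))) \<longlonglongrightarrow> 0" using d by real_asymp
    show "\<forall>\<^sub>F K in sequentially. 0 \<le> soft_box m K a y"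
      using soft_box_bounds(1) by (intro always_eventually) (auto intro: less_imp_le)
  qed simp
  then show ?thesis using False by simp
qed

text \<open>Sets that contain no list of length \<open>m\<close> are added to the generator. The measures below vanish on them, and they
take care of the lists of all other lengths.\<close>

lemma sets_particle_space_lower_boxes:
  fixes m :: nat
  defines "E \<equiv> range (lower_box m) \<union> {X \<in> sets particle_space. \<forall>y\<in>X. length y \<noteq> m}"
  shows "sets particle_space = sigma_sets UNIV E"
proof
  have E: "E \<subseteq> sets particle_space" by (auto simp: E_def)
  show "sigma_sets UNIV E \<subseteq> sets particle_space"
    using sets.sigma_sets_subset[OF E] by simp
  let ?S = "sigma UNIV E"
  have S: "sets ?S = sigma_sets UNIV E" by simp
  have inS: "X \<in> sets ?S" if "X \<in> E" for X using that by auto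
  have lb: "lower_box m a \<in> sets ?S" for a by (rule inS) (auto simp: E_def)
  have bounded: "\<exists>j::nat. \<forall>k<m. y ! k \<le> real j" for y :: "real list"
  proof -
    obtain j :: nat where "(\<Sum>k<m. \<bar>y ! k\<bar>) \<le> real j" using real_arch_simple by blast
    moreover have "y ! k \<le> (\<Sum>k<m. \<bar>y ! k\<bar>)" if "k < m" for k
      using member_le_sum[of k "{..<m}" "\<lambda>k. \<bar>y ! k\<bar>"] that by fastforce
    ultimately show ?thesis by (meson order_trans)
  qed
  have half: "{y. length y = m \<and> y ! k \<le> c} \<in> sets ?S" if "k < m" for k c
  proof -
    have "{y. length y = m \<and> y ! k \<le> c} = (\<Union>j::nat. lower_box m (\<lambda>i. if i = k then c else real j))"
    proof (intro equalityI subsetI)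
      fix y assume y: "y \<in> {y. length y = m \<and> y ! k \<le> c}"
      obtain j :: nat where "\<forall>k<m. y ! k \<le> real j" using bounded by blast
      then show "y \<in> (\<Union>j::nat. lower_box m (\<lambda>i. if i = k then c else real j))"
        using y by (intro UN_I[of j]) (auto simp: lower_box_def)
    qed (use that in \<open>auto simp: lower_box_def\<close>)
    also have "\<dots> \<in> sets ?S" using lb by (intro sets.countable_UN) auto
    finally show ?thesis .
  qed
  have len: "{y::real list. length y = m} \<in> sets ?S"
  proof -
    have "{y::real list. length y = m} = (\<Union>j::nat. lower_box m (\<lambda>i. real j))"
      using bounded by (auto simp: lower_box_def)
    also have "\<dots> \<in> sets ?S" using lb by (intro sets.countable_UN) auto
    finally show ?thesis .
  qed
  have coord: "{y. length y = m \<and> y ! k \<in> B} \<in> sets ?S" if k: "k < m" and B: "B \<in> sets borel" for k B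
  proof -
    have "B \<in> sigma_sets UNIV (range (\<lambda>a::real. {..a}))" using B by (simp add: borel_eq_atMost)
    then show ?thesis
    proof induction
      case (Basic B)
      then show ?case using half[OF k] by auto
    next
      case Empty
      have "{} \<in> sets ?S" by (rule sets.empty_sets)
      then show ?case by (simp add: sigma_sets.Empty)
    next
      case (Compl B)
      have "{y. length y = m \<and> y ! k \<in> UNIV - B} = {y. length y = m} - {y. length y = m \<and> y ! k \<in> B}" by auto
      moreover have "{y. length y = m} - {y. length y = m \<and> y ! k \<in> B} \<in> sets ?S"
        by (rule sets.Diff[OF len]) (use Compl.IH in simp)
      ultimately show ?case by simp
    next
      case (Union B)
      have "{y. length y = m \<and> y ! k \<in> \<Union> (range B)} = (\<Union>i. {y. length y = m \<and> y ! k \<in> B i})" by auto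
      moreover have "\<dots> \<in> sets ?S" using Union by (intro sets.countable_UN) auto
      ultimately show ?case by simp
    qed
  qed
  have "{ys. length ys = n \<and> (\<forall>i<n. ys ! i \<in> B i)} \<in> sigma_sets UNIV E" if B: "\<forall>i<n. B i \<in> sets borel" for n B
  proof (cases "n = m")
    case False
    then have "{ys. length ys = n \<and> (\<forall>i<n. ys ! i \<in> B i)} \<in> E"
      using particle_space_box[of n B] B by (auto simp: E_def)
    then show ?thesis by auto
  next
    case True
    have "{ys. length ys = m \<and> (\<forall>i<m. ys ! i \<in> B i)}
        = {y::real list. length y = m} - (\<Union>i\<in>{..<m}. {y. length y = m} - {y. length y = m \<and> y ! i \<in> B i})"
      by auto
    also have "\<dots> \<in> sets ?S"
      by (intro sets.Diff sets.finite_UN len coord) (use B True in auto)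
    finally show ?thesis using True by simp
  qed
  then have "{{ys. length ys = n \<and> (\<forall>i<n. ys ! i \<in> B i)} | n B. \<forall>i<n. B i \<in> sets borel} \<subseteq> sigma_sets UNIV E"
    by blast
  then have "sigma_sets UNIV {{ys. length ys = n \<and> (\<forall>i<n. ys ! i \<in> B i)} | n B. \<forall>i<n. B i \<in> sets borel} \<subseteq> sigma_sets UNIV E"
    by (rule sigma_sets_mono)
  then show "sets particle_space \<subseteq> sigma_sets UNIV E" by (simp add: particle_space_def)
qed

text \<open>By dominated convergence the measures agree on lower boxes, which are closed under intersection.\<close>

lemma measure_eqI_soft_box:
  assumes sets: "sets M = sets particle_space" "sets M' = sets particle_space"
    and fin: "emeasure M UNIV \<noteq> \<infinity>" "emeasure M' UNIV \<noteq> \<infinity>"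
    and len: "AE y in M. length y = m" "AE y in M'. length y = m"
    and eq: "\<And>K a. (\<integral>\<^sup>+y. ennreal (soft_box m K a y) \<partial>M) = (\<integral>\<^sup>+y. ennreal (soft_box m K a y) \<partial>M')"
  shows "M = M'"
proof -
  define E where "E = range (lower_box m) \<union> {X \<in> sets particle_space. \<forall>y\<in>X. length y \<noteq> m}"
  let ?A = "\<lambda>j. case j of 0 \<Rightarrow> {y. length y \<noteq> m} | Suc j \<Rightarrow> lower_box m (\<lambda>_. real j)"
  have lim: "(\<lambda>K. \<integral>\<^sup>+y. ennreal (soft_box m K a y) \<partial>L) \<longlonglongrightarrow> emeasure L (lower_box m a)"
    if [measurable_cong]: "sets L = sets particle_space" and "emeasure L UNIV \<noteq> \<infinity>" "AE y in L. length y = m" for L a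
  proof -
    have "space L = UNIV" using sets_eq_imp_space_eq[OF that(1)] by simp
    have "(\<lambda>K. \<integral>\<^sup>+y. ennreal (soft_box m K a y) \<partial>L) \<longlonglongrightarrow> (\<integral>\<^sup>+y. indicator (lower_box m a) y \<partial>L)"
    proof (rule nn_integral_dominated_convergence[where w = "\<lambda>_. 1"])
      show "AE y in L. (\<lambda>K. ennreal (soft_box m K a y)) \<longlonglongrightarrow> indicator (lower_box m a) y"
        using that(3)
      proof eventually_elim
        case (elim y)
        have "(\<lambda>K. ennreal (soft_box m K a y)) \<longlonglongrightarrow> ennreal (indicator (lower_box m a) y)"
          by (intro tendsto_ennrealI soft_box_limit elim)
        then show ?case by (simp add: ennreal_indicator)
      qed
      show "(\<integral>\<^sup>+y. 1 \<partial>L) < \<infinity>" using that(2) \<open>space L = UNIV\<close> by (simp add: less_top)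
    qed (auto simp: soft_box_bounds)
    then show ?thesis by simp
  qed
  have lower: "emeasure M (lower_box m a) = emeasure M' (lower_box m a)" for a
    using lim[OF sets(1) fin(1) len(1), of a] lim[OF sets(2) fin(2) len(2), of a]
    unfolding eq by (rule LIMSEQ_unique)
  have null: "emeasure L X = 0" if "AE y in L. length y = m" "sets L = sets particle_space"
    "X \<in> sets particle_space" "\<forall>y\<in>X. length y \<noteq> m" for L X
  proof -
    have "AE y in L. y \<notin> X" using that(1) by eventually_elim (use that(4) in auto)
    then show ?thesis using that by (subst (asm) AE_iff_measurable[where N = X]) (auto dest: sets_eq_imp_space_eq)
  qed
  show ?thesis
  proof (rule measure_eqI_generator_eq[where E = E and \<Omega> = UNIV and A = ?A])
    show "Int_stable E"
    proof (rule Int_stableI)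
      fix X Y assume X: "X \<in> E" and Y: "Y \<in> E"
      then have sets: "X \<inter> Y \<in> sets particle_space" by (auto simp: E_def)
      show "X \<inter> Y \<in> E"
      proof (cases "\<exists>y\<in>X \<inter> Y. length y = m")
        case False
        then show ?thesis using sets by (auto simp: E_def)
      next
        case True
        then obtain a b where "X = lower_box m a" "Y = lower_box m b" using X Y by (auto simp: E_def)
        then have "X \<inter> Y = lower_box m (\<lambda>k. min (a k) (b k))" by (auto simp: lower_box_def)
        then show ?thesis by (auto simp: E_def)
      qed
    qed
    show "emeasure M X = emeasure M' X" if "X \<in> E" for X
      using that lower null[OF len(1) sets(1)] null[OF len(2) sets(2)] by (auto simp: E_def)
    show "sets M = sigma_sets UNIV E" "sets M' = sigma_sets UNIV E"
      using sets sets_particle_space_lower_boxes[of m] by (simp_all add: E_def)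
    have "{y::real list. length y \<noteq> m} \<in> sets particle_space"
    proof -
      have "{y \<in> space particle_space. length y \<noteq> m} \<in> sets particle_space" by measurable
      then show ?thesis by simp
    qed
    then show "range ?A \<subseteq> E"
      by (auto simp: E_def split: nat.splits)
    show "\<Union> (range ?A) = UNIV"
    proof (intro equalityI subsetI UNIV_I)
      fix y :: "real list"
      show "y \<in> \<Union> (range ?A)"
      proof (cases "length y = m")
        case False
        then show ?thesis by (intro UN_I[of 0]) auto
      next
        case True
        obtain j :: nat where j: "(\<Sum>k<m. \<bar>y ! k\<bar>) \<le> real j" using real_arch_simple by blast
        have "y ! k \<le> real j" if "k < m" for k
          using member_le_sum[of k "{..<m}" "\<lambda>k. \<bar>y ! k\<bar>"] that j by fastforce
        then show ?thesis using True by (intro UN_I[of "Suc j"]) (auto simp: lower_box_def)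
      qed
    qed
    show "emeasure M (?A j) \<noteq> \<infinity>" for j
      using fin(1) emeasure_mono[of _ UNIV M] sets sets_eq_imp_space_eq[OF sets(1)] sets.top[of M]
      by (metis infinity_ennreal_def neq_top_trans space_particle_space top_greatest)
  qed auto
qed

section \<open>Transport of uniform measure by the backward flow\<close>

definition time_span :: "real \<Rightarrow> real measure" where
  "time_span t = restrict_space lborel {0..t}"

lemma space_time_span [simp]: "space (time_span t) = {0..t}"
  by (simp add: time_span_def space_restrict_space)

lemma finite_measure_time_span: "finite_measure (time_span t)"
  by (rule finite_measureI) (simp add: time_span_def emeasure_restrict_space space_restrict_space emeasure_lborel_Icc_eq)

interpretation time: finite_measure "time_span t" for t by (rule finite_measure_time_span)

lemma measurable_time_span [measurable]: "(\<lambda>x. x) \<in> measurable (time_span t) borel"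
  unfolding time_span_def by (rule measurable_restrict_space1) simp

lemma integral_time_span:
  fixes g :: "real \<Rightarrow> real"
  shows "(\<integral>v. g v \<partial>time_span t) = (\<integral>v. indicator {0..t} v * g v \<partial>lborel)"
  unfolding time_span_def by (subst integral_restrict_space) auto

lemma isCont_reflect:
  fixes g :: "real \<Rightarrow> real"
  assumes "isCont g (- r)"
  shows "isCont (\<lambda>r. g (- r)) r"
  by (rule isCont_o2[where f = uminus and g = g]) (simp_all add: assms)

lemma flow_coeff_bounded:
  obtains C where "\<And>r k l. r \<in> {0..t} \<Longrightarrow> k < n + 2 \<Longrightarrow> l < n + 2 \<Longrightarrow> \<bar>flow_coeff n (- r) k l\<bar> \<le> C"
proof -
  have bound: "\<exists>C. \<forall>r\<in>{0..t}. \<bar>flow_coeff n (- r) k l\<bar> \<le> C" if "k < n + 2" "l < n + 2" for k l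
  proof -
    have "continuous_on {0..t} (\<lambda>r. flow_coeff n (- r) k l)"
    proof (intro continuous_at_imp_continuous_on ballI)
      fix r
      show "isCont (\<lambda>r. flow_coeff n (- r) k l) r"
        by (rule isCont_reflect[OF flow_coeff_continuous[OF that]])
    qed
    then have "bounded ((\<lambda>r. flow_coeff n (- r) k l) ` {0..t})"
      by (intro compact_imp_bounded compact_continuous_image) auto
    then show ?thesis unfolding bounded_iff by auto
  qed
  define C where "C k l = (SOME C. \<forall>r\<in>{0..t}. \<bar>flow_coeff n (- r) k l\<bar> \<le> C)" for k l
  have C: "\<bar>flow_coeff n (- r) k l\<bar> \<le> C k l" if "k < n + 2" "l < n + 2" "r \<in> {0..t}" for k l r
    using someI_ex[OF bound[OF that(1,2)]] that(3) unfolding C_def by blast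
  have "\<bar>flow_coeff n (- r) k l\<bar> \<le> (\<Sum>k<n + 2. \<Sum>l<n + 2. \<bar>C k l\<bar>)" if "r \<in> {0..t}" "k < n + 2" "l < n + 2" for r k l
  proof -
    have "\<bar>flow_coeff n (- r) k l\<bar> \<le> \<bar>C k l\<bar>" using C[OF that(2,3,1)] by linarith
    also have "\<dots> \<le> (\<Sum>l<n + 2. \<bar>C k l\<bar>)" by (rule member_le_sum) (use that in auto)
    also have "\<dots> \<le> (\<Sum>k<n + 2. \<Sum>l<n + 2. \<bar>C k l\<bar>)"
      by (rule member_le_sum[of k _ "\<lambda>k. \<Sum>l<n + 2. \<bar>C k l\<bar>"]) (use that in \<open>auto intro: sum_nonneg\<close>)
    finally show ?thesis .
  qed
  then show thesis by (rule that)
qed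

lemma vel_bound:
  assumes y: "y \<in> Delta n" and that: "l < n + 2"
  shows "\<bar>vel y l\<bar> \<le> 4"
proof (cases "l = 0 \<or> l = n + 1")
  case True
  then show ?thesis using Delta_length[OF y] by (auto simp: vel_def)
next
  case False
  show ?thesis
  proof -
    have "0 \<le> y ! l" "y ! l \<le> 1" "0 \<le> y ! (l - 1)" "y ! (l - 1) \<le> 1" "0 \<le> y ! (l + 1)" "y ! (l + 1) \<le> 1"
      using that False Delta_bounds[OF y] by auto
    then show ?thesis unfolding vel_def by (auto simp: abs_le_iff)
  qed
qed

text \<open>The outward flux of \<open>h \<circ> e\<^bsup>-rA\<^esup>\<close> through the boundary of the simplex with \<open>n + 1\<close> particles. A face
on which two moving particles coincide occurs twice, as the upper end for one coordinate and as the lower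
end for the next; its two weights are the gaps on both sides of the double particle.\<close>

definition face_integral :: "nat \<Rightarrow> (real list \<Rightarrow> real) \<Rightarrow> real \<Rightarrow> real" where
  "face_integral n h r = (\<Sum>i\<le>n. \<integral>z. indicator (Delta n) z * ((z ! (i + 1) - z ! i) *
        (h (linear_flow (- r) (ins i (z ! i) z)) + h (linear_flow (- r) (ins i (z ! (i + 1)) z)))) \<partial>iid_config n)"

text \<open>With \<open>N = n + 1\<close> and \<open>F r y = h (e\<^bsup>-rA\<^esup>y)\<close>, the derivative of \<open>-e\<^bsup>-2Nr\<^esup> F r y\<close> in \<open>r\<close> is
\<open>e\<^bsup>-2Nr\<^esup>\<close> times the divergence of \<open>y \<mapsto> F r y \<cdot> Ay\<close>, the exponential factor supplying exactly the term \<open>2N F\<close>.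
Integrate over \<open>r\<close> and \<open>y\<close>, exchange the integrals, and apply the divergence theorem at each \<open>r\<close>.\<close>

lemma soft_box_transport_identity:
  fixes a :: "nat \<Rightarrow> real" and K n :: nat and t :: real
  defines "h \<equiv> soft_box (Suc n + 2) K a"
  assumes t: "0 \<le> t"
  shows "(\<integral>y. indicator (Delta (Suc n)) y * h y \<partial>iid_config (Suc n))
    = (\<integral>y. indicator (Delta (Suc n)) y * (exp (- 2 * real (Suc n) * t) * h (linear_flow (- t) y)) \<partial>iid_config (Suc n))
    + (\<integral>r. exp (- 2 * real (Suc n) * r) * face_integral n h r \<partial>time_span t)"
proof -
  let ?N = "Suc n"
  define F where "F r y = h (linear_flow (- r) y)" for r y
  define D where "D r l y = soft_box_grad ?N K a r l y" for r l y
  define G where "G r y = exp (- 2 * real ?N * r) * (\<Sum>i\<le>n. 2 * F r y + vel y (Suc i) * D r (Suc i) y)" for r y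
  let ?d = "\<lambda>r i y. 2 * F r y + vel y (Suc i) * D r (Suc i) y"
  let ?k = "\<lambda>y. indicator (Delta ?N) y * (exp (- 2 * real ?N * t) * h (linear_flow (- t) y))"
  have h01: "0 < h x" "h x \<le> 1" for x using soft_box_bounds by (auto simp: h_def)
  have [measurable]: "h \<in> borel_measurable particle_space" unfolding h_def by measurable
  have [measurable]: "(\<lambda>p. F (fst p) (snd p)) \<in> borel_measurable (borel \<Otimes>\<^sub>M particle_space)"
    unfolding F_def by measurable
  have Dm [measurable]: "(\<lambda>p. D (fst p) l (snd p)) \<in> borel_measurable (borel \<Otimes>\<^sub>M particle_space)" if "l < ?N + 2" for l
  proof -
    have [measurable]: "(\<lambda>p. flow_coeff ?N (- fst p) k l) \<in> borel_measurable (borel \<Otimes>\<^sub>M particle_space)" if "k < ?N + 2" for k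
      by (rule measurable_flow_coeff) (use that \<open>l < ?N + 2\<close> in auto)
    show ?thesis unfolding D_def soft_box_grad_def by measurable
  qed
  have [measurable]: "(\<lambda>y. vel y l) \<in> borel_measurable particle_space" for l
    unfolding vel_def by measurable
  have Gm [measurable]: "(\<lambda>p. G (fst p) (snd p)) \<in> borel_measurable (borel \<Otimes>\<^sub>M particle_space)"
    unfolding G_def by measurable
  obtain C where C: "\<And>r k l. r \<in> {0..t} \<Longrightarrow> k < ?N + 2 \<Longrightarrow> l < ?N + 2 \<Longrightarrow> \<bar>flow_coeff ?N (- r) k l\<bar> \<le> C"
    using flow_coeff_bounded[of t ?N] by blast
  define B where "B = real (?N + 2) * (real K ^ 2 * \<bar>C\<bar>)"
  have DB: "\<bar>D r l y\<bar> \<le> B" if "r \<in> {0..t}" "l < ?N + 2" for r l y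
    unfolding D_def B_def by (rule soft_box_grad_bound) (use C[OF that(1) _ that(2)] in \<open>force intro: order_trans\<close>)
  have B0: "0 \<le> B" by (simp add: B_def)
  have GB: "\<bar>G r y\<bar> \<le> real (Suc n) * (2 + 4 * B)" if "r \<in> {0..t}" "y \<in> Delta ?N" for r y
  proof -
    have "\<bar>\<Sum>i\<le>n. ?d r i y\<bar> \<le> (\<Sum>i\<le>n. \<bar>?d r i y\<bar>)"
      by (rule sum_abs)
    also have "\<dots> \<le> (\<Sum>i\<le>n. 2 + 4 * B)"
    proof (rule sum_mono)
      fix i assume "i \<in> {..n}"
      then have "\<bar>vel y (Suc i) * D r (Suc i) y\<bar> \<le> 4 * B"
        unfolding abs_mult using vel_bound[OF that(2)] DB[OF that(1)] by (intro mult_mono) auto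
      moreover have "\<bar>2 * F r y\<bar> \<le> 2" using h01[of "linear_flow (- r) y"] by (simp add: F_def abs_le_iff)
      ultimately show "\<bar>?d r i y\<bar> \<le> 2 + 4 * B" by linarith
    qed
    finally have "\<bar>\<Sum>i\<le>n. ?d r i y\<bar> \<le> real (Suc n) * (2 + 4 * B)" by simp
    moreover have "exp (- 2 * real ?N * r) \<le> 1"
      using that mult_nonneg_nonneg[of "2 * real ?N" r] by (simp del: of_nat_Suc)
    ultimately have "exp (- 2 * real ?N * r) * \<bar>\<Sum>i\<le>n. ?d r i y\<bar> \<le> 1 * (real (Suc n) * (2 + 4 * B))"
      by (intro mult_mono) auto
    then show ?thesis by (simp add: G_def abs_mult)
  qed
  have pointwise: "h y - exp (- 2 * real ?N * t) * h (linear_flow (- t) y) = (\<integral>r. G r y \<partial>time_span t)"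
    if y: "y \<in> Delta ?N" for y
  proof -
    have l: "length y = ?N + 2" using y by (rule Delta_length)
    have "(\<integral>r. G r y \<partial>time_span t) = (\<integral>r. indicator {0..t} r *\<^sub>R G r y \<partial>lborel)"
      by (simp add: integral_time_span)
    also have "\<dots> = - exp (- 2 * real ?N * t) * F t y - (- exp (- 2 * real ?N * 0) * F 0 y)"
    proof (rule integral_FTC_Icc[OF t])
      fix r
      have sum: "(\<Sum>l<?N + 2. vel y l * D r l y) = (\<Sum>i\<le>n. vel y (Suc i) * D r (Suc i) y)"
      proof -
        have "(\<Sum>l<?N + 2. vel y l * D r l y) = (\<Sum>l\<in>Suc ` {..n}. vel y l * D r l y)"
          by (rule sum.mono_neutral_right) (auto simp: vel_def l image_iff Suc_le_eq less_Suc_eq gr0_conv_Suc)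
        then show ?thesis by (simp add: sum.reindex)
      qed
      have "((\<lambda>r. - exp (- 2 * real ?N * r) * F r y) has_field_derivative
          (- exp (- 2 * real ?N * r)) * - (\<Sum>l<?N + 2. vel y l * D r l y)
          + (2 * real ?N * exp (- 2 * real ?N * r)) * F r y) (at r)"
        unfolding F_def h_def D_def
        by (intro DERIV_mult' DERIV_soft_box_time[OF l]) (auto intro!: derivative_eq_intros simp: algebra_simps)
      also have "(- exp (- 2 * real ?N * r)) * - (\<Sum>l<?N + 2. vel y l * D r l y)
          + (2 * real ?N * exp (- 2 * real ?N * r)) * F r y = G r y"
        unfolding sum G_def by (simp add: sum.distrib algebra_simps)
      finally show "((\<lambda>r. - exp (- 2 * real ?N * r) * F r y) has_vector_derivative G r y) (at r within {0..t})"
        by (simp add: has_real_derivative_iff_has_vector_derivative has_vector_derivative_at_within)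
    next
      have c1: "isCont (\<lambda>r. linear_flow (- r) y ! k) r" if "k < ?N + 2" for k r
        by (rule isCont_reflect[OF linear_flow_continuous[OF l that]])
      have c2: "isCont (\<lambda>r. flow_coeff ?N (- r) k l) r" if "k < ?N + 2" "l < ?N + 2" for k l r
        by (rule isCont_reflect[OF flow_coeff_continuous[OF that]])
      have c3: "isCont (\<lambda>r. F r y) r" for r
        unfolding F_def h_def using DERIV_soft_box_time[OF l] by (rule DERIV_isCont)
      have "isCont (\<lambda>r. D r k y) r" if "k < ?N + 2" for k r
        using c3 unfolding D_def soft_box_grad_def F_def h_def
        by (intro continuous_intros c1 c2) (use that in auto)
      then show "continuous_on {0..t} (\<lambda>r. G r y)"
        unfolding G_def by (intro continuous_at_imp_continuous_on ballI continuous_intros c3) auto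
    qed
    finally show ?thesis using linear_flow_0[OF l] by (simp add: F_def)
  qed
  interpret pair_sigma_finite "time_span t" "iid_config ?N" by unfold_locales
  have int: "integrable (time_span t \<Otimes>\<^sub>M iid_config ?N) (\<lambda>(r, y). indicator (Delta ?N) y * G r y)"
  proof (rule finite_measure.integrable_const_bound)
    show "finite_measure (time_span t \<Otimes>\<^sub>M iid_config ?N)"
      by (intro finite_measure_pair_measure) unfold_locales
    show "AE p in time_span t \<Otimes>\<^sub>M iid_config ?N. norm (case p of (r, y) \<Rightarrow> indicator (Delta ?N) y * G r y) \<le> real (Suc n) * (2 + 4 * B)"
      by (rule AE_I2) (use GB B0 in \<open>auto simp: space_pair_measure indicator_def\<close>)
    have "(\<lambda>p. (fst p, snd p)) \<in> measurable (time_span t \<Otimes>\<^sub>M iid_config ?N) (borel \<Otimes>\<^sub>M particle_space)"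
      by (intro measurable_Pair measurable_compose[OF measurable_fst measurable_time_span]) measurable
    from measurable_compose[OF this Gm]
    have [measurable]: "(\<lambda>p. G (fst p) (snd p)) \<in> borel_measurable (time_span t \<Otimes>\<^sub>M iid_config ?N)" by simp
    have "(\<lambda>p. indicator (Delta ?N) (snd p) * G (fst p) (snd p)) \<in> borel_measurable (time_span t \<Otimes>\<^sub>M iid_config ?N)"
      by (intro borel_measurable_times borel_measurable_indicator') measurable
    then show "(\<lambda>(r, y). indicator (Delta ?N) y * G r y) \<in> borel_measurable (time_span t \<Otimes>\<^sub>M iid_config ?N)"
      by (simp add: split_beta')
  qed
  have hint: "integrable (iid_config ?N) (\<lambda>y. indicator (Delta ?N) y * h y)"
    by (rule integrable_iid_config_bounded[where C = 1]) (simp_all add: indicator_def abs_of_pos h01)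
  have hint2: "integrable (iid_config ?N) ?k"
  proof (rule integrable_iid_config_bounded[where C = 1])
    fix y
    have "exp (- 2 * real ?N * t) \<le> 1"
      using t mult_nonneg_nonneg[of "2 * real ?N" t] by (simp del: of_nat_Suc)
    then have "exp (- 2 * real ?N * t) * h (linear_flow (- t) y) \<le> 1 * 1"
      using h01[of "linear_flow (- t) y"] by (intro mult_mono) auto
    then show "\<bar>?k y\<bar> \<le> 1"
      using h01(1)[of "linear_flow (- t) y"] by (simp add: indicator_def abs_mult)
  qed measurable
  have "(\<integral>y. indicator (Delta ?N) y * h y \<partial>iid_config ?N)
      - (\<integral>y. ?k y \<partial>iid_config ?N)
    = (\<integral>y. indicator (Delta ?N) y * (\<integral>r. G r y \<partial>time_span t) \<partial>iid_config ?N)"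
    unfolding Bochner_Integration.integral_diff[OF hint hint2, symmetric]
    by (rule Bochner_Integration.integral_cong) (auto simp: indicator_def pointwise[symmetric])
  also have "\<dots> = (\<integral>y. \<integral>r. indicator (Delta ?N) y * G r y \<partial>time_span t \<partial>iid_config ?N)"
    by (rule Bochner_Integration.integral_cong) (auto simp: indicator_def)
  also have "\<dots> = (\<integral>r. \<integral>y. indicator (Delta ?N) y * G r y \<partial>iid_config ?N \<partial>time_span t)"
    using Fubini_integral[OF int] by simp
  also have "\<dots> = (\<integral>r. exp (- 2 * real ?N * r) * face_integral n h r \<partial>time_span t)"
  proof (rule Bochner_Integration.integral_cong[OF refl])
    fix r assume "r \<in> space (time_span t)"
    then have r: "r \<in> {0..t}" by simp
    have Fm: "F r \<in> borel_measurable particle_space" unfolding F_def by measurable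
    have Dmr: "D r l \<in> borel_measurable particle_space" if "l < ?N + 2" for l
      using measurable_compose[OF _ Dm[OF that], of "\<lambda>y. (r, y)" particle_space] by simp
    have bnd: "\<bar>F r y\<bar> \<le> max 1 B" "l < ?N + 2 \<Longrightarrow> \<bar>D r l y\<bar> \<le> max 1 B" for y l
      using h01[of "linear_flow (- r) y"] DB[OF r, of l y] by (auto simp: F_def max_def)
    have vb: "\<bar>indicator (Delta ?N) y * (?d r i y)\<bar> \<le> 2 + 4 * B" if "i \<le> n" for i y
    proof (cases "y \<in> Delta ?N")
      case True
      then have "\<bar>vel y (Suc i) * D r (Suc i) y\<bar> \<le> 4 * B"
        unfolding abs_mult using vel_bound[OF True] DB[OF r] that by (intro mult_mono) auto
      moreover have "\<bar>2 * F r y\<bar> \<le> 2" using h01[of "linear_flow (- r) y"] by (simp add: F_def abs_le_iff)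
      ultimately show ?thesis using True by simp
    qed (use B0 in simp)
    have "(\<integral>y. indicator (Delta ?N) y * G r y \<partial>iid_config ?N)
      = (\<integral>y. exp (- 2 * real ?N * r) * (\<Sum>i\<le>n. indicator (Delta ?N) y * (?d r i y)) \<partial>iid_config ?N)"
      unfolding G_def by (simp add: sum_distrib_left mult.left_commute)
    also have "\<dots> = exp (- 2 * real ?N * r) * (\<Sum>i\<le>n. \<integral>y. indicator (Delta ?N) y * (?d r i y) \<partial>iid_config ?N)"
    proof (subst integral_mult_right_zero, subst Bochner_Integration.integral_sum)
      fix i assume i: "i \<in> {..n}"
      have [measurable]: "D r (Suc i) \<in> borel_measurable particle_space" by (rule Dmr) (use i in auto)
      note [measurable] = Fm
      show "integrable (iid_config ?N) (\<lambda>y. indicator (Delta ?N) y * (?d r i y))"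
        by (rule integrable_iid_config_bounded[OF _ vb]) (use i in auto)
    qed simp
    also have "\<dots> = exp (- 2 * real ?N * r) * face_integral n h r"
      unfolding face_integral_def
    proof (intro arg_cong2[where f = "(*)"] refl sum.cong)
      fix i assume i: "i \<in> {..n}"
      have "(\<integral>y. indicator (Delta ?N) y * (?d r i y) \<partial>iid_config ?N)
        = (\<integral>z. indicator (Delta n) z * ((z ! (i + 1) - z ! i) * (F r (ins i (z ! i) z) + F r (ins i (z ! (i + 1)) z))) \<partial>iid_config n)"
      proof (intro divergence_coordinate[where C = "max 1 B"] Fm Dmr bnd)
        fix z v assume z: "z \<in> Delta n"
        show "((\<lambda>v. F r (ins i v z)) has_field_derivative D r (Suc i) (ins i v z)) (at v)"
          unfolding F_def D_def h_def by (rule DERIV_soft_box_ins[OF Delta_length[OF z]]) (use i in simp)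
        show "isCont (\<lambda>v. D r (Suc i) (ins i v z)) v"
          unfolding D_def by (rule isCont_soft_box_grad_ins[OF Delta_length[OF z]]) (use i in simp)
      qed (use i in auto)
      then show "(\<integral>y. indicator (Delta ?N) y * (?d r i y) \<partial>iid_config ?N)
        = (\<integral>z. indicator (Delta n) z * ((z ! (i + 1) - z ! i) *
        (h (linear_flow (- r) (ins i (z ! i) z)) + h (linear_flow (- r) (ins i (z ! (i + 1)) z)))) \<partial>iid_config n)"
        by (simp add: F_def)
    qed
    finally show "(\<integral>y. indicator (Delta ?N) y * G r y \<partial>iid_config ?N)
      = exp (- 2 * real ?N * r) * face_integral n h r" .
  qed
  finally show ?thesis by simp
qed

text \<open>The density of the face contributions at \<open>p = (r, z)\<close>: contraction of volume times the width of the gap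
of \<open>z\<close> into which the lost particle is put back.\<close>

definition face_weight :: "nat \<Rightarrow> nat \<Rightarrow> real \<times> real list \<Rightarrow> real" where
  "face_weight n i p = indicator (Delta n) (snd p) * (exp (- 2 * real (Suc n) * fst p) * (snd p ! (i + 1) - snd p ! i))"

text \<open>The parameter \<open>s \<in> {0, 1}\<close> selects the end of the gap after index \<open>i\<close> that is doubled.\<close>

definition face_flow :: "nat \<Rightarrow> nat \<Rightarrow> real \<times> real list \<Rightarrow> real list" where
  "face_flow i s p = linear_flow (- fst p) (ins i (snd p ! (i + s)) (snd p))"

lemma measurable_time_span_pair: "(\<lambda>p. p) \<in> measurable (time_span t \<Otimes>\<^sub>M iid_config n) (borel \<Otimes>\<^sub>M particle_space)"
proof -
  have "(\<lambda>p. (fst p, snd p)) \<in> measurable (time_span t \<Otimes>\<^sub>M iid_config n) (borel \<Otimes>\<^sub>M particle_space)"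
    by (intro measurable_Pair measurable_compose[OF measurable_fst measurable_time_span]) measurable
  then show ?thesis by simp
qed

lemma measurable_face_weight: "face_weight n i \<in> borel_measurable (time_span t \<Otimes>\<^sub>M iid_config n)"
proof -
  have "face_weight n i \<in> borel_measurable (borel \<Otimes>\<^sub>M particle_space)"
    unfolding face_weight_def by measurable
  from measurable_compose[OF measurable_time_span_pair this] show ?thesis .
qed

lemma measurable_face_flow: "face_flow i s \<in> measurable (time_span t \<Otimes>\<^sub>M iid_config n) particle_space"
proof -
  have "face_flow i s \<in> measurable (borel \<Otimes>\<^sub>M particle_space) particle_space"
    unfolding face_flow_def by measurable
  from measurable_compose[OF measurable_time_span_pair this] show ?thesis .
qed

lemma exp_decay_le_1: "0 \<le> r \<Longrightarrow> exp (- 2 * real m * r) \<le> 1"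
  using mult_nonneg_nonneg[of "2 * real m" r] by simp

lemma face_weight_bounds:
  assumes "p \<in> space (time_span t \<Otimes>\<^sub>M iid_config n)" "i \<le> n"
  shows "0 \<le> face_weight n i p" "face_weight n i p \<le> 1"
proof -
  have r: "0 \<le> fst p" using assms by (auto simp: space_pair_measure)
  have "0 \<le> face_weight n i p \<and> face_weight n i p \<le> 1"
  proof (cases "snd p \<in> Delta n")
    case True
    have g: "0 \<le> snd p ! (i + 1) - snd p ! i" "snd p ! (i + 1) - snd p ! i \<le> 1"
      using Delta_mono[OF True, of i "i + 1"] Delta_bounds[OF True, of i] Delta_bounds[OF True, of "i + 1"] assms(2) by auto
    have "exp (- 2 * real (Suc n) * fst p) * (snd p ! (i + 1) - snd p ! i) \<le> 1 * 1"
      by (intro mult_mono exp_decay_le_1 r g) auto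
    then show ?thesis using g True by (simp add: face_weight_def)
  qed (simp add: face_weight_def)
  then show "0 \<le> face_weight n i p" "face_weight n i p \<le> 1" by auto
qed

lemma soft_box_transport_nn:
  fixes a :: "nat \<Rightarrow> real" and K n :: nat and t :: real
  defines "h \<equiv> soft_box (Suc n + 2) K a"
  assumes t: "0 \<le> t"
  shows "(\<integral>\<^sup>+y. indicator (Delta (Suc n)) y * ennreal (h y) \<partial>iid_config (Suc n))
    = (\<integral>\<^sup>+y. indicator (Delta (Suc n)) y * ennreal (exp (- 2 * real (Suc n) * t)) * ennreal (h (linear_flow (- t) y)) \<partial>iid_config (Suc n))
    + (\<Sum>i\<le>n. \<Sum>s\<in>{0, 1}. \<integral>\<^sup>+p. ennreal (face_weight n i p) * ennreal (h (face_flow i s p)) \<partial>(time_span t \<Otimes>\<^sub>M iid_config n))"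
proof -
  let ?N = "Suc n"
  let ?T = "time_span t \<Otimes>\<^sub>M iid_config n"
  interpret pair_sigma_finite "time_span t" "iid_config n" by unfold_locales
  let ?k = "\<lambda>y. indicator (Delta ?N) y * (exp (- 2 * real ?N * t) * h (linear_flow (- t) y))"
  interpret T: finite_measure ?T by (intro finite_measure_pair_measure) unfold_locales
  have h01: "0 < h x" "h x \<le> 1" for x using soft_box_bounds by (auto simp: h_def)
  have hm [measurable]: "h \<in> borel_measurable particle_space" unfolding h_def by measurable
  define q where "q i s p = face_weight n i p * h (face_flow i s p)" for i s p
  have qm: "q i s \<in> borel_measurable ?T" for i s
    unfolding q_def
    by (intro borel_measurable_times measurable_face_weight measurable_compose[OF measurable_face_flow hm])
  have q01: "0 \<le> q i s p" "q i s p \<le> 1" if "p \<in> space ?T" "i \<le> n" for i s p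
  proof -
    show "0 \<le> q i s p" unfolding q_def using face_weight_bounds[OF that] h01(1) by (simp add: less_imp_le)
    have "q i s p \<le> 1 * 1" unfolding q_def using face_weight_bounds[OF that] h01 by (intro mult_mono) (auto intro: less_imp_le)
    then show "q i s p \<le> 1" by simp
  qed
  have qint: "integrable ?T (q i s)" if "i \<le> n" for i s
    by (rule T.integrable_const_bound[where B = 1]) (auto intro!: AE_I2 qm simp: q01 that abs_of_nonneg)
  have qnn: "(\<integral>\<^sup>+p. ennreal (face_weight n i p) * ennreal (h (face_flow i s p)) \<partial>?T) = ennreal (\<integral>p. q i s p \<partial>?T)" if "i \<le> n" for i s
  proof -
    have "(\<integral>\<^sup>+p. ennreal (face_weight n i p) * ennreal (h (face_flow i s p)) \<partial>?T) = (\<integral>\<^sup>+p. ennreal (q i s p) \<partial>?T)"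
      unfolding q_def using face_weight_bounds[OF _ that]
      by (intro nn_integral_cong) (simp add: ennreal_mult' h01 less_imp_le ennreal_mult)
    also have "\<dots> = ennreal (\<integral>p. q i s p \<partial>?T)"
      by (rule nn_integral_eq_integral[OF qint[OF that]]) (auto intro!: AE_I2 q01 that)
    finally show ?thesis .
  qed
  have qz: "integrable (iid_config n) (\<lambda>z. q i s (r, z))" if "r \<in> {0..t}" "i \<le> n" for r i s
    using measurable_compose[OF measurable_Pair1'[of r "time_span t" "iid_config n"] qm[of i s]] that
    by (intro iid.integrable_const_bound[where B = 1] AE_I2) (auto simp: q01 abs_of_nonneg space_pair_measure)
  have "(\<integral>r. exp (- 2 * real ?N * r) * face_integral n h r \<partial>time_span t)
    = (\<integral>r. (\<Sum>i\<le>n. \<Sum>s\<in>{0, 1}. \<integral>z. q i s (r, z) \<partial>iid_config n) \<partial>time_span t)"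
  proof (rule Bochner_Integration.integral_cong[OF refl])
    fix r assume "r \<in> space (time_span t)"
    then have r: "r \<in> {0..t}" by simp
    show "exp (- 2 * real ?N * r) * face_integral n h r
      = (\<Sum>i\<le>n. \<Sum>s\<in>{0, 1}. \<integral>z. q i s (r, z) \<partial>iid_config n)"
      unfolding face_integral_def sum_distrib_left
    proof (rule sum.cong[OF refl])
      fix i assume "i \<in> {..n}"
      then have i: "i \<le> n" by simp
      have "(\<Sum>s\<in>{0, 1}. \<integral>z. q i s (r, z) \<partial>iid_config n) = (\<integral>z. q i 0 (r, z) + q i 1 (r, z) \<partial>iid_config n)"
        using Bochner_Integration.integral_add[OF qz[OF r i, of 0] qz[OF r i, of 1]] by simp
      also have "\<dots> = (\<integral>z. exp (- 2 * real ?N * r) * (indicator (Delta n) z * ((z ! (i + 1) - z ! i) *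
        (h (linear_flow (- r) (ins i (z ! i) z)) + h (linear_flow (- r) (ins i (z ! (i + 1)) z))))) \<partial>iid_config n)"
        by (rule Bochner_Integration.integral_cong) (simp_all add: q_def face_weight_def face_flow_def algebra_simps)
      finally show "exp (- 2 * real ?N * r) * (\<integral>z. indicator (Delta n) z * ((z ! (i + 1) - z ! i) *
        (h (linear_flow (- r) (ins i (z ! i) z)) + h (linear_flow (- r) (ins i (z ! (i + 1)) z)))) \<partial>iid_config n)
        = (\<Sum>s\<in>{0, 1}. \<integral>z. q i s (r, z) \<partial>iid_config n)" by simp
    qed
  qed
  also have "\<dots> = (\<Sum>i\<le>n. \<Sum>s\<in>{0, 1}. \<integral>r. \<integral>z. q i s (r, z) \<partial>iid_config n \<partial>time_span t)"
  proof -
    have int: "integrable (time_span t) (\<lambda>r. \<integral>z. q i s (r, z) \<partial>iid_config n)" if "i \<in> {..n}" for i s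
      using integrable_fst'[OF qint[of i s]] that by simp
    have "(\<integral>r. (\<Sum>i\<le>n. \<Sum>s\<in>{0, 1}. \<integral>z. q i s (r, z) \<partial>iid_config n) \<partial>time_span t)
      = (\<Sum>i\<le>n. \<integral>r. (\<Sum>s\<in>{0, 1}. \<integral>z. q i s (r, z) \<partial>iid_config n) \<partial>time_span t)"
      by (intro Bochner_Integration.integral_sum Bochner_Integration.integrable_sum int)
    also have "\<dots> = (\<Sum>i\<le>n. \<Sum>s\<in>{0, 1}. \<integral>r. \<integral>z. q i s (r, z) \<partial>iid_config n \<partial>time_span t)"
      by (intro sum.cong refl Bochner_Integration.integral_sum int)
    finally show ?thesis .
  qed
  also have "\<dots> = (\<Sum>i\<le>n. \<Sum>s\<in>{0, 1}. \<integral>p. q i s p \<partial>?T)"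
    by (intro sum.cong refl integral_fst' qint) auto
  finally have faces: "(\<integral>r. exp (- 2 * real ?N * r) * face_integral n h r \<partial>time_span t)
    = (\<Sum>i\<le>n. \<Sum>s\<in>{0, 1}. \<integral>p. q i s p \<partial>?T)" .
  have bulk0: "(\<integral>\<^sup>+y. indicator (Delta ?N) y * ennreal (h y) \<partial>iid_config ?N) = ennreal (\<integral>y. indicator (Delta ?N) y * h y \<partial>iid_config ?N)"
  proof -
    have "(\<integral>\<^sup>+y. indicator (Delta ?N) y * ennreal (h y) \<partial>iid_config ?N) = (\<integral>\<^sup>+y. ennreal (indicator (Delta ?N) y * h y) \<partial>iid_config ?N)"
      by (rule nn_integral_cong) (simp add: indicator_def)
    also have "\<dots> = ennreal (\<integral>y. indicator (Delta ?N) y * h y \<partial>iid_config ?N)"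
      by (intro nn_integral_eq_integral integrable_iid_config_bounded[where C = 1])
        (measurable, simp_all add: indicator_def abs_of_pos h01 less_imp_le)
    finally show ?thesis .
  qed
  have bulkt: "(\<integral>\<^sup>+y. indicator (Delta ?N) y * ennreal (exp (- 2 * real ?N * t)) * ennreal (h (linear_flow (- t) y)) \<partial>iid_config ?N)
    = ennreal (\<integral>y. ?k y \<partial>iid_config ?N)"
  proof -
    have e: "exp (- 2 * real ?N * t) * h (linear_flow (- t) y) \<le> 1" for y
      using mult_mono[OF exp_decay_le_1[OF t, of ?N] h01(2)[of "linear_flow (- t) y"]] h01(1)[of "linear_flow (- t) y"]
      by simp
    have "(\<integral>\<^sup>+y. indicator (Delta ?N) y * ennreal (exp (- 2 * real ?N * t)) * ennreal (h (linear_flow (- t) y)) \<partial>iid_config ?N)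
      = (\<integral>\<^sup>+y. ennreal (?k y) \<partial>iid_config ?N)"
      by (rule nn_integral_cong) (simp add: indicator_def ennreal_mult h01 less_imp_le)
    also have "\<dots> = ennreal (\<integral>y. ?k y \<partial>iid_config ?N)"
    proof (intro nn_integral_eq_integral integrable_iid_config_bounded[where C = 1])
      fix y
      show "\<bar>?k y\<bar> \<le> 1"
        using e[of y] h01(1)[of "linear_flow (- t) y"] by (simp add: indicator_def abs_mult)
    qed (measurable, simp add: h01 less_imp_le indicator_def)
    finally show ?thesis .
  qed
  have q0: "0 \<le> (\<integral>p. q i s p \<partial>?T)" if "i \<le> n" for i s
    by (rule integral_nonneg_AE) (auto intro!: AE_I2 q01 that)
  have "ennreal (\<integral>y. indicator (Delta ?N) y * h y \<partial>iid_config ?N)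
    = ennreal ((\<integral>y. ?k y \<partial>iid_config ?N)
        + (\<Sum>i\<le>n. \<Sum>s\<in>{0, 1}. \<integral>p. q i s p \<partial>?T))"
    using soft_box_transport_identity[OF t, of n K a] unfolding faces[unfolded h_def] h_def by presburger
  also have "\<dots> = ennreal (\<integral>y. ?k y \<partial>iid_config ?N)
        + ennreal (\<Sum>i\<le>n. \<Sum>s\<in>{0, 1}. \<integral>p. q i s p \<partial>?T)"
  proof (rule ennreal_plus)
    show "0 \<le> (\<Sum>i\<le>n. \<Sum>s\<in>{0, 1}. \<integral>p. q i s p \<partial>?T)" by (intro sum_nonneg q0) simp
    show "0 \<le> (\<integral>y. ?k y \<partial>iid_config ?N)"
      by (intro integral_nonneg_AE AE_I2) (simp add: h01 less_imp_le)
  qed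
  also have "ennreal (\<Sum>i\<le>n. \<Sum>s\<in>{0, 1}. \<integral>p. q i s p \<partial>?T)
    = (\<Sum>i\<le>n. ennreal (\<Sum>s\<in>{0, 1}. \<integral>p. q i s p \<partial>?T))"
  proof (rule sum_ennreal[symmetric])
    fix i assume "i \<in> {..n}"
    then show "0 \<le> (\<Sum>s\<in>{0, 1}. \<integral>p. q i s p \<partial>?T)" by (intro sum_nonneg q0) simp
  qed
  also have "\<dots> = (\<Sum>i\<le>n. \<Sum>s\<in>{0, 1}. ennreal (\<integral>p. q i s p \<partial>?T))"
    by (intro sum.cong refl sum_ennreal[symmetric] q0) auto
  also have "\<dots> = (\<Sum>i\<le>n. \<Sum>s\<in>{0, 1}. \<integral>\<^sup>+p. ennreal (face_weight n i p) * ennreal (h (face_flow i s p)) \<partial>?T)"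
    by (intro sum.cong refl qnn[symmetric]) auto
  finally show ?thesis unfolding bulk0 bulkt .
qed

text \<open>Written as equality of the measures with density on the left and with image measures on the right, the identity
for smoothed boxes extends to all measurable functions.\<close>

lemma transport_formula:
  assumes t: "0 \<le> t" and f [measurable]: "f \<in> borel_measurable particle_space"
  shows "(\<integral>\<^sup>+y. indicator (Delta (Suc n)) y * f y \<partial>iid_config (Suc n))
    = (\<integral>\<^sup>+y. indicator (Delta (Suc n)) y * ennreal (exp (- 2 * real (Suc n) * t)) * f (linear_flow (- t) y) \<partial>iid_config (Suc n))
    + (\<Sum>i\<le>n. \<Sum>s\<in>{0, 1}. \<integral>\<^sup>+p. ennreal (face_weight n i p) * f (face_flow i s p) \<partial>(time_span t \<Otimes>\<^sub>M iid_config n))"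
proof -
  let ?N = "Suc n"
  let ?T = "time_span t \<Otimes>\<^sub>M iid_config n"
  \<comment> \<open>\<open>None\<close> stands for the trajectories without collision, \<open>Some (i, s)\<close> for those that start on a face.\<close>
  define J where "J = insert None (Some ` ({..n} \<times> {0, 1::nat}))"
  define e where "e = (\<lambda>y. indicator (Delta ?N) y * ennreal (exp (- 2 * real ?N * t)))"
  define M where "M = density (iid_config ?N) (indicator (Delta ?N))"
  define R where "R j = (case j of
       None \<Rightarrow> distr (density (iid_config ?N) e) particle_space (linear_flow (- t))
     | Some (i, s) \<Rightarrow> distr (density ?T (\<lambda>p. ennreal (face_weight n i p))) particle_space (face_flow i s))" for j
  interpret T: finite_measure ?T by (intro finite_measure_pair_measure) unfold_locales
  have [measurable]: "e \<in> borel_measurable particle_space" unfolding e_def by measurable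
  have [measurable]: "(indicator (Delta ?N) :: _ \<Rightarrow> ennreal) \<in> borel_measurable particle_space" by measurable
  have [measurable]: "linear_flow (- t) \<in> measurable particle_space particle_space" by measurable
  note [measurable] = measurable_face_weight measurable_face_flow
  have setsR: "sets (R j) = sets particle_space" for j by (auto simp: R_def split: option.splits)
  have fin: "finite J" by (simp add: J_def)
  have sumJ: "(\<Sum>j\<in>J. g j) = g None + (\<Sum>i\<le>n. \<Sum>s\<in>{0, 1}. g (Some (i, s)))" for g :: "_ \<Rightarrow> ennreal"
  proof -
    have "(\<Sum>x\<in>{..n} \<times> {0, 1::nat}. g (Some x)) = (\<Sum>i\<le>n. \<Sum>s\<in>{0, 1}. g (Some (i, s)))"
      unfolding sum.cartesian_product by (rule sum.cong) auto
    moreover have "(\<Sum>j\<in>J. g j) = g None + (\<Sum>x\<in>{..n} \<times> {0, 1::nat}. g (Some x))"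
      unfolding J_def by (subst sum.insert) (auto simp: sum.reindex simp del: insert_Times_insert)
    ultimately show ?thesis by simp
  qed
  have intM: "(\<integral>\<^sup>+y. g y \<partial>M) = (\<integral>\<^sup>+y. indicator (Delta ?N) y * g y \<partial>iid_config ?N)"
    if [measurable]: "g \<in> borel_measurable particle_space" for g
    unfolding M_def by (rule nn_integral_density) measurable
  have intNone: "(\<integral>\<^sup>+y. g y \<partial>R None) = (\<integral>\<^sup>+y. e y * g (linear_flow (- t) y) \<partial>iid_config ?N)"
    if [measurable]: "g \<in> borel_measurable particle_space" for g
    unfolding R_def by (simp add: nn_integral_distr nn_integral_density)
  have intSome: "(\<integral>\<^sup>+y. g y \<partial>R (Some (i, s))) = (\<integral>\<^sup>+p. ennreal (face_weight n i p) * g (face_flow i s p) \<partial>?T)"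
    if [measurable]: "g \<in> borel_measurable particle_space" for g i s
    unfolding R_def by (simp add: nn_integral_distr nn_integral_density)
  have intR: "(\<integral>\<^sup>+y. g y \<partial>sum_measure J particle_space R)
      = (\<integral>\<^sup>+y. e y * g (linear_flow (- t) y) \<partial>iid_config ?N)
      + (\<Sum>i\<le>n. \<Sum>s\<in>{0, 1}. \<integral>\<^sup>+p. ennreal (face_weight n i p) * g (face_flow i s p) \<partial>?T)"
    if g: "g \<in> borel_measurable particle_space" for g
    by (simp only: nn_integral_sum_measure[OF fin setsR g] sumJ intNone[OF g] intSome[OF g])
  have e1: "e y \<le> 1" for y
    using exp_decay_le_1[OF t, of ?N] by (simp add: e_def indicator_def)
  have "M = sum_measure J particle_space R"
  proof (rule measure_eqI_soft_box[where m = "?N + 2"])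
    show "sets M = sets particle_space" by (simp add: M_def)
    show "sets (sum_measure J particle_space R) = sets particle_space" by simp
    have "emeasure M UNIV = (\<integral>\<^sup>+y. 1 \<partial>M)" by (simp add: M_def)
    also have "\<dots> = (\<integral>\<^sup>+y. indicator (Delta ?N) y * 1 \<partial>iid_config ?N)" by (rule intM) simp
    also have "\<dots> \<le> (\<integral>\<^sup>+y. 1 \<partial>iid_config ?N)" by (rule nn_integral_mono) (simp add: indicator_def)
    finally show "emeasure M UNIV \<noteq> \<infinity>" using iid.emeasure_space_1[of ?N] by (auto simp: top_unique)
    have "(\<integral>\<^sup>+y. e y * 1 \<partial>iid_config ?N) \<le> (\<integral>\<^sup>+y. 1 \<partial>iid_config ?N)"
      by (rule nn_integral_mono) (simp add: e1)
    then have f1: "(\<integral>\<^sup>+y. e y * 1 \<partial>iid_config ?N) \<noteq> \<top>" using iid.emeasure_space_1[of ?N] by (auto simp: top_unique)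
    have f2: "(\<integral>\<^sup>+p. ennreal (face_weight n i p) * 1 \<partial>?T) \<noteq> \<top>" if "i \<le> n" for i
    proof -
      have "(\<integral>\<^sup>+p. ennreal (face_weight n i p) * 1 \<partial>?T) \<le> (\<integral>\<^sup>+p. 1 \<partial>?T)"
        by (rule nn_integral_mono) (use face_weight_bounds[OF _ that] in \<open>simp add: ennreal_le_1\<close>)
      also have "\<dots> = emeasure ?T (space ?T)" by simp
      finally show ?thesis using T.emeasure_finite by (auto simp: top_unique)
    qed
    have "emeasure (sum_measure J particle_space R) UNIV = (\<integral>\<^sup>+y. 1 \<partial>sum_measure J particle_space R)" by simp
    also have "\<dots> = (\<integral>\<^sup>+y. e y * 1 \<partial>iid_config ?N)
      + (\<Sum>i\<le>n. \<Sum>s\<in>{0, 1::nat}. \<integral>\<^sup>+p. ennreal (face_weight n i p) * 1 \<partial>?T)" by (rule intR) simp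
    also have "\<dots> \<noteq> \<top>" using f1 f2 by (simp add: ennreal_add_eq_top ennreal_mult_eq_top_iff)
    finally show "emeasure (sum_measure J particle_space R) UNIV \<noteq> \<infinity>" by simp
    show "AE y in M. length y = ?N + 2"
      unfolding M_def by (subst AE_density) (auto simp: indicator_def Delta_length)
    define g :: "real list \<Rightarrow> ennreal" where "g = indicator {y. length y \<noteq> ?N + 2}"
    have len_set: "{y::real list. length y \<noteq> ?N + 2} \<in> sets particle_space"
    proof -
      have "{y \<in> space particle_space. length y \<noteq> ?N + 2} \<in> sets particle_space" by measurable
      then show ?thesis by simp
    qed
    then have gm: "g \<in> borel_measurable particle_space" unfolding g_def by simp
    have z1: "e y * g (linear_flow (- t) y) = 0" for y
      by (auto simp: e_def g_def indicator_def dest: Delta_length)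
    have z2: "ennreal (face_weight n i p) * g (face_flow i s p) = 0" for i s p
    proof (cases "snd p \<in> Delta n")
      case True
      then have "length (ins i (snd p ! (i + s)) (snd p)) = ?N + 2" by (simp add: Delta_length)
      then show ?thesis by (simp add: g_def face_flow_def)
    qed (simp add: face_weight_def)
    have "emeasure (sum_measure J particle_space R) {y. length y \<noteq> ?N + 2} = (\<integral>\<^sup>+y. g y \<partial>sum_measure J particle_space R)"
      unfolding g_def using len_set by (subst nn_integral_indicator) auto
    also have "\<dots> = 0" by (simp add: intR[OF gm] z1 z2)
    finally show "AE y in sum_measure J particle_space R. length y = ?N + 2"
      using len_set by (intro AE_I'[of "{y. length y \<noteq> ?N + 2}"]) (auto simp: null_sets_def)
    show "(\<integral>\<^sup>+y. ennreal (soft_box (?N + 2) K a y) \<partial>M) = (\<integral>\<^sup>+y. ennreal (soft_box (?N + 2) K a y) \<partial>sum_measure J particle_space R)" for K a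
    proof -
      have m: "(\<lambda>y. ennreal (soft_box (?N + 2) K a y)) \<in> borel_measurable particle_space" by measurable
      show ?thesis unfolding intM[OF m] intR[OF m] soft_box_transport_nn[OF t] e_def ..
    qed
  qed
  then have "(\<integral>\<^sup>+y. f y \<partial>M) = (\<integral>\<^sup>+y. f y \<partial>sum_measure J particle_space R)" by simp
  then show ?thesis unfolding intM[OF f] intR[OF f] e_def .
qed

section \<open>Ties and sorting\<close>

lemma AE_unit_lborel_not_in:
  assumes "finite A"
  shows "AE v in unit_lborel. v \<notin> A"
proof -
  have "A \<in> null_sets lborel" using assms by (intro countable_imp_null_set_lborel countable_finite)
  then have "AE v in lborel. v \<notin> A" by (rule AE_not_in)
  then show ?thesis unfolding unit_lborel_def by (subst AE_restrict_space_iff) auto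
qed

lemma AE_iid_config_length: "AE z in iid_config n. length z = n + 2"
proof -
  have "{x \<in> space particle_space. length x = n + 2} \<in> sets particle_space" by measurable
  then show ?thesis unfolding iid_config_def by (subst AE_distr_iff) auto
qed

lemma AE_iid_config_distinct:
  assumes i: "i \<le> n"
  shows "AE y in iid_config (Suc n). \<forall>j\<le>n + 2. j \<noteq> Suc i \<longrightarrow> y ! j \<noteq> y ! Suc i"
proof (rule AE_iid_config_Suc[OF i])
  show "AE z in iid_config n. AE v in unit_lborel. \<forall>j\<le>n + 2. j \<noteq> Suc i \<longrightarrow> ins i v z ! j \<noteq> ins i v z ! Suc i"
    using AE_iid_config_length
  proof eventually_elim
    case (elim z)
    have "AE v in unit_lborel. v \<notin> set z" by (rule AE_unit_lborel_not_in) simp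
    then show ?case
    proof eventually_elim
      case (elim v)
      show ?case
      proof (intro allI impI)
        fix j assume j: "j \<le> n + 2" "j \<noteq> Suc i"
        have v: "ins i v z ! Suc i = v" using \<open>length z = n + 2\<close> i by (simp add: ins_nth)
        have "ins i v z ! j \<in> set z" using j i \<open>length z = n + 2\<close> by (auto simp: ins_nth)
        then show "ins i v z ! j \<noteq> ins i v z ! Suc i" using elim v by metis
      qed
    qed
  qed
qed measurable

text \<open>Two adjacent entries are never both extra particles when there is at least one particle, so one of them is an
independent uniform point that almost surely avoids all the others.\<close>

lemma AE_iid_config_Delta_open: "AE y in iid_config n. y \<in> Delta n \<longrightarrow> y \<in> Delta_open n"
proof (cases n)
  case 0
  have "Delta 0 \<subseteq> Delta_open 0" by (auto simp: Delta_iff Delta_open_iff)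
  then show ?thesis using 0 by auto
next
  case (Suc m)
  have "AE y in iid_config (Suc m). \<forall>i\<in>{..m}. \<forall>j\<le>m + 2. j \<noteq> Suc i \<longrightarrow> y ! j \<noteq> y ! Suc i"
    by (rule AE_finite_allI) (auto intro: AE_iid_config_distinct)
  then show ?thesis unfolding Suc
  proof eventually_elim
    case (elim y)
    show ?case
    proof
      assume y: "y \<in> Delta (Suc m)"
      have "y ! j < y ! (j + 1)" if j: "j \<le> Suc m" for j
      proof -
        have "y ! j \<noteq> y ! (j + 1)"
        proof (cases j)
          case 0
          then show ?thesis using elim[rule_format, of 0 0] by simp
        next
          case (Suc i)
          then show ?thesis using elim[rule_format, of i "j + 1"] j by force
        qed
        then show ?thesis using y j by (auto simp: Delta_iff order_less_le)
      qed
      then show "y \<in> Delta_open (Suc m)" using y by (auto simp: Delta_iff Delta_open_iff)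
    qed
  qed
qed

lemma particles_add_endpoints [simp]: "particles (add_endpoints ys) = ys"
  by (simp add: particles_def add_endpoints_def)

lemma particles_config [simp]: "particles (config n u) = map u [0..<n]"
  by (simp add: config_def)

lemma ins_add_endpoints:
  assumes "i \<le> length ps"
  shows "ins i v (add_endpoints ps) = add_endpoints (take i ps @ v # drop i ps)"
  using assms by (simp add: ins_def add_endpoints_def)

lemma add_endpoints_particles:
  assumes "x \<in> Delta n"
  shows "add_endpoints (particles x) = x"
proof -
  have l: "length x = n + 2" "x ! 0 = 0" "x ! (n + 1) = 1" using assms by (auto simp: Delta_def)
  then obtain a xs where x: "x = a # xs" by (cases x) auto
  then have xs: "length xs = n + 1" "xs \<noteq> []" "a = 0" using l by auto
  have "last xs = 1" using xs l(3) x by (simp add: last_conv_nth)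
  then show ?thesis using xs unfolding x by (simp add: particles_def add_endpoints_def) (metis append_butlast_last_id)
qed

lemma particles_ins_0:
  assumes "length z = n + 2"
  shows "particles (ins 0 v z) = v # particles z"
  using assms by (cases z) (auto simp: particles_def ins_def numeral_2_eq_2)

text \<open>Exactly one of the \<open>n + 1\<close> insertions of a new value \<open>v\<close> keeps the configuration ordered, namely the one that
sorting performs.\<close>

lemma insort_config_eq_sum:
  fixes f :: "real list \<Rightarrow> ennreal"
  assumes w: "w \<in> Delta n" and v: "v \<in> {0..1}" "v \<notin> set w"
  shows "f (add_endpoints (insort v (particles w)))
    = (\<Sum>i\<le>n. indicator (Delta (Suc n)) (ins i v w) * f (ins i v w))"
proof -
  let ?ps = "particles w"
  have l: "length w = n + 2" "sorted w" using w by (auto simp: Delta_def)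
  have lp: "length ?ps = n" using l by (simp add: particles_def)
  have in_w: "w ! j \<in> set w" if "j \<le> n + 1" for j using l that by simp
  \<comment> \<open>The right position is after the last entry that does not exceed \<open>v\<close>.\<close>
  define I where "I = {i. i \<le> n \<and> w ! i \<le> v}"
  have I: "finite I" "0 \<in> I" using w v by (auto simp: I_def Delta_iff)
  define i where "i = Max I"
  have "i \<in> I" unfolding i_def by (rule Max_in) (use I in auto)
  then have i: "i \<le> n" "w ! i \<le> v" by (auto simp: I_def)
  have vi: "v \<le> w ! (i + 1)"
  proof (cases "i = n")
    case True
    then show ?thesis using w v by (simp add: Delta_iff)
  next
    case False
    have "Suc i \<notin> I"
    proof
      assume "Suc i \<in> I"
      then have "Suc i \<le> i" unfolding i_def by (intro Max_ge I)
      then show False by simp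
    qed
    then show ?thesis using i False by (simp add: I_def)
  qed
  have other: "ins j v w \<notin> Delta (Suc n)" if j: "j \<le> n" "j \<noteq> i" for j
  proof
    assume "ins j v w \<in> Delta (Suc n)"
    then have vj: "w ! j \<le> v" "v \<le> w ! (j + 1)" using ins_in_Delta_iff[OF j(1)] by auto
    consider "j < i" | "i < j" using j by linarith
    then show False
    proof cases
      assume "j < i"
      then have "w ! (j + 1) \<le> w ! i" using Delta_mono[OF w, of "j + 1" i] i by simp
      then have "v = w ! i" using vj i by linarith
      then show False using v(2) in_w[of i] i by simp
    next
      assume "i < j"
      then have "w ! (i + 1) \<le> w ! j" using Delta_mono[OF w, of "i + 1" j] j by simp
      then have "v = w ! j" using vj vi by linarith
      then show False using v(2) in_w[of j] j by simp
    qed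
  qed
  have inD: "ins i v w \<in> Delta (Suc n)" using ins_in_Delta_iff[OF i(1)] w i vi by auto
  have w_eq: "w = add_endpoints ?ps" using add_endpoints_particles[OF w] by simp
  have ins_eq: "ins i v w = add_endpoints (take i ?ps @ v # drop i ?ps)"
    using ins_add_endpoints[of i ?ps v] i lp w_eq by metis
  have "sorted (take i ?ps @ v # drop i ?ps)"
    using inD unfolding ins_eq Delta_def by (simp add: add_endpoints_def sorted_append)
  moreover have "sorted ?ps" using l(2) by (metis w_eq add_endpoints_def sorted_append sorted_simps(2))
  moreover have "mset (take i ?ps @ v # drop i ?ps) = mset (v # ?ps)"
    by simp (metis append_take_drop_id mset_append)
  ultimately have "insort v ?ps = take i ?ps @ v # drop i ?ps"
    using properties_for_sort[of "take i ?ps @ v # drop i ?ps" "v # ?ps"] by (simp add: sorted_sort_id)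
  then have "f (add_endpoints (insort v ?ps)) = indicator (Delta (Suc n)) (ins i v w) * f (ins i v w)"
    using ins_eq inD by simp
  also have "\<dots> = (\<Sum>j\<in>{i}. indicator (Delta (Suc n)) (ins j v w) * f (ins j v w))"
    by (simp del: sum_indicator_mult)
  also have "\<dots> = (\<Sum>j\<le>n. indicator (Delta (Suc n)) (ins j v w) * f (ins j v w))"
    by (rule sum.mono_neutral_left) (use i other in auto)
  finally show ?thesis .
qed

text \<open>Inserting one more point into a sorted configuration, it falls into one of \<open>n + 1\<close> gaps. Each gap contributes the
same integral over ordered configurations, by exchangeability, and the factors multiply to \<open>n!\<close>.\<close>

lemma nn_integral_sort_iid_config:
  assumes "f \<in> borel_measurable particle_space"
  shows "(\<integral>\<^sup>+x. f (add_endpoints (sort (particles x))) \<partial>iid_config n)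
    = ennreal (fact n) * (\<integral>\<^sup>+x. indicator (Delta n) x * f x \<partial>iid_config n)"
  using assms
proof (induction n arbitrary: f)
  case 0
  have "AE x in iid_config 0. x = [0, 1]"
    unfolding iid_config_def
  proof (subst AE_distr_iff)
    have "{[0, 1]} = {x \<in> space particle_space. length x = 2 \<and> x ! 0 = 0 \<and> x ! 1 = (1::real)}"
      by (auto simp: numeral_2_eq_2 length_Suc_conv)
    also have "\<dots> \<in> sets particle_space" by measurable
    finally show "{x \<in> space particle_space. x = [0, 1::real]} \<in> sets particle_space" by simp
  qed (auto simp: config_def add_endpoints_def)
  moreover have "[0, 1] \<in> Delta 0" by (simp add: Delta_def)
  ultimately show ?case
    by (simp, intro nn_integral_cong_AE) (auto simp: particles_def add_endpoints_def elim!: eventually_mono)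
next
  case (Suc n)
  note [measurable] = Suc.prems
  define H where "H w = (\<integral>\<^sup>+v. f (add_endpoints (insort v (particles w))) \<partial>unit_lborel)" for w
  have id: "(\<lambda>p. (fst p, snd p)) \<in> measurable (particle_space \<Otimes>\<^sub>M unit_lborel) (particle_space \<Otimes>\<^sub>M borel)"
    by (intro measurable_Pair measurable_compose[OF measurable_snd measurable_unit_lborel]) measurable
  have "(\<lambda>p. f (add_endpoints (insort (snd p) (particles (fst p))))) \<in> borel_measurable (particle_space \<Otimes>\<^sub>M borel)"
    by measurable
  from measurable_compose[OF id this]
  have Hm: "H \<in> borel_measurable particle_space"
    unfolding H_def by (intro unit.borel_measurable_nn_integral) (simp add: split_beta')
  have "(\<integral>\<^sup>+x. f (add_endpoints (sort (particles x))) \<partial>iid_config (Suc n))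
    = (\<integral>\<^sup>+z. \<integral>\<^sup>+v. f (add_endpoints (sort (particles (ins 0 v z)))) \<partial>unit_lborel \<partial>iid_config n)"
    by (rule nn_integral_iid_config_Suc) measurable
  also have "\<dots> = (\<integral>\<^sup>+z. H (add_endpoints (sort (particles z))) \<partial>iid_config n)"
  proof (rule nn_integral_cong_AE)
    show "AE z in iid_config n. (\<integral>\<^sup>+v. f (add_endpoints (sort (particles (ins 0 v z)))) \<partial>unit_lborel)
      = H (add_endpoints (sort (particles z)))"
      using AE_iid_config_length by eventually_elim (simp add: H_def particles_ins_0)
  qed
  also have "\<dots> = ennreal (fact n) * (\<integral>\<^sup>+w. indicator (Delta n) w * H w \<partial>iid_config n)"
    by (rule Suc.IH[OF Hm])
  also have "(\<integral>\<^sup>+w. indicator (Delta n) w * H w \<partial>iid_config n)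
    = (\<integral>\<^sup>+w. (\<Sum>i\<le>n. \<integral>\<^sup>+v. indicator (Delta (Suc n)) (ins i v w) * f (ins i v w) \<partial>unit_lborel) \<partial>iid_config n)"
  proof (rule nn_integral_cong)
    fix w
    show "indicator (Delta n) w * H w = (\<Sum>i\<le>n. \<integral>\<^sup>+v. indicator (Delta (Suc n)) (ins i v w) * f (ins i v w) \<partial>unit_lborel)"
    proof (cases "w \<in> Delta n")
      case False
      then show ?thesis using ins_in_Delta_iff by (simp add: indicator_def)
    next
      case True
      have "AE v in unit_lborel. v \<notin> set w" by (rule AE_unit_lborel_not_in) simp
      then have "H w = (\<integral>\<^sup>+v. (\<Sum>i\<le>n. indicator (Delta (Suc n)) (ins i v w) * f (ins i v w)) \<partial>unit_lborel)"
        unfolding H_def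
      proof (intro nn_integral_cong_AE)
        show "AE v in unit_lborel. f (add_endpoints (insort v (particles w)))
            = (\<Sum>i\<le>n. indicator (Delta (Suc n)) (ins i v w) * f (ins i v w))"
          using \<open>AE v in unit_lborel. v \<notin> set w\<close> AE_space[of unit_lborel]
        proof eventually_elim
          case (elim v)
          then show ?case by (intro insort_config_eq_sum[OF True]) simp_all
        qed
      qed
      also have "\<dots> = (\<Sum>i\<le>n. \<integral>\<^sup>+v. indicator (Delta (Suc n)) (ins i v w) * f (ins i v w) \<partial>unit_lborel)"
      proof (rule nn_integral_sum)
        fix i
        have "(\<lambda>v. indicator (Delta (Suc n)) (ins i v w) * f (ins i v w)) \<in> borel_measurable borel" by measurable
        from measurable_compose[OF measurable_unit_lborel this]
        show "(\<lambda>v. indicator (Delta (Suc n)) (ins i v w) * f (ins i v w)) \<in> borel_measurable unit_lborel" .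
      qed
      finally show ?thesis using True by simp
    qed
  qed
  also have "\<dots> = (\<Sum>i\<le>n. \<integral>\<^sup>+w. \<integral>\<^sup>+v. indicator (Delta (Suc n)) (ins i v w) * f (ins i v w) \<partial>unit_lborel \<partial>iid_config n)"
  proof (rule nn_integral_sum)
    fix i
    have "(\<lambda>p. indicator (Delta (Suc n)) (ins i (snd p) (fst p)) * f (ins i (snd p) (fst p))) \<in> borel_measurable (particle_space \<Otimes>\<^sub>M borel)"
      by measurable
    from measurable_compose[OF id this]
    have "(\<lambda>w. \<integral>\<^sup>+v. indicator (Delta (Suc n)) (ins i v w) * f (ins i v w) \<partial>unit_lborel) \<in> borel_measurable particle_space"
      by (intro unit.borel_measurable_nn_integral) (simp add: split_beta')
    then show "(\<lambda>w. \<integral>\<^sup>+v. indicator (Delta (Suc n)) (ins i v w) * f (ins i v w) \<partial>unit_lborel) \<in> borel_measurable (iid_config n)"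
      by (simp cong: measurable_cong_sets)
  qed
  also have "\<dots> = (\<Sum>i\<le>n. \<integral>\<^sup>+y. indicator (Delta (Suc n)) y * f y \<partial>iid_config (Suc n))"
    by (intro sum.cong refl nn_integral_iid_config_Suc[symmetric]) (auto, measurable)
  also have "\<dots> = of_nat (Suc n) * (\<integral>\<^sup>+y. indicator (Delta (Suc n)) y * f y \<partial>iid_config (Suc n))" by simp
  also have "ennreal (fact n) * (of_nat (Suc n) * (\<integral>\<^sup>+y. indicator (Delta (Suc n)) y * f y \<partial>iid_config (Suc n)))
    = ennreal (fact (Suc n)) * (\<integral>\<^sup>+y. indicator (Delta (Suc n)) y * f y \<partial>iid_config (Suc n))"
  proof -
    have "ennreal (fact (Suc n)) = ennreal (fact n * real (Suc n))" by (simp add: mult.commute)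
    also have "\<dots> = ennreal (fact n) * of_nat (Suc n)"
      unfolding ennreal_of_nat_eq_real_of_nat by (rule ennreal_mult') simp
    finally have "ennreal (fact (Suc n)) = ennreal (fact n) * of_nat (Suc n)" .
    then show ?thesis by (simp only: mult.assoc)
  qed
  finally show ?case .
qed

lemma nn_integral_uniform_points_in_order:
  assumes [measurable]: "f \<in> borel_measurable particle_space"
  shows "(\<integral>\<^sup>+u. f (add_endpoints (in_order n u)) \<partial>uniform_points n)
    = ennreal (fact n) * (\<integral>\<^sup>+x. indicator (Delta n) x * f x \<partial>iid_config n)"
proof -
  have "(\<integral>\<^sup>+u. f (add_endpoints (in_order n u)) \<partial>uniform_points n)
    = (\<integral>\<^sup>+x. f (add_endpoints (sort (particles x))) \<partial>iid_config n)"
    unfolding iid_config_def by (subst nn_integral_distr) (auto simp: in_order_def)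
  then show ?thesis using nn_integral_sort_iid_config[OF assms] by simp
qed

section \<open>Recursion in the number of particles\<close>

lemma remdups_adj_duplicate: "remdups_adj (xs @ x # x # ys) = remdups_adj (xs @ x # ys)"
proof (induction xs rule: remdups_adj.induct)
  case (2 y)
  then show ?case by (cases ys) auto
qed auto

context
  fixes z :: "real list" and n i s :: nat
  assumes z: "z \<in> Delta_open n" and i: "i \<le> n" and s: "s \<in> {0, 1}"
begin

lemma duplicate_nth:
  assumes "j \<le> n + 2"
  shows "ins i v z ! j = (if j \<le> i then z ! j else if j = Suc i then v else z ! (j - 1))"
  using z i assms by (intro ins_nth) (auto simp: Delta_open_iff)

lemma open_less: "j \<le> n \<Longrightarrow> z ! j < z ! (Suc j)"
  using z by (simp add: Delta_open_iff)

lemma duplicate_gap: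
  assumes j: "j \<le> Suc n" and eq: "ins i (z ! (i + s)) z ! j = ins i (z ! (i + s)) z ! (j + 1)"
  shows "j = i + s"
proof (rule ccontr)
  assume ne: "j \<noteq> i + s"
  consider "j < i" | "j = i" "s = 1" | "j = Suc i" "s = 0" | "Suc i < j"
    using ne s by fastforce
  then show False
  proof cases
    case 1
    then show False using eq open_less[of j] i by (simp add: duplicate_nth numeral_2_eq_2)
  next
    case 2
    then show False using eq open_less[of i] i by (simp add: duplicate_nth numeral_2_eq_2)
  next
    case 3
    then show False using eq open_less[of i] i by (simp add: duplicate_nth numeral_2_eq_2)
  next
    case 4
    then obtain k where "j = Suc k" "Suc k \<le> Suc n" using j by (cases j) auto
    then show False using eq open_less[of k] 4 i by (simp add: duplicate_nth numeral_2_eq_2)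
  qed
qed

lemma duplicate_in_boundary: "ins i (z ! (i + s)) z \<in> Delta_boundary (Suc n)"
proof -
  have "ins i (z ! (i + s)) z \<in> Delta (Suc n)"
    using ins_in_Delta_iff[OF i] z Delta_open_subset s open_less[OF i] by (auto simp: less_imp_le)
  moreover have eq: "ins i (z ! (i + s)) z ! (i + s) = ins i (z ! (i + s)) z ! (i + s + 1)"
    using s i by (auto simp: duplicate_nth)
  moreover have "i + s \<le> Suc n" using s i by auto
  then have "ins i (z ! (i + s)) z \<notin> Delta_open (Suc n)" using eq unfolding Delta_open_iff by auto
  ultimately show ?thesis by (simp add: Delta_boundary_def)
qed

lemma duplicate_opens:
  assumes "0 < q"
  shows "linear_flow (- q) (ins i (z ! (i + s)) z) \<in> Delta_open (Suc n)"
proof (rule backward_flow_opens_gaps[OF _ assms])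
  let ?y = "ins i (z ! (i + s)) z"
  show "?y \<in> Delta (Suc n)" using duplicate_in_boundary by (simp add: Delta_boundary_def)
  fix j assume "j \<le> Suc n" "?y ! j = ?y ! (j + 1)"
  then have j: "j = i + s" by (rule duplicate_gap)
  consider "s = 0" | "s = 1" using s by auto
  then show "(0 < j \<and> ?y ! (j - 1) < ?y ! j) \<or> (j < Suc n \<and> ?y ! (j + 1) < ?y ! (j + 2))"
  proof cases
    case 1
    then show ?thesis using j i open_less[OF i] by (simp add: duplicate_nth numeral_2_eq_2)
  next
    case 2
    then show ?thesis using j i open_less[OF i] by (simp add: duplicate_nth numeral_2_eq_2)
  qed
qed

lemma remdups_adj_duplicate_config: "remdups_adj (ins i (z ! (i + s)) z) = z"
proof -
  have l: "length z = n + 2" "sorted_wrt (<) z" using z by (auto simp: Delta_open_def Delta_def)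
  have split: "z = take k z @ z ! k # drop (Suc k) z" if "k < n + 2" for k
    using id_take_nth_drop[of k z] that l by simp
  have "ins i (z ! (i + s)) z = take (i + s) z @ z ! (i + s) # z ! (i + s) # drop (Suc (i + s)) z"
    using s
  proof
    assume "s = 0"
    then show ?thesis using i l by (simp add: ins_def take_Suc_conv_app_nth)
  next
    assume "s \<in> {1}"
    then show ?thesis using i l by (simp add: ins_def Cons_nth_drop_Suc)
  qed
  then have "remdups_adj (ins i (z ! (i + s)) z) = remdups_adj z"
    using split[of "i + s"] i s by (auto simp: remdups_adj_duplicate)
  also have "\<dots> = z" using l by (simp add: remdups_adj_distinct strict_sorted_iff)
  finally show ?thesis .
qed

text \<open>The evolution along the backward trajectory of a face: by \<open>duplicate_opens\<close> there is no collision before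
the face is reached, and then the double entry is omitted.\<close>

lemma Phi_face_flow:
  assumes "0 \<le> r" "r \<le> t"
  shows "Phi t (face_flow i s (r, z)) = Phi (t - r) z"
  unfolding face_flow_def
  using Phi_after_collision[OF duplicate_in_boundary assms duplicate_opens] remdups_adj_duplicate_config by simp

end

text \<open>The evolution is only known to be measurable on the simplices, hence this totalised version.\<close>

definition Phi_upto :: "nat \<Rightarrow> real \<Rightarrow> real list \<Rightarrow> real list" where
  "Phi_upto n t x = (if (\<exists>k<n. x \<in> Delta k) \<and> 0 \<le> t then Phi t x else [])"

lemma measurable_Phi_upto [measurable (raw)]:
  assumes [measurable]: "f \<in> borel_measurable M" "g \<in> measurable M particle_space"
  shows "(\<lambda>x. Phi_upto n (f x) (g x)) \<in> measurable M particle_space"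
proof -
  have "(\<lambda>x. (f x, g x)) \<in> measurable M (borel \<Otimes>\<^sub>M particle_space)" by measurable
  from measurable_compose[OF this measurable_Phi_below[of n]]
  show ?thesis by (simp add: Phi_upto_def)
qed

lemma Phi_upto_eq: "x \<in> Delta k \<Longrightarrow> k < n \<Longrightarrow> 0 \<le> t \<Longrightarrow> Phi_upto n t x = Phi t x"
  by (auto simp: Phi_upto_def)

lemma AE_time_span_pos: "AE r in time_span t. r \<noteq> 0"
proof -
  have "AE r in lborel. r \<notin> {0::real}" by (intro AE_not_in countable_imp_null_set_lborel) simp
  then show ?thesis unfolding time_span_def by (subst AE_restrict_space_iff) auto
qed

text \<open>Up to the factor \<open>n!\<close>, this is the expectation of \<open>g\<close> after time \<open>t\<close>, starting with \<open>n\<close> uniform points.\<close>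

definition evolved :: "nat \<Rightarrow> real \<Rightarrow> (real list \<Rightarrow> ennreal) \<Rightarrow> ennreal" where
  "evolved n t g = (\<integral>\<^sup>+y. indicator (Delta n) y * g (Phi t y) \<partial>iid_config n)"

lemma measurable_evolved:
  assumes [measurable]: "g \<in> borel_measurable particle_space"
  shows "(\<lambda>r. evolved n (t - r) g) \<in> borel_measurable (time_span t)"
proof -
  have "(\<lambda>p. indicator (Delta n) (snd p) * g (Phi_upto (Suc n) (t - fst p) (snd p))) \<in> borel_measurable (borel \<Otimes>\<^sub>M particle_space)"
    by measurable
  from measurable_compose[OF measurable_time_span_pair this]
  have m: "(\<lambda>r. \<integral>\<^sup>+y. indicator (Delta n) y * g (Phi_upto (Suc n) (t - r) y) \<partial>iid_config n) \<in> borel_measurable (time_span t)"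
    by (intro iid.borel_measurable_nn_integral) (simp add: split_beta')
  have "evolved n (t - r) g = (\<integral>\<^sup>+y. indicator (Delta n) y * g (Phi_upto (Suc n) (t - r) y) \<partial>iid_config n)"
    if "r \<in> space (time_span t)" for r
    unfolding evolved_def
    by (rule nn_integral_cong) (use that in \<open>auto simp: indicator_def Phi_upto_eq[of _ n]\<close>)
  then show ?thesis using m by (rule measurable_cong[THEN iffD2])
qed

text \<open>Conditioning on the first collision. The flux weights over a point \<open>z\<close> telescope to twice the total length \<open>1\<close>
of the gaps of \<open>z\<close>, which is why the configuration after the collision is uniform again and independent of
the collision time.\<close>

lemma evolved_Suc:
  assumes t: "0 \<le> t" and g [measurable]: "g \<in> borel_measurable particle_space"
  shows "evolved (Suc n) t g
    = ennreal (exp (- 2 * real (Suc n) * t)) * evolved (Suc n) 0 g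
    + (\<integral>\<^sup>+r. ennreal (2 * exp (- 2 * real (Suc n) * r)) * evolved n (t - r) g \<partial>time_span t)"
proof -
  let ?N = "Suc n"
  let ?T = "time_span t \<Otimes>\<^sub>M iid_config n"
  let ?G = "\<lambda>p. ennreal (2 * exp (- 2 * real ?N * fst p)) * (indicator (Delta n) (snd p) * g (Phi_upto ?N (t - fst p) (snd p)))"
  let ?e = "exp (- 2 * real ?N * t)"
  interpret pair_sigma_finite "time_span t" "iid_config n" by unfold_locales
  define f where "f y = g (Phi_upto (Suc ?N) t y)" for y
  have fm [measurable]: "f \<in> borel_measurable particle_space" unfolding f_def by measurable
  have lhs: "(\<integral>\<^sup>+y. indicator (Delta ?N) y * f y \<partial>iid_config ?N) = evolved ?N t g"
    unfolding evolved_def f_def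
    by (rule nn_integral_cong) (use t in \<open>auto simp: indicator_def Phi_upto_eq[of _ ?N]\<close>)
  have start: "Phi 0 y = y" if "y \<in> Delta_open ?N" for y
    using Phi_before_collision[OF that, of 0] that by (simp add: Delta_open_iff)
  have bulk: "(\<integral>\<^sup>+y. indicator (Delta ?N) y * ennreal (?e) * f (linear_flow (- t) y) \<partial>iid_config ?N)
    = ennreal (?e) * evolved ?N 0 g"
  proof -
    have "(\<integral>\<^sup>+y. indicator (Delta ?N) y * ennreal (?e) * f (linear_flow (- t) y) \<partial>iid_config ?N)
      = (\<integral>\<^sup>+y. ennreal (?e) * (indicator (Delta ?N) y * g (Phi_upto (Suc ?N) 0 y)) \<partial>iid_config ?N)"
    proof (rule nn_integral_cong_AE)
      show "AE y in iid_config ?N. indicator (Delta ?N) y * ennreal (?e) * f (linear_flow (- t) y)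
        = ennreal (?e) * (indicator (Delta ?N) y * g (Phi_upto (Suc ?N) 0 y))"
        using AE_iid_config_Delta_open
      proof eventually_elim
        case (elim y)
        show ?case
        proof (cases "y \<in> Delta ?N")
          case True
          then have y: "y \<in> Delta_open ?N" using elim by blast
          have "f (linear_flow (- t) y) = g y"
            using Phi_before_collision[OF y t] Phi_upto_eq[OF backward_flow_Delta[OF True t], of "Suc ?N" t] t
            by (simp add: f_def)
          moreover have "Phi_upto (Suc ?N) 0 y = y" using Phi_upto_eq[OF True, of "Suc ?N" 0] start[OF y] by simp
          ultimately show ?thesis by (simp add: ac_simps)
        qed simp
      qed
    qed
    also have "\<dots> = ennreal (?e) * (\<integral>\<^sup>+y. indicator (Delta ?N) y * g (Phi_upto (Suc ?N) 0 y) \<partial>iid_config ?N)"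
      by (rule nn_integral_cmult) measurable
    also have "(\<integral>\<^sup>+y. indicator (Delta ?N) y * g (Phi_upto (Suc ?N) 0 y) \<partial>iid_config ?N) = evolved ?N 0 g"
      unfolding evolved_def by (rule nn_integral_cong) (auto simp: indicator_def Phi_upto_eq[of _ ?N])
    finally show ?thesis .
  qed
  have "(\<Sum>i\<le>n. \<Sum>s\<in>{0, 1}. \<integral>\<^sup>+p. ennreal (face_weight n i p) * f (face_flow i s p) \<partial>?T)
    = (\<integral>\<^sup>+p. (\<Sum>i\<le>n. \<Sum>s\<in>{0, 1}. ennreal (face_weight n i p) * f (face_flow i s p)) \<partial>?T)"
    by (subst nn_integral_sum; (subst nn_integral_sum)?)
      (auto intro!: borel_measurable_add borel_measurable_sum borel_measurable_times_ennreal measurable_compose[OF measurable_face_weight measurable_ennreal] measurable_compose[OF measurable_face_flow fm])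
  also have "\<dots> = (\<integral>\<^sup>+p. ?G p \<partial>?T)"
  proof (rule nn_integral_cong_AE)
    have "AE p in ?T. fst p \<noteq> 0 \<and> (snd p \<in> Delta n \<longrightarrow> snd p \<in> Delta_open n)"
    proof (rule AE_pair_measure)
      have "{p \<in> space (borel \<Otimes>\<^sub>M particle_space). fst p \<noteq> (0::real) \<and> (snd p \<in> Delta n \<longrightarrow> snd p \<in> Delta_open n)} \<in> sets (borel \<Otimes>\<^sub>M particle_space)"
        by measurable
      from measurable_sets[OF measurable_time_span_pair[of t n] this]
      show "{p \<in> space ?T. fst p \<noteq> 0 \<and> (snd p \<in> Delta n \<longrightarrow> snd p \<in> Delta_open n)} \<in> sets ?T"
        by (simp add: vimage_def Int_def space_pair_measure conj_ac)
      show "AE r in time_span t. AE z in iid_config n. fst (r, z) \<noteq> 0 \<and> (snd (r, z) \<in> Delta n \<longrightarrow> snd (r, z) \<in> Delta_open n)"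
        using AE_time_span_pos
      proof eventually_elim
        case (elim r)
        show ?case using AE_iid_config_Delta_open by eventually_elim (use elim in simp)
      qed
    qed
    then show "AE p in ?T. (\<Sum>i\<le>n. \<Sum>s\<in>{0, 1}. ennreal (face_weight n i p) * f (face_flow i s p))
      = ?G p"
      using AE_space
    proof eventually_elim
      case (elim p)
      obtain r z where p: "p = (r, z)" by (cases p)
      have r: "0 \<le> r" "r \<le> t" "0 < r" using elim p by (auto simp: space_pair_measure)
      show ?case
      proof (cases "z \<in> Delta n")
        case False
        then show ?thesis by (simp add: p face_weight_def)
      next
        case True
        then have z: "z \<in> Delta_open n" using elim p by simp
        have f: "f (face_flow i s p) = g (Phi (t - r) z)" if "i \<le> n" "s \<in> {0, 1}" for i s
        proof -
          have "face_flow i s p \<in> Delta ?N"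
            using duplicate_opens[OF z that r(3)] Delta_open_subset by (auto simp: face_flow_def p)
          then show ?thesis
            using Phi_face_flow[OF z that r(1,2)] t by (simp add: f_def p Phi_upto_eq[of _ ?N])
        qed
        have w: "0 \<le> face_weight n i p" if "i \<le> n" for i using face_weight_bounds elim that by blast
        have "(\<Sum>i\<le>n. \<Sum>s\<in>{0, 1}. ennreal (face_weight n i p) * f (face_flow i s p))
          = (\<Sum>i\<le>n. ennreal (2 * face_weight n i p) * g (Phi (t - r) z))"
        proof (rule sum.cong[OF refl])
          fix i assume "i \<in> {..n}"
          then have i: "i \<le> n" by simp
          have "ennreal (2 * face_weight n i p) = ennreal (face_weight n i p) + ennreal (face_weight n i p)"
            unfolding mult_2 by (rule ennreal_plus) (rule w[OF i])+
          then show "(\<Sum>s\<in>{0, 1}. ennreal (face_weight n i p) * f (face_flow i s p)) = ennreal (2 * face_weight n i p) * g (Phi (t - r) z)"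
            using f[OF i, of 0] f[OF i, of 1] by (simp add: distrib_right)
        qed
        also have "\<dots> = ennreal (\<Sum>i\<le>n. 2 * face_weight n i p) * g (Phi (t - r) z)"
          unfolding sum_distrib_right[symmetric] by (subst sum_ennreal) (auto simp: w)
        also have "(\<Sum>i\<le>n. 2 * face_weight n i p) = 2 * exp (- 2 * real ?N * r) * (\<Sum>i\<le>n. z ! Suc i - z ! i)"
          using True by (simp add: face_weight_def p sum_distrib_left mult.assoc)
        also have "(\<Sum>i\<le>n. z ! Suc i - z ! i) = 1"
          using True sum_lessThan_telescope[of "\<lambda>i. z ! i" "Suc n"] by (simp add: Delta_iff lessThan_Suc_atMost)
        finally show ?thesis using True r by (simp add: p Phi_upto_eq[of _ n])
      qed
    qed
  qed
  also have "\<dots> = (\<integral>\<^sup>+r. \<integral>\<^sup>+z. ?G (r, z) \<partial>iid_config n \<partial>time_span t)"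
  proof (rule iid.nn_integral_fst[symmetric])
    have "?G \<in> borel_measurable (borel \<Otimes>\<^sub>M particle_space)"
      by measurable
    from measurable_compose[OF measurable_time_span_pair this]
    show "?G \<in> borel_measurable ?T" .
  qed
  also have "\<dots> = (\<integral>\<^sup>+r. ennreal (2 * exp (- 2 * real ?N * r)) * evolved n (t - r) g \<partial>time_span t)"
  proof (rule nn_integral_cong)
    fix r assume "r \<in> space (time_span t)"
    then have r: "0 \<le> r" "r \<le> t" by auto
    have "(\<integral>\<^sup>+z. ennreal (2 * exp (- 2 * real ?N * r)) * (indicator (Delta n) z * g (Phi_upto ?N (t - r) z)) \<partial>iid_config n)
      = ennreal (2 * exp (- 2 * real ?N * r)) * (\<integral>\<^sup>+z. indicator (Delta n) z * g (Phi_upto ?N (t - r) z) \<partial>iid_config n)"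
      by (rule nn_integral_cmult) measurable
    also have "(\<integral>\<^sup>+z. indicator (Delta n) z * g (Phi_upto ?N (t - r) z) \<partial>iid_config n) = evolved n (t - r) g"
      unfolding evolved_def by (rule nn_integral_cong) (use r in \<open>auto simp: indicator_def Phi_upto_eq[of _ n]\<close>)
    finally show "(\<integral>\<^sup>+z. ?G (r, z) \<partial>iid_config n)
      = ennreal (2 * exp (- 2 * real ?N * r)) * evolved n (t - r) g" by simp
  qed
  finally show ?thesis using transport_formula[OF t fm, of n] unfolding lhs bulk by simp
qed

section \<open>The binomial law\<close>

lemma nn_integral_time_span:
  assumes "g \<in> borel_measurable borel"
  shows "(\<integral>\<^sup>+r. g r \<partial>time_span t) = (\<integral>\<^sup>+r. g r * indicator {0..t} r \<partial>lborel)"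
  unfolding time_span_def by (subst nn_integral_restrict_space) auto

text \<open>In terms of \<open>q = e\<^bsup>-2r\<^esup>\<close> and \<open>p = e\<^bsup>-2t\<^esup>\<close> the integrand is a multiple of \<open>p\<^sup>k q (q - p)\<^bsup>n-k\<^esup>\<close>, and
\<open>dq = -2q dr\<close>, so \<open>(q - p)\<^bsup>n-k+1\<^esup>\<close> is an antiderivative up to a constant.\<close>

lemma binomial_death_integral:
  assumes t: "0 \<le> t" and k: "k \<le> n"
  shows "(\<integral>\<^sup>+r. ennreal (2 * real (Suc n) * exp (- 2 * real (Suc n) * r)
        * (real (n choose k) * exp (- 2 * (t - r)) ^ k * (1 - exp (- 2 * (t - r))) ^ (n - k))) \<partial>time_span t)
    = ennreal (real (Suc n choose k) * exp (- 2 * t) ^ k * (1 - exp (- 2 * t)) ^ (Suc n - k))"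
proof -
  define p where "p = exp (- 2 * t)"
  define m where "m = n - k"
  have n: "n = k + m" "Suc n - k = Suc m" using k by (auto simp: m_def)
  let ?c = "real (Suc n choose k)"
  let ?f = "\<lambda>r. 2 * real (Suc n) * exp (- 2 * real (Suc n) * r)
        * (real (n choose k) * exp (- 2 * (t - r)) ^ k * (1 - exp (- 2 * (t - r))) ^ (n - k))"
  let ?F = "\<lambda>r. - ?c * p ^ k * (exp (- 2 * r) - p) ^ Suc m"
  have choose: "real (Suc n) * real (n choose k) = real (Suc m) * ?c"
  proof -
    have "(Suc n - k) * (Suc n choose k) = Suc n * (n choose k)"
      using binomial_absorb_comp[of "Suc n" k] by simp
    then show ?thesis unfolding n(2) by (metis of_nat_mult)
  qed
  have f_eq: "?f r = 2 * (real (Suc m) * ?c) * p ^ k * exp (- 2 * r) * (exp (- 2 * r) - p) ^ m" for r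
  proof -
    define q where "q = exp (- 2 * r)"
    have q: "q \<noteq> 0" by (simp add: q_def)
    have e: "exp (- 2 * (t - r)) = p / q" by (simp add: p_def q_def exp_diff[symmetric] algebra_simps)
    have qn: "exp (- 2 * real (Suc n) * r) = q ^ Suc n"
      unfolding q_def exp_of_nat_mult[symmetric] by (simp add: algebra_simps)
    have cancel: "q ^ Suc n * (p / q) ^ k * (1 - p / q) ^ m = p ^ k * q * (q - p) ^ m"
    proof -
      have "1 - p / q = (q - p) / q" using q by (simp add: field_simps)
      moreover have "q ^ Suc n = q ^ k * q ^ m * q" using n(1) by (simp add: power_add)
      ultimately show ?thesis using q by (simp add: power_divide)
    qed
    have "?f r = 2 * (real (Suc n) * real (n choose k)) * (q ^ Suc n * (p / q) ^ k * (1 - p / q) ^ m)"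
      unfolding e qn m_def[symmetric] by (simp only: mult_ac)
    then have "?f r = 2 * (real (Suc n) * real (n choose k)) * (p ^ k * q * (q - p) ^ m)"
      unfolding cancel .
    then show ?thesis unfolding choose by (simp add: q_def mult.assoc)
  qed
  have "(\<integral>\<^sup>+r. ennreal (?f r) \<partial>time_span t) = (\<integral>\<^sup>+r. ennreal (?f r) * indicator {0..t} r \<partial>lborel)"
    by (rule nn_integral_time_span) measurable
  also have "\<dots> = ennreal (?F t - ?F 0)"
  proof (rule nn_integral_FTC_Icc)
    show "?f \<in> borel_measurable borel" by measurable
    fix r assume r: "r \<in> {0..t}"
    have "((\<lambda>r. exp (- 2 * r) - p) has_field_derivative - 2 * exp (- 2 * r)) (at r)"
      by (auto intro!: derivative_eq_intros)
    from DERIV_cmult[OF DERIV_power_Suc[OF this, of m], of "- ?c * p ^ k"]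
    show "(?F has_field_derivative ?f r) (at r)"
      unfolding f_eq by (rule DERIV_cong) (simp add: algebra_simps)
    have "exp (- 2 * (t - r)) \<le> 1" using r by simp
    then show "0 \<le> ?f r" by (intro mult_nonneg_nonneg zero_le_power) auto
  qed (rule t)
  also have "?F t - ?F 0 = ?c * p ^ k * (1 - p) ^ Suc m" by (simp add: p_def)
  finally show ?thesis unfolding n(2) p_def .
qed

lemma Phi_Delta_0: "x \<in> Delta 0 \<Longrightarrow> Phi t x = x"
  by (subst Phi.simps) (simp add: Delta_def)

text \<open>Induction on the number of particles. No collision up to time \<open>t\<close> gives the term \<open>k = n\<close>; otherwise the
induction hypothesis is integrated over the time of the first collision.\<close>

lemma evolved_binomial:
  assumes t: "0 \<le> t" and g: "g \<in> borel_measurable particle_space"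
  shows "ennreal (fact n) * evolved n t g
    = (\<Sum>k\<le>n. ennreal (real (n choose k) * exp (- 2 * t) ^ k * (1 - exp (- 2 * t)) ^ (n - k))
        * (ennreal (fact k) * evolved k 0 g))"
  using t
proof (induction n arbitrary: t)
  case 0
  have "evolved 0 t g = evolved 0 0 g"
    unfolding evolved_def by (rule nn_integral_cong) (simp add: indicator_def Phi_Delta_0)
  then show ?case by simp
next
  case (Suc n)
  let ?N = "Suc n"
  let ?b = "\<lambda>n t k. real (n choose k) * exp (- 2 * t) ^ k * (1 - exp (- 2 * t)) ^ (n - k)"
  let ?U = "\<lambda>k. ennreal (fact k) * evolved k 0 g"
  let ?d = "\<lambda>r. ennreal (2 * exp (- 2 * real ?N * r))"
  let ?w = "\<lambda>r. 2 * real ?N * exp (- 2 * real ?N * r)"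
  have b0: "0 \<le> ?b m s k" if "0 \<le> s" for m s k
    using that by (intro mult_nonneg_nonneg zero_le_power) auto
  have "ennreal (fact ?N) * (\<integral>\<^sup>+r. ?d r * evolved n (t - r) g \<partial>time_span t)
    = (\<integral>\<^sup>+r. ennreal (fact ?N) * (?d r * evolved n (t - r) g) \<partial>time_span t)"
  proof (rule nn_integral_cmult[symmetric], rule borel_measurable_times_ennreal)
    have "?d \<in> borel_measurable borel" by measurable
    from measurable_compose[OF measurable_time_span this]
    show "?d \<in> borel_measurable (time_span t)" .
    show "(\<lambda>r. evolved n (t - r) g) \<in> borel_measurable (time_span t)" by (rule measurable_evolved[OF g])
  qed
  also have "\<dots> = (\<integral>\<^sup>+r. (\<Sum>k\<le>n. ennreal (?w r * ?b n (t - r) k) * ?U k) \<partial>time_span t)"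
  proof (rule nn_integral_cong)
    fix r assume "r \<in> space (time_span t)"
    then have r: "0 \<le> t - r" by simp
    have fact: "ennreal (fact ?N) * ?d r = ennreal (?w r) * ennreal (fact n)"
      by (subst (1 2) ennreal_mult'[symmetric]) (auto simp: algebra_simps)
    have "ennreal (fact ?N) * (?d r * evolved n (t - r) g)
      = ennreal (?w r) * (ennreal (fact n) * evolved n (t - r) g)"
      unfolding mult.assoc[symmetric] fact ..
    also have "\<dots> = (\<Sum>k\<le>n. ennreal (?w r) * (ennreal (?b n (t - r) k) * ?U k))"
      unfolding Suc.IH[OF r] sum_distrib_left ..
    also have "\<dots> = (\<Sum>k\<le>n. ennreal (?w r * ?b n (t - r) k) * ?U k)"
    proof (rule sum.cong[OF refl])
      fix k
      have "ennreal (?w r * ?b n (t - r) k)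
        = ennreal (?w r) * ennreal (?b n (t - r) k)"
        by (rule ennreal_mult[OF _ b0[OF r]]) simp
      then show "ennreal (?w r) * (ennreal (?b n (t - r) k) * ?U k)
        = ennreal (?w r * ?b n (t - r) k) * ?U k" by (simp only: mult.assoc)
    qed
    finally show "ennreal (fact ?N) * (?d r * evolved n (t - r) g)
      = (\<Sum>k\<le>n. ennreal (?w r * ?b n (t - r) k) * ?U k)" .
  qed
  also have "\<dots> = (\<Sum>k\<le>n. \<integral>\<^sup>+r. ennreal (?w r * ?b n (t - r) k) * ?U k \<partial>time_span t)"
  proof (rule nn_integral_sum)
    fix k
    have "(\<lambda>r. ennreal (?w r * ?b n (t - r) k) * ?U k) \<in> borel_measurable borel" by measurable
    from measurable_compose[OF measurable_time_span this]
    show "(\<lambda>r. ennreal (?w r * ?b n (t - r) k) * ?U k) \<in> borel_measurable (time_span t)" .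
  qed
  also have "\<dots> = (\<Sum>k\<le>n. ennreal (?b ?N t k) * ?U k)"
  proof (rule sum.cong[OF refl])
    fix k assume "k \<in> {..n}"
    then have k: "k \<le> n" by simp
    have "(\<lambda>r. ennreal (?w r * ?b n (t - r) k)) \<in> borel_measurable borel" by measurable
    from measurable_compose[OF measurable_time_span this]
    have "(\<integral>\<^sup>+r. ennreal (?w r * ?b n (t - r) k) * ?U k \<partial>time_span t)
      = (\<integral>\<^sup>+r. ennreal (?w r * ?b n (t - r) k) \<partial>time_span t) * ?U k"
      by (rule nn_integral_multc)
    then show "(\<integral>\<^sup>+r. ennreal (?w r * ?b n (t - r) k) * ?U k \<partial>time_span t) = ennreal (?b ?N t k) * ?U k"
      unfolding binomial_death_integral[OF Suc.prems k] .
  qed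
  finally have boundary: "ennreal (fact ?N) * (\<integral>\<^sup>+r. ?d r * evolved n (t - r) g \<partial>time_span t)
    = (\<Sum>k\<le>n. ennreal (?b ?N t k) * ?U k)" .
  have "exp (- 2 * real ?N * t) = ?b ?N t ?N"
    unfolding exp_of_nat_mult[symmetric] by (simp add: algebra_simps)
  then have bulk: "ennreal (fact ?N) * (ennreal (exp (- 2 * real ?N * t)) * evolved ?N 0 g) = ennreal (?b ?N t ?N) * ?U ?N"
    by (simp only: mult.left_commute)
  have "ennreal (fact ?N) * evolved ?N t g = ennreal (?b ?N t ?N) * ?U ?N + (\<Sum>k\<le>n. ennreal (?b ?N t k) * ?U k)"
    unfolding evolved_Suc[OF Suc.prems g] distrib_left boundary bulk ..
  also have "\<dots> = (\<Sum>k\<le>?N. ennreal (?b ?N t k) * ?U k)" by (simp only: sum.atMost_Suc add.commute)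
  finally show ?case .
qed

lemma measurable_in_order [measurable]: "in_order n \<in> measurable (uniform_points n) particle_space"
proof -
  have "(\<lambda>u. sort (map u [0..<n])) \<in> measurable (uniform_points n) particle_space"
  proof (rule measurable_sort_map)
    fix i assume "i < n"
    then have "(\<lambda>u. u i) \<in> measurable (uniform_points n) unit_lborel"
      unfolding uniform_points_eq by (intro measurable_component_singleton) simp
    from measurable_compose[OF this measurable_unit_lborel]
    show "(\<lambda>u. u i) \<in> borel_measurable (uniform_points n)" .
  qed
  then show ?thesis unfolding in_order_def .
qed

lemma add_endpoints_in_order_Delta:
  assumes "u \<in> space (uniform_points n)"
  shows "add_endpoints (in_order n u) \<in> Delta n"
proof -
  have "0 \<le> u i \<and> u i \<le> 1" if "i < n" for i
    using assms that by (auto simp: uniform_points_eq space_PiM PiE_iff)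
  then show ?thesis
    by (auto simp: Delta_def add_endpoints_def in_order_def sorted_append nth_append)
qed

lemma measurable_coarsening:
  assumes t: "0 \<le> t"
  shows "(\<lambda>u. particles (Phi t (add_endpoints (in_order n u)))) \<in> measurable (uniform_points n) particle_space"
proof -
  have "(\<lambda>u. Phi t (add_endpoints (in_order n u))) \<in> measurable (uniform_points n) particle_space"
    by (rule measurable_Phi[where n = n]) (use t in \<open>auto intro: add_endpoints_in_order_Delta\<close>)
  from measurable_compose[OF this measurable_particles] show ?thesis .
qed

lemma emeasure_coarsening:
  assumes t: "0 \<le> t" and X: "X \<in> sets particle_space"
  shows "emeasure (distr (uniform_points n) particle_space (\<lambda>u. particles (Phi t (add_endpoints (in_order n u))))) X
    = ennreal (fact n) * evolved n t (\<lambda>x. indicator X (particles x))"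
proof -
  let ?g = "\<lambda>x. indicator X (particles x) :: ennreal"
  have [measurable]: "?g \<in> borel_measurable particle_space" using X by measurable
  have "emeasure (distr (uniform_points n) particle_space (\<lambda>u. particles (Phi t (add_endpoints (in_order n u))))) X
    = (\<integral>\<^sup>+y. indicator X y \<partial>distr (uniform_points n) particle_space (\<lambda>u. particles (Phi t (add_endpoints (in_order n u)))))"
    using X by simp
  also have "\<dots> = (\<integral>\<^sup>+u. ?g (Phi t (add_endpoints (in_order n u))) \<partial>uniform_points n)"
    by (rule nn_integral_distr[OF measurable_coarsening[OF t]]) (use X in simp)
  also have "\<dots> = (\<integral>\<^sup>+u. ?g (Phi_upto (Suc n) t (add_endpoints (in_order n u))) \<partial>uniform_points n)"
    by (rule nn_integral_cong) (simp add: Phi_upto_eq[OF add_endpoints_in_order_Delta] t)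
  also have "\<dots> = ennreal (fact n) * (\<integral>\<^sup>+x. indicator (Delta n) x * ?g (Phi_upto (Suc n) t x) \<partial>iid_config n)"
    by (rule nn_integral_uniform_points_in_order) measurable
  also have "(\<integral>\<^sup>+x. indicator (Delta n) x * ?g (Phi_upto (Suc n) t x) \<partial>iid_config n) = evolved n t ?g"
    unfolding evolved_def by (rule nn_integral_cong) (use t in \<open>auto simp: indicator_def Phi_upto_eq[of _ n]\<close>)
  finally show ?thesis .
qed

lemma emeasure_uniform_config:
  assumes X: "X \<in> sets particle_space"
  shows "emeasure (uniform_config n) X = ennreal (fact n) * evolved n 0 (\<lambda>x. indicator X (particles x))"
proof -
  let ?g = "\<lambda>x. indicator X (particles x) :: ennreal"
  have gm [measurable]: "?g \<in> borel_measurable particle_space" using X by measurable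
  have "emeasure (uniform_config n) X = (\<integral>\<^sup>+y. indicator X y \<partial>uniform_config n)"
    using X by (simp add: uniform_config_def)
  also have "\<dots> = (\<integral>\<^sup>+u. ?g (add_endpoints (in_order n u)) \<partial>uniform_points n)"
    unfolding uniform_config_def using X by (subst nn_integral_distr) auto
  also have "\<dots> = ennreal (fact n) * (\<integral>\<^sup>+x. indicator (Delta n) x * ?g x \<partial>iid_config n)"
    by (rule nn_integral_uniform_points_in_order[OF gm])
  also have "(\<integral>\<^sup>+x. indicator (Delta n) x * ?g x \<partial>iid_config n) = evolved n 0 ?g"
    unfolding evolved_def
  proof (rule nn_integral_cong_AE)
    show "AE x in iid_config n. indicator (Delta n) x * ?g x = indicator (Delta n) x * ?g (Phi 0 x)"
      using AE_iid_config_Delta_open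
    proof eventually_elim
      case (elim x)
      then show ?case
        using Phi_before_collision[of x n 0] by (cases "x \<in> Delta n") (auto simp: Delta_length)
    qed
  qed
  finally show ?thesis .
qed

lemma uniform_config_subprob: "uniform_config \<in> measurable (measure_pmf p) (subprob_algebra particle_space)"
proof -
  have "uniform_config n \<in> space (subprob_algebra particle_space)" for n
    unfolding space_subprob_algebra uniform_config_def
    using prob_space_imp_subprob_space[OF prob_space.prob_space_distr[OF prob_space_uniform_points measurable_in_order]]
    by simp
  then show ?thesis by (auto simp: measurable_def)
qed

theorem theorem2p1:
  fixes n :: nat and t :: real
  assumes "0 \<le> t"
  shows "(\<lambda>u. particles (Phi t (add_endpoints (in_order n u))))
           \<in> measurable (uniform_points n) particle_space
       \<and> distr (uniform_points n) particle_space
           (\<lambda>u. particles (Phi t (add_endpoints (in_order n u))))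
         = measure_pmf (binomial_pmf n (exp (- 2 * t))) \<bind> uniform_config"
proof (intro conjI measure_eqI)
  let ?p = "exp (- 2 * t)"
  let ?B = "measure_pmf (binomial_pmf n ?p)"
  let ?D = "distr (uniform_points n) particle_space (\<lambda>u. particles (Phi t (add_endpoints (in_order n u))))"
  show "(\<lambda>u. particles (Phi t (add_endpoints (in_order n u)))) \<in> measurable (uniform_points n) particle_space"
    by (rule measurable_coarsening[OF assms])
  show "sets ?D = sets (?B \<bind> uniform_config)"
    by (subst sets_bind[where N = particle_space]) (auto simp: uniform_config_def)
  fix X assume "X \<in> sets ?D"
  then have X: "X \<in> sets particle_space" by simp
  let ?g = "\<lambda>x. indicator X (particles x) :: ennreal"
  have g: "?g \<in> borel_measurable particle_space" using X by measurable
  have p: "0 \<le> ?p" "?p \<le> 1" using assms by auto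
  have "emeasure (?B \<bind> uniform_config) X = (\<integral>\<^sup>+k. emeasure (uniform_config k) X \<partial>?B)"
    by (rule emeasure_bind[OF _ uniform_config_subprob X]) simp
  also have "\<dots> = (\<Sum>k\<le>n. emeasure (uniform_config k) X * ennreal (pmf (binomial_pmf n ?p) k))"
    by (rule nn_integral_measure_pmf_support) (use set_pmf_binomial_eq[OF p] in \<open>auto split: if_splits\<close>)
  also have "\<dots> = (\<Sum>k\<le>n. ennreal (real (n choose k) * ?p ^ k * (1 - ?p) ^ (n - k)) * (ennreal (fact k) * evolved k 0 ?g))"
    unfolding pmf_binomial[OF p] emeasure_uniform_config[OF X] by (intro sum.cong refl mult.commute)
  also have "\<dots> = emeasure ?D X"
    unfolding emeasure_coarsening[OF assms X] evolved_binomial[OF assms g] ..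
  finally show "emeasure ?D X = emeasure (?B \<bind> uniform_config) X" ..
qed

end
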